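(* The automorphism $g_2$ of $Y$ exchanges the interiors of $e_1$ and $e_3$, the interiors of $f_1$ and $f_3$, and the interiors of $h_1$ and $h_3$. Moreover $g_2$ maps the interiors of $e_2,f_2,h_2$ to themselves.
   Context: Work over $\mathbb{C}$. $W$ is a 3-dimensional vector space with basis $\{x,y,z\}$; $\mathbb{P}(V)$ is the space of lines in $V$. View elements $R$ of $\mathbb{C}^2\otimes\mathbb{C}^3\otimes W$ as $2\times 3$ matrices with entries in $W$; $(A,B)\in GL(2)\times GL(3)$ acts by $R\mapsto ARB^{-1}$. $Y$ is the GIT quotient of $\mathbb{P}(\mathbb{C}^2\otimes\mathbb{C}^3\otimes W)$ by this action; points of $Y$ are orbits $[R]$ of matrices whose three maximal minors are linearly independent in $S^2W$, and $[R]\mapsto H_R$ (the span of the minors) is a closed embedding $Y\hookrightarrow\mathrm{Gr}(3,S^2W)$. Points of $Y$ are denoted by $\langle a,b,c\rangle=H_R$. $Y$ is a smooth Fano 6-fold. The open $PGL(W)$-orbit $\mathcal{O}_6\subset Y$ of $\langle xy,xz,yz\rangle$ is identified with the set of unordered triples of non-collinear points of $\mathbb{P}(W^* )$ (the common zeros of the quadrics in $H_R\subset S^2W=H^0(\mathbb{P}(W^* ),\mathcal{O}(2))$). The automorphism $g_2$ is the extension to $Y$ of the following map on $\mathcal{O}_6$: to a triple of non-collinear points of $\mathbb{P}(W^* )$ associate the three lines joining pairs of them, viewed as three points of $\mathbb{P}(W)$, and then transport these to three points of $\mathbb{P}(W^* )$ by the isomorphism $W\cong W^*$ given by the bilinear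 form on $W$ with matrix $\begin{pmatrix}0&0&1\\0&1&0\\1&0&0\end{pmatrix}$ in the basis $\{x,y,z\}$. $\mathbb{G}_m$ acts on $Y$ through $t\mapsto(x\mapsto x,\ y\mapsto ty,\ z\mapsto t^3z)$ in $GL(W)$, with 13 fixed points; for a fixed point $R_0$ the cell is $C_{R_0}=\{R\in Y:\lim_{t\to\infty}t.R=R_0\}$. The closures $\overline{C_{R_0}}$ are denoted: $e_1,e_2,e_3$ for $R_0=\langle z^2,xz,xy\rangle,\langle z^2,yz,xy\rangle,\langle y^2,yz,xz\rangle$; $f_1,f_2,f_3$ for $\langle z^2,xz,x^2\rangle,\langle yz,xz,xy\rangle,\langle y^2,xy,yz\rangle$; $h_1,h_2,h_3$ for $\langle x^2,xz,yz\rangle,\langle x^2,xy,yz\rangle,\langle xy,xz,y^2\rangle$. The interior of such a closure means the corresponding open cell $C_{R_0}$. *)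

theory Defs
  imports "HOL-Analysis.Analysis"
begin

section \<open>The space of quadrics\<close>

text \<open>Elements of \<open>W\<close> are coordinate vectors in the basis \<open>x, y, z\<close>; elements of the dual space are
  coordinate vectors in the dual basis, so that \<open>dual_pair\<close> is the evaluation pairing.
  \<open>Sym\<^sup>2 W\<close> is the space of symmetric tensors inside \<open>W \<otimes> W\<close>.\<close>

type_synonym W = "complex^3"
type_synonym W_dual = "complex^3"
type_synonym W_tensor_W = "complex^(3 \<times> 3)"

definition x\<^sub>W :: W where "x\<^sub>W = axis 1 1"
definition y\<^sub>W :: W where "y\<^sub>W = axis 2 1"
definition z\<^sub>W :: W where "z\<^sub>W = axis 3 1"

definition dual_pair :: "W_dual \<Rightarrow> W \<Rightarrow> complex" where
  "dual_pair p w = (\<Sum>i\<in>UNIV. p $ i * w $ i)"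

definition sym_mult :: "W \<Rightarrow> W \<Rightarrow> W_tensor_W"  (infixl "\<odot>" 70) where
  "v \<odot> w = (\<chi> m. (v $ fst m * w $ snd m + w $ fst m * v $ snd m) / 2)"

definition quadric_eval :: "W_tensor_W \<Rightarrow> W_dual \<Rightarrow> complex" where
  "quadric_eval q p = (\<Sum>m\<in>UNIV. q $ m * p $ fst m * p $ snd m)"

definition net :: "W_tensor_W \<Rightarrow> W_tensor_W \<Rightarrow> W_tensor_W \<Rightarrow> W_tensor_W set"  ("\<langle>_, _, _\<rangle>") where
  "\<langle>a, b, c\<rangle> = vec.span {a, b, c}"

text \<open>The action of \<open>A \<in> GL(W)\<close> on \<open>Sym\<^sup>2 W\<close> induced by \<open>v \<odot> w \<mapsto> (A *v v) \<odot> (A *v w)\<close>.\<close>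

definition sym_act :: "complex^3^3 \<Rightarrow> W_tensor_W \<Rightarrow> W_tensor_W" where
  "sym_act A q = (\<chi> m. \<Sum>k\<in>UNIV. A $ fst m $ fst k * A $ snd m $ snd k * q $ k)"


section \<open>The variety \<open>Y\<close>\<close>

text \<open>An element of \<open>\<complex>\<^sup>2 \<otimes> \<complex>\<^sup>3 \<otimes> W\<close> is a matrix \<open>R\<close> with two rows and three columns and entries
  \<open>R $ i $ j\<close> in \<open>W\<close>. Arithmetic in the index type \<open>3\<close> is modulo 3, so \<open>minor R j\<close> is, with its
  cofactor sign, the minor obtained by deleting column \<open>j\<close>.\<close>

type_synonym W_matrix = "W^3^2"

definition minor :: "W_matrix \<Rightarrow> 3 \<Rightarrow> W_tensor_W" where
  "minor R j = R $ 1 $ (j + 1) \<odot> R $ 2 $ (j + 2) - R $ 1 $ (j + 2) \<odot> R $ 2 $ (j + 1)"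

definition lin_indep_triple :: "(3 \<Rightarrow> W_tensor_W) \<Rightarrow> bool" where
  "lin_indep_triple u \<longleftrightarrow> inj u \<and> vec.independent (range u)"

definition stable_matrices :: "W_matrix set" where
  "stable_matrices = {R. lin_indep_triple (minor R)}"

definition minor_net :: "W_matrix \<Rightarrow> W_tensor_W set" where
  "minor_net R = vec.span (range (minor R))"

text \<open>The orbit \<open>[R]\<close> is represented by the net \<open>minor_net R\<close>, i.e. \<open>Y\<close> is identified with its image
  under the closed embedding into the Grassmannian. Its topology and its structure of a variety are
  those of the geometric quotient \<open>minor_net : stable_matrices \<rightarrow> Y\<close>.\<close>

definition Y :: "W_tensor_W set set" where
  "Y = minor_net ` stable_matrices"

definition Y_topology :: "W_tensor_W set topology" where
  "Y_topology = topology (\<lambda>U. U \<subseteq> Y \<and>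
     openin (top_of_set stable_matrices) {R \<in> stable_matrices. minor_net R \<in> U})"

lemma openin_Y_topology:
  "openin Y_topology U \<longleftrightarrow> U \<subseteq> Y \<and>
     openin (top_of_set stable_matrices) {R \<in> stable_matrices. minor_net R \<in> U}"
proof -
  let ?P = "\<lambda>U. {R \<in> stable_matrices. minor_net R \<in> U}"
  let ?L = "\<lambda>U. U \<subseteq> Y \<and> openin (top_of_set stable_matrices) (?P U)"
  have "istopology ?L"
    unfolding istopology_def
  proof (intro conjI allI impI)
    fix S T assume ST: "?L S" "?L T"
    then show "S \<inter> T \<subseteq> Y" by blast
    have "?P (S \<inter> T) = ?P S \<inter> ?P T" by blast
    moreover have "openin (top_of_set stable_matrices) (?P S \<inter> ?P T)"
      by (rule openin_Int[OF conjunct2[OF ST(1)] conjunct2[OF ST(2)]])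
    ultimately show "openin (top_of_set stable_matrices) (?P (S \<inter> T))"
      by (rule ssubst)
  next
    fix K assume K: "\<forall>U\<in>K. ?L U"
    then show "\<Union>K \<subseteq> Y" by blast
    have "?P (\<Union>K) = (\<Union>U\<in>K. ?P U)" by blast
    moreover have "openin (top_of_set stable_matrices) (\<Union>U\<in>K. ?P U)"
      by (rule openin_Union, erule imageE, erule ssubst, rule conjunct2, erule K[rule_format])
    ultimately show "openin (top_of_set stable_matrices) (?P (\<Union>K))"
      by (rule ssubst)
  qed
  then show ?thesis
    unfolding Y_topology_def by (simp only: topology_inverse')
qed

lemma quotient_map_minor_net:
  "quotient_map (top_of_set stable_matrices) Y_topology minor_net"
proof -
  have "openin Y_topology Y"
  proof -
    have "{R \<in> stable_matrices. minor_net R \<in> Y} = stable_matrices"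
      by (auto simp: Y_def)
    then show ?thesis
      unfolding openin_Y_topology by (simp only: openin_subtopology_self subset_refl simp_thms)
  qed
  then have "Y \<subseteq> topspace Y_topology"
    by (rule openin_subset)
  moreover have "topspace Y_topology \<subseteq> Y"
    using openin_topspace[of Y_topology] by (simp only: openin_Y_topology)
  ultimately have top: "topspace Y_topology = Y"
    by blast
  show ?thesis
    unfolding quotient_map_def
  proof (intro conjI allI impI)
    show "minor_net ` topspace (top_of_set stable_matrices) = topspace Y_topology"
      by (simp only: top topspace_euclidean_subtopology Y_def)
  next
    fix U assume "U \<subseteq> topspace Y_topology"
    then show "openin (top_of_set stable_matrices)
        {R \<in> topspace (top_of_set stable_matrices). minor_net R \<in> U} = openin Y_topology U"
      by (simp only: top topspace_euclidean_subtopology openin_Y_topology simp_thms)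
  qed
qed


section \<open>Automorphisms of \<open>Y\<close>\<close>

inductive polynomial_fun :: "(W_matrix \<Rightarrow> complex) \<Rightarrow> bool" where
  const: "polynomial_fun (\<lambda>R. c)"
| coord: "polynomial_fun (\<lambda>R. R $ i $ j $ k)"
| add: "polynomial_fun f \<Longrightarrow> polynomial_fun g \<Longrightarrow> polynomial_fun (\<lambda>R. f R + g R)"
| mult: "polynomial_fun f \<Longrightarrow> polynomial_fun g \<Longrightarrow> polynomial_fun (\<lambda>R. f R * g R)"

text \<open>A morphism from the quotient \<open>Y\<close> to \<open>Y \<subseteq> Gr(3, Sym\<^sup>2 W)\<close> is a map whose composition with
  \<open>minor_net\<close> is a morphism from the open set of stable matrices to the Grassmannian, i.e. which
  Zariski-locally has a frame with regular entries. After clearing denominators, and multiplying by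
  a polynomial cutting out the complement of the neighbourhood, the frame \<open>F\<close> is polynomial on the
  whole space of matrices, and the neighbourhood can be taken to be the (Zariski open) locus where
  \<open>F\<close> is linearly independent.\<close>

definition Y_morphism :: "(W_tensor_W set \<Rightarrow> W_tensor_W set) \<Rightarrow> bool" where
  "Y_morphism g \<longleftrightarrow> g \<in> Y \<rightarrow> Y \<and>
     (\<forall>R\<^sub>0\<in>stable_matrices. \<exists>F :: W_matrix \<Rightarrow> 3 \<Rightarrow> W_tensor_W.
        (\<forall>a m. polynomial_fun (\<lambda>R. F R a $ m)) \<and>
        lin_indep_triple (F R\<^sub>0) \<and>
        (\<forall>R\<in>stable_matrices. lin_indep_triple (F R) \<longrightarrow>
            g (minor_net R) = vec.span (range (F R))))"

definition Y_automorphism :: "(W_tensor_W set \<Rightarrow> W_tensor_W set) \<Rightarrow> bool" where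
  "Y_automorphism g \<longleftrightarrow> bij_betw g Y Y \<and> Y_morphism g \<and> Y_morphism (inv_into Y g)"


section \<open>The open orbit and \<open>g\<^sub>2\<close>\<close>

text \<open>A point of \<open>\<P>(V)\<close> is represented by the corresponding line (one-dimensional subspace) of \<open>V\<close>.\<close>

definition open_orbit :: "W_tensor_W set set" where
  "open_orbit = {sym_act A ` \<langle>x\<^sub>W \<odot> y\<^sub>W, x\<^sub>W \<odot> z\<^sub>W, y\<^sub>W \<odot> z\<^sub>W\<rangle> | A. invertible A}"

definition common_zeros :: "W_tensor_W set \<Rightarrow> W_dual set set" where
  "common_zeros H = {vec.span {p} | p. p \<noteq> 0 \<and> (\<forall>q\<in>H. quadric_eval q p = 0)}"

text \<open>The lines of \<open>\<P>(W\<^sup>*)\<close> joining two points of \<open>T\<close>, first as planes in \<open>W\<^sup>*\<close>, then as points of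
  \<open>\<P>(W)\<close> (the linear forms vanishing on the line).\<close>

definition joining_lines :: "W_dual set set \<Rightarrow> W_dual set set" where
  "joining_lines T = {vec.span (l \<union> l') | l l'. l \<in> T \<and> l' \<in> T \<and> l \<noteq> l'}"

definition line_as_point :: "W_dual set \<Rightarrow> W set" where
  "line_as_point L = {w. \<forall>p\<in>L. dual_pair p w = 0}"

definition g2_form :: "complex^3^3" where
  "g2_form = vector [vector [0, 0, 1], vector [0, 1, 0], vector [1, 0, 0]]"

text \<open>The isomorphism \<open>W \<cong> W\<^sup>*\<close> sends \<open>w\<close> to the functional \<open>v \<mapsto> w\<^sup>T J v\<close>, where \<open>J\<close> is the symmetric
  matrix \<open>g2_form\<close>; in coordinates this is \<open>w \<mapsto> J w\<close>.\<close>

definition g2_triple :: "W_dual set set \<Rightarrow> W_dual set set" where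
  "g2_triple T = (\<lambda>L. (*v) g2_form ` line_as_point L) ` joining_lines T"

text \<open>Elements of \<open>open_orbit\<close> are determined by their common zeros, and \<open>open_orbit\<close> is dense, so
  \<open>is_g2\<close> determines \<open>g\<close> on \<open>Y\<close>.\<close>

definition is_g2 :: "(W_tensor_W set \<Rightarrow> W_tensor_W set) \<Rightarrow> bool" where
  "is_g2 g \<longleftrightarrow> Y_automorphism g \<and>
     (\<forall>H\<in>open_orbit. g H \<in> open_orbit \<and> common_zeros (g H) = g2_triple (common_zeros H))"


section \<open>The cells\<close>

definition torus :: "complex \<Rightarrow> complex^3^3" where
  "torus t = vector [vector [1, 0, 0], vector [0, t, 0], vector [0, 0, t ^ 3]]"

definition cell :: "W_tensor_W set \<Rightarrow> W_tensor_W set set" where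
  "cell H\<^sub>0 = {H \<in> Y. limitin Y_topology (\<lambda>t. sym_act (torus t) ` H) H\<^sub>0 at_infinity}"

text \<open>The interiors (open cells) of the closures \<open>e\<^sub>i, f\<^sub>i, h\<^sub>i\<close>.\<close>

definition interior_e1 where "interior_e1 = cell \<langle>z\<^sub>W \<odot> z\<^sub>W, x\<^sub>W \<odot> z\<^sub>W, x\<^sub>W \<odot> y\<^sub>W\<rangle>"
definition interior_e2 where "interior_e2 = cell \<langle>z\<^sub>W \<odot> z\<^sub>W, y\<^sub>W \<odot> z\<^sub>W, x\<^sub>W \<odot> y\<^sub>W\<rangle>"
definition interior_e3 where "interior_e3 = cell \<langle>y\<^sub>W \<odot> y\<^sub>W, y\<^sub>W \<odot> z\<^sub>W, x\<^sub>W \<odot> z\<^sub>W\<rangle>"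

definition interior_f1 where "interior_f1 = cell \<langle>z\<^sub>W \<odot> z\<^sub>W, x\<^sub>W \<odot> z\<^sub>W, x\<^sub>W \<odot> x\<^sub>W\<rangle>"
definition interior_f2 where "interior_f2 = cell \<langle>y\<^sub>W \<odot> z\<^sub>W, x\<^sub>W \<odot> z\<^sub>W, x\<^sub>W \<odot> y\<^sub>W\<rangle>"
definition interior_f3 where "interior_f3 = cell \<langle>y\<^sub>W \<odot> y\<^sub>W, x\<^sub>W \<odot> y\<^sub>W, y\<^sub>W \<odot> z\<^sub>W\<rangle>"

definition interior_h1 where "interior_h1 = cell \<langle>x\<^sub>W \<odot> x\<^sub>W, x\<^sub>W \<odot> z\<^sub>W, y\<^sub>W \<odot> z\<^sub>W\<rangle>"
definition interior_h2 where "interior_h2 = cell \<langle>x\<^sub>W \<odot> x\<^sub>W, x\<^sub>W \<odot> y\<^sub>W, y\<^sub>W \<odot> z\<^sub>W\<rangle>"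
definition interior_h3 where "interior_h3 = cell \<langle>x\<^sub>W \<odot> y\<^sub>W, x\<^sub>W \<odot> z\<^sub>W, y\<^sub>W \<odot> y\<^sub>W\<rangle>"

end

theory Submission
  imports Defs "HOL-Computational_Algebra.Fundamental_Theorem_Algebra"
begin

text \<open>A stable matrix is a three-dimensional subspace of \<open>\<complex>\<^sup>2 \<otimes> W\<close>, spanned by its columns, and \<open>g\<^sub>2\<close>
  sends it to its annihilator with respect to the standard form on \<open>\<complex>\<^sup>2\<close> tensored with the form \<open>J\<close> on
  \<open>W\<close>: for a generic matrix this is seen on the triangle of common zeros, and a morphism is determined by
  its values on generic matrices. Hence \<open>g\<^sub>2\<close> is a continuous involution of \<open>Y\<close>, and it conjugates the
  torus with weights \<open>(0, 1, 3)\<close> into the one with weights \<open>(0, 2, 3)\<close>. It remains to see that both tori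
  have the same cells at the fixed points in question. A net in such a cell has a reduced basis
  with prescribed leading monomials; conversely a net with such a basis converges to the fixed point, as the
  matrix can be recovered continuously from the linear syzygies of the net. The two orders on monomials
  differ only in \<open>y\<^sup>2\<close> and \<open>xz\<close>, and the existence of two independent syzygies excludes the reduced bases
  on which this matters.\<close>

section \<open>Minors and stability\<close>

text \<open>Why annihilators occur: up to column operations a generic matrix is a pencil with rows
  \<open>A\<close> and \<open>A diag(c)\<close>. Its net is spanned by products of pairs of columns
  of \<open>A\<close>; these columns are the sides of the triangle of common zeros, and the rows of
  the inverse of \<open>A\<close> are its vertices. Passing to the sides and applying J replaces
  \<open>A\<close> by its contragredient twisted by J, and the annihilator of the pencil is
  diagonalised by exactly this matrix. Triangles degenerate outside the open orbit, whereas
  annihilators make sense for every stable matrix. J pairs x with z and y with itself, so weights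
  (a, b, c) with total n = 3 turn into (3 - c, 3 - b, 3 - a), and limits are still taken at
  infinity. But \<open>g\<close> does not map the given torus to itself, so the assertion is not
  formal: the cells of two different tori must be compared at each fixed point. Since
  \<open>Y\<close> carries a quotient topology, convergence of the three quadrics alone proves
  nothing; it has to be lifted to stable matrices.\<close>

lemma index3_simps [simp]: "(1::3) + 1 = 2" "(1::3) + 2 = 3" "(2::3) + 1 = 3" "(2::3) + 2 = 1" "(3::3) + 1 = 1" "(3::3) + 2 = 2"
  "(4::3) = 1" "(5::3) = 2" "(6::3) = 3"
  by auto

section \<open>Spans and independence of triples of vectors\<close>

lemma span_range3:
  fixes u :: "3 \<Rightarrow> complex^'n"
  shows "vec.span (range u) = {\<Sum>j\<in>UNIV. k j *s u j | k. True}" (is "_ = ?S")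
proof
  have sub: "vec.subspace ?S"
    unfolding vec.subspace_def
  proof (safe)
    show "\<exists>k. 0 = (\<Sum>j\<in>UNIV. k j *s u j) \<and> True" by (rule exI[of _ "\<lambda>_. 0"]) simp
  next
    fix k l :: "3 \<Rightarrow> complex"
    show "\<exists>m. (\<Sum>j\<in>UNIV. k j *s u j) + (\<Sum>j\<in>UNIV. l j *s u j) = (\<Sum>j\<in>UNIV. m j *s u j) \<and> True"
      by (rule exI[of _ "\<lambda>j. k j + l j"]) (simp add: sum.distrib vec.scale_left_distrib)
  next
    fix c and k :: "3 \<Rightarrow> complex"
    show "\<exists>m. c *s (\<Sum>j\<in>UNIV. k j *s u j) = (\<Sum>j\<in>UNIV. m j *s u j) \<and> True"
      by (rule exI[of _ "\<lambda>j. c * k j"]) (simp add: vec.scale_sum_right)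
  qed
  have "u i \<in> ?S" for i
    by (rule CollectI, rule exI[of _ "\<lambda>j. if j = i then 1 else 0"]) (simp add: if_distrib[of "\<lambda>c. c *s _"] sum.delta cong: if_cong)
  then show "vec.span (range u) \<subseteq> ?S"
    by (intro vec.span_minimal sub) auto
  show "?S \<subseteq> vec.span (range u)"
    by (auto intro: vec.span_sum vec.span_scale vec.span_base rangeI)
qed

lemma lin_indep_triple_iff:
  "lin_indep_triple u \<longleftrightarrow> (\<forall>k. (\<Sum>j\<in>UNIV. k j *s u j) = 0 \<longrightarrow> (\<forall>j. k j = 0))"
proof
  assume u: "lin_indep_triple u"
  show "\<forall>k. (\<Sum>j\<in>UNIV. k j *s u j) = 0 \<longrightarrow> (\<forall>j. k j = 0)"
  proof (intro allI impI)
    fix k j assume 0: "(\<Sum>j\<in>UNIV. k j *s u j) = 0"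
    have inj: "inj u" using u by (simp add: lin_indep_triple_def)
    have "(\<Sum>v\<in>range u. k (inv u v) *s v) = 0"
      using 0 by (subst sum.reindex[OF inj]) (simp add: inv_f_f[OF inj])
    then have "k (inv u (u j)) = 0"
      using u unfolding lin_indep_triple_def
      by (intro vec.independentD[of "range u" "range u" "\<lambda>v. k (inv u v)"]) auto
    then show "k j = 0" by (simp add: inv_f_f[OF inj])
  qed
next
  assume r: "\<forall>k. (\<Sum>j\<in>UNIV. k j *s u j) = 0 \<longrightarrow> (\<forall>j. k j = 0)"
  have inj: "inj u"
  proof (rule injI, rule ccontr)
    fix i j assume "u i = u j" "i \<noteq> j"
    then have "(\<Sum>l\<in>UNIV. ((if l = i then 1 else 0) - (if l = j then 1 else 0)) *s u l) = 0"
      by (simp add: vec.scale_left_diff_distrib sum_subtractf if_distrib[of "\<lambda>c. c *s _"] sum.delta cong: if_cong)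
    from r[rule_format, OF this, of i] \<open>i \<noteq> j\<close> show False by simp
  qed
  have "vec.independent (range u)"
  proof (subst vec.dependent_finite; clarsimp)
    fix k i assume "(\<Sum>v\<in>range u. k v *s v) = 0" "k (u i) \<noteq> 0"
    moreover have "(\<Sum>v\<in>range u. k v *s v) = (\<Sum>j\<in>UNIV. k (u j) *s u j)"
      by (subst sum.reindex[OF inj]) simp
    ultimately show False using r by metis
  qed
  with inj show "lin_indep_triple u" by (simp add: lin_indep_triple_def)
qed

text \<open>Three independent vectors inside a span of three vectors fill it by dimension, so
  equality of nets is always proved by a single inclusion.\<close>

lemma span_triple_eqI:
  assumes u: "lin_indep_triple u" and v: "\<And>j. u j \<in> vec.span (range v)"
  shows "vec.span (range u) = vec.span (range (v :: 3 \<Rightarrow> _))"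
proof (rule vec.dim_eq_span[THEN trans])
  show "range u \<subseteq> vec.span (range v)" using v by auto
  have "vec.dim (range u) = 3"
    using u unfolding lin_indep_triple_def by (simp add: vec.dim_eq_card_independent card_image)
  moreover have "vec.dim (vec.span (range v)) \<le> 3"
    using vec.dim_le_card[of "range v" "range v"] card_image_le[of "UNIV :: 3 set" v]
    by (simp add: vec.span_superset)
  ultimately show "vec.dim (vec.span (range v)) \<le> vec.dim (range u)" by simp
qed (simp add: vec.span_span)

section \<open>Cross products, cofactors and column operations\<close>

definition cross :: "complex^3 \<Rightarrow> complex^3 \<Rightarrow> complex^3" where
  "cross u v = (\<chi> j. u $ (j + 1) * v $ (j + 2) - u $ (j + 2) * v $ (j + 1))"

text \<open>Cyclic indices build the sign into each 2x2 minor: this is the cofactor matrix, whose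
  transpose is the adjugate.\<close>

definition cof :: "complex^3^3 \<Rightarrow> complex^3^3" where
  "cof B = (\<chi> i j. B $ (i + 1) $ (j + 1) * B $ (i + 2) $ (j + 2) - B $ (i + 1) $ (j + 2) * B $ (i + 2) $ (j + 1))"

lemma cof_transpose_mult: "transpose (cof B) ** B = mat (det B)"
  by (simp add: vec_eq_iff forall_3 matrix_matrix_mult_def transpose_def cof_def mat_def sum_3 det_3 algebra_simps)

lemma mult_cof_transpose: "B ** transpose (cof B) = mat (det B)"
  by (simp add: vec_eq_iff forall_3 matrix_matrix_mult_def transpose_def cof_def mat_def sum_3 det_3 algebra_simps)

lemma cof_cof: "cof (cof B) = (\<chi> i j. det B * B $ i $ j)"
  by (simp add: vec_eq_iff forall_3 cof_def det_3) (simp add: algebra_simps)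

definition col_comb :: "W_matrix \<Rightarrow> complex^3 \<Rightarrow> 2 \<Rightarrow> W" where
  "col_comb R u i = (\<Sum>k\<in>UNIV. u $ k *s R $ i $ k)"

definition col_act :: "W_matrix \<Rightarrow> complex^3^3 \<Rightarrow> W_matrix" where
  "col_act R B = (\<chi> i j. col_comb R (column j B) i)"

lemma sym_mult_nth: "(v \<odot> w) $ (i, k) = (v $ i * w $ k + w $ i * v $ k) / 2"
  by (simp add: sym_mult_def)

lemma minor_nth: "minor R j $ (i, k) = 
   (R $ 1 $ (j + 1) $ i * R $ 2 $ (j + 2) $ k + R $ 2 $ (j + 2) $ i * R $ 1 $ (j + 1) $ k
   - R $ 1 $ (j + 2) $ i * R $ 2 $ (j + 1) $ k - R $ 2 $ (j + 1) $ i * R $ 1 $ (j + 2) $ k) / 2"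
  by (simp add: minor_def sym_mult_nth field_simps)

text \<open>The 2x2 determinant of two column combinations is alternating in \<open>u\<close> and
  \<open>v\<close>, hence depends only on \<open>cross u v\<close> (Cauchy-Binet).\<close>

lemma col_comb_bracket:
  "col_comb R u 1 \<odot> col_comb R v 2 - col_comb R v 1 \<odot> col_comb R u 2 = (\<Sum>j\<in>UNIV. cross u v $ j *s minor R j)"
  by (simp add: vec_eq_iff col_comb_def minor_nth sum_3 sym_mult_nth cross_def) (simp add: field_simps)

lemma minor_col_act: "minor (col_act R B) j = (\<Sum>k\<in>UNIV. cof B $ k $ j *s minor R k)"
proof -
  have "minor (col_act R B) j = (\<Sum>k\<in>UNIV. cross (column (j + 1) B) (column (j + 2) B) $ k *s minor R k)"
    unfolding col_comb_bracket[symmetric] by (simp add: minor_def col_act_def)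
  then show ?thesis by (simp add: cross_def cof_def column_def mult.commute)
qed

section \<open>Substitutions in W\<close>

definition W_act :: "complex^3^3 \<Rightarrow> W_matrix \<Rightarrow> W_matrix" where
  "W_act A R = (\<chi> i j. A *v R $ i $ j)"

lemma sum_pair: "(\<Sum>m\<in>(UNIV :: ('i::finite \<times> 'k::finite) set). f m) = (\<Sum>i\<in>UNIV. \<Sum>k\<in>UNIV. f (i, k))"
  by (simp only: UNIV_Times_UNIV[symmetric] sum.cartesian_product) (simp add: case_prod_beta)

lemma sym_act_mult: "sym_act A (v \<odot> w) = (A *v v) \<odot> (A *v w)"
  by (simp add: vec_eq_iff sym_act_def sym_mult_nth matrix_vector_mult_def sum_pair sum_3) (simp add: field_simps)

lemma sym_act_matrix: "sym_act A = (*v) (\<chi> m k. A $ fst m $ fst k * A $ snd m $ snd k)"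
  by (rule ext) (simp add: sym_act_def matrix_vector_mult_def)

lemma sym_act_span: "sym_act A ` vec.span S = vec.span (sym_act A ` S)"
  unfolding sym_act_matrix by (rule vec.linear_span_image[symmetric, OF matrix_vector_mul_linear_gen])

lemma sym_act_diff: "sym_act A (p - q) = sym_act A p - sym_act A q"
  unfolding sym_act_matrix by (rule matrix_vector_mult_diff_distrib)

lemma sym_act_scale: "sym_act A (c *s q) = c *s sym_act A q"
  unfolding sym_act_matrix by (rule vector_scalar_commute)

lemma sym_act_sum: "sym_act A (\<Sum>j\<in>S. f j) = (\<Sum>j\<in>S. sym_act A (f j))"
  unfolding sym_act_matrix by (rule vec.linear_sum[OF matrix_vector_mul_linear_gen])

lemma sym_act_0: "sym_act A 0 = 0"
  by (simp add: sym_act_matrix)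

lemma sym_act_compose: "sym_act A (sym_act B q) = sym_act (A ** B) q"
  by (simp add: vec_eq_iff sym_act_def sum_pair sum_3 matrix_matrix_mult_def) (simp add: algebra_simps)

lemma sym_act_1 [simp]: "sym_act (mat 1) q = q"
  by (simp add: vec_eq_iff sym_act_def sum_pair sum_3 mat_def forall_3 split_paired_all)

lemma minor_W_act: "minor (W_act A R) j = sym_act A (minor R j)"
  by (simp add: minor_def W_act_def sym_act_diff sym_act_mult)

lemma minor_net_W_act: "minor_net (W_act A R) = sym_act A ` minor_net R"
  by (simp add: minor_net_def sym_act_span minor_W_act image_image)

lemma stable_W_act:
  assumes "invertible A" "R \<in> stable_matrices" shows "W_act A R \<in> stable_matrices"
  unfolding stable_matrices_def mem_Collect_eq lin_indep_triple_iff
proof (intro allI impI)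
  fix k j assume "(\<Sum>j\<in>UNIV. k j *s minor (W_act A R) j) = 0"
  then have "sym_act A (\<Sum>j\<in>UNIV. k j *s minor R j) = 0"
    by (simp add: sym_act_sum sym_act_scale minor_W_act)
  moreover obtain A' where "A' ** A = mat 1" using assms(1) unfolding invertible_def by blast
  ultimately have "(\<Sum>j\<in>UNIV. k j *s minor R j) = 0"
    using sym_act_compose[of A' A "\<Sum>j\<in>UNIV. k j *s minor R j"] by (simp add: sym_act_0)
  then show "k j = 0"
    using assms(2) by (simp add: stable_matrices_def lin_indep_triple_iff)
qed

section \<open>Products of linear forms and vanishing 2x2 determinants\<close>

lemma quadric_eval_mult: "quadric_eval (v \<odot> w) p = dual_pair p v * dual_pair p w"
  by (simp add: quadric_eval_def dual_pair_def sum_pair sum_3 sym_mult_nth) (simp add: field_simps)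

lemma dual_pair_add: "dual_pair (p + q) w = dual_pair p w + dual_pair q w"
  by (simp add: dual_pair_def sum.distrib algebra_simps)

lemma dual_pair_axis: "dual_pair (axis i 1) w = w $ i"
  by (simp add: dual_pair_def axis_def if_distrib[of "\<lambda>c. c * _"] sum.delta cong: if_cong)

text \<open>If each factor is nonzero at some point, the product is nonzero at one of these two
  points or at their sum. This replaces unique factorisation of polynomials.\<close>

lemma dual_pair_product_zero:
  assumes add: "\<And>p q. P p \<Longrightarrow> P q \<Longrightarrow> P (p + q)"
    and zero: "\<And>p. P p \<Longrightarrow> dual_pair p a * dual_pair p b = 0"
  shows "(\<forall>p. P p \<longrightarrow> dual_pair p a = 0) \<or> (\<forall>p. P p \<longrightarrow> dual_pair p b = 0)"
proof (rule ccontr)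
  assume "\<not> ?thesis"
  then obtain p q where pq: "P p" "dual_pair p a \<noteq> 0" "P q" "dual_pair q b \<noteq> 0" by blast
  then have "dual_pair p b = 0" "dual_pair q a = 0" using zero by force+
  then show False using zero[OF add[OF pq(1,3)]] pq by (simp add: dual_pair_add)
qed

lemma dual_pair_0 [simp]: "dual_pair p 0 = 0"
  by (simp add: dual_pair_def)

lemma dual_pair_all_zero: "(\<forall>p. dual_pair p w = 0) \<longleftrightarrow> w = 0"
  using dual_pair_axis[of _ w] by (metis dual_pair_0 vec_eq_iff zero_index)

lemma dual_pair_diff_scale: "dual_pair p (w - k *s v) = dual_pair p w - k * dual_pair p v"
  by (simp add: dual_pair_def sum_distrib_left sum_subtractf algebra_simps)

lemma dual_pair_scale: "dual_pair p (k *s v) = k * dual_pair p v"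
  by (simp add: dual_pair_def sum_distrib_left algebra_simps)

lemma dual_pair_kernel_subset:
  assumes "a \<noteq> 0" "\<forall>p. dual_pair p a = 0 \<longrightarrow> dual_pair p b = 0"
  shows "\<exists>c. b = c *s a"
proof -
  obtain i where i: "a $ i \<noteq> 0" using assms(1) by (auto simp: vec_eq_iff)
  have "a $ i * b $ j = a $ j * b $ i" for j
  proof -
    \<comment> \<open>The functional with value \<open>a $ i\<close> on the j-th and
      \<open>- a $ j\<close> on the i-th unit vector kills \<open>a\<close>, so it kills
      \<open>b\<close>; that is the proportionality of coordinates.\<close>
    have pair: "dual_pair (a $ i *s axis j 1 + (- a $ j) *s axis i 1) w = a $ i * w $ j - a $ j * w $ i" for w
    proof -
      have "dual_pair (c *s p) w = c * dual_pair p w" for c p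
        by (simp add: dual_pair_def sum_distrib_left mult.assoc)
      then show ?thesis by (simp only: dual_pair_add dual_pair_axis) simp
    qed
    show ?thesis
      using assms(2)[rule_format, of "a $ i *s axis j 1 + (- a $ j) *s axis i 1"] unfolding pair by simp
  qed
  then have "b = (b $ i / a $ i) *s a" using i by (simp add: vec_eq_iff field_simps)
  then show ?thesis by blast
qed

text \<open>The 2x2 matrix of linear forms with rows (a, c) and (b, d) has determinant zero. If
  \<open>a\<close> is nonzero, the product of \<open>c\<close> and \<open>b\<close> vanishes on its
  kernel, so \<open>a\<close> divides one of them; cancelling \<open>a\<close> gives dependent
  columns or dependent rows.\<close>

lemma sym_mult_eq_cases:
  assumes "a \<odot> d = c \<odot> b"
  obtains (rows) \<alpha> \<beta> where "\<alpha> \<noteq> 0 \<or> \<beta> \<noteq> 0" "\<alpha> *s a + \<beta> *s b = 0" "\<alpha> *s c + \<beta> *s d = 0"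
    | (columns) \<alpha> \<beta> where "\<alpha> \<noteq> 0 \<or> \<beta> \<noteq> 0" "\<alpha> *s a + \<beta> *s c = 0" "\<alpha> *s b + \<beta> *s d = 0"
proof -
  have ev: "dual_pair p a * dual_pair p d = dual_pair p c * dual_pair p b" for p
    using assms by (simp flip: quadric_eval_mult)
  show thesis
  proof (cases "a = 0")
    case True
    then have "c = 0 \<or> b = 0"
      using dual_pair_product_zero[of "\<lambda>_. True" c b] ev by (simp add: dual_pair_all_zero)
    then show thesis using True rows[of 1 0] columns[of 1 0] by auto
  next
    case False
    have "(\<forall>p. dual_pair p a = 0 \<longrightarrow> dual_pair p c = 0) \<or> (\<forall>p. dual_pair p a = 0 \<longrightarrow> dual_pair p b = 0)"
      by (rule dual_pair_product_zero) (use ev in \<open>auto simp: dual_pair_add\<close>, metis mult_zero_left mult_eq_0_iff)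
    then consider k where "c = k *s a" | k where "b = k *s a"
      using dual_pair_kernel_subset[OF False] by blast
    then show thesis
    proof cases
      case 1
      have "dual_pair p a * dual_pair p (d - k *s b) = 0" for p
        using ev[of p] by (simp add: dual_pair_scale dual_pair_diff_scale 1 algebra_simps)
      then have "d - k *s b = 0"
        using dual_pair_product_zero[of "\<lambda>_. True" a "d - k *s b"] False by (simp add: dual_pair_all_zero)
      then show thesis using columns[of k "-1"] 1 by simp
    next
      case 2
      have "dual_pair p a * dual_pair p (d - k *s c) = 0" for p
        using ev[of p] by (simp add: dual_pair_scale dual_pair_diff_scale 2 algebra_simps)
      then have "d - k *s c = 0"
        using dual_pair_product_zero[of "\<lambda>_. True" a "d - k *s c"] False by (simp add: dual_pair_all_zero)
      then show thesis using rows[of k "-1"] 2 by simp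
    qed
  qed
qed

section \<open>Stability as a condition on the pencil of rows\<close>

lemma cross_eq_0_iff: "cross u v = 0 \<longleftrightarrow> (\<exists>\<alpha> \<beta>. (\<alpha> \<noteq> 0 \<or> \<beta> \<noteq> 0) \<and> \<alpha> *s u + \<beta> *s v = 0)"
proof
  assume c: "cross u v = 0"
  show "\<exists>\<alpha> \<beta>. (\<alpha> \<noteq> 0 \<or> \<beta> \<noteq> 0) \<and> \<alpha> *s u + \<beta> *s v = 0"
  proof (cases "u = 0")
    case True then show ?thesis by (intro exI[of _ 1] exI[of _ 0]) simp
  next
    case False
    then obtain i where "u $ i \<noteq> 0" by (auto simp: vec_eq_iff)
    moreover have "v $ i *s u + (- u $ i) *s v = 0"
      using c exhaust_3[of i] by (auto simp: cross_def vec_eq_iff forall_3 algebra_simps)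
    ultimately show ?thesis by (intro exI[of _ "v $ i"] exI[of _ "- u $ i"]) simp
  qed
next
  assume "\<exists>\<alpha> \<beta>. (\<alpha> \<noteq> 0 \<or> \<beta> \<noteq> 0) \<and> \<alpha> *s u + \<beta> *s v = 0"
  then obtain \<alpha> \<beta> where ab: "\<alpha> \<noteq> 0 \<or> \<beta> \<noteq> 0" and "\<And>i. \<alpha> * u $ i + \<beta> * v $ i = 0"
    by (auto simp: vec_eq_iff)
  then have z: "\<alpha> * u $ i = - (\<beta> * v $ i)" for i by (simp add: eq_neg_iff_add_eq_0)
  have "\<alpha> * (u $ i * v $ j - u $ j * v $ i) = 0" "\<beta> * (u $ i * v $ j - u $ j * v $ i) = 0" for i j
    using z[of i] z[of j] by algebra+
  then show "cross u v = 0" using ab by (auto simp: cross_def vec_eq_iff)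
qed

lemma cross_surj: "\<exists>u v. cross u v = w"
proof (cases "w = 0")
  case True then show ?thesis by (intro exI[of _ 0]) (simp add: cross_def vec_eq_iff)
next
  case False
  then consider "w $ 1 \<noteq> 0" | "w $ 2 \<noteq> 0" | "w $ 3 \<noteq> 0" by (auto simp: vec_eq_iff forall_3)
  then show ?thesis
  proof cases
    case 1 then show ?thesis
      by (intro exI[of _ "vector [- w $ 2 / w $ 1, 1, 0]"] exI[of _ "vector [- w $ 3, 0, w $ 1]"])
        (simp add: cross_def vec_eq_iff forall_3 vector_3)
  next
    case 2 then show ?thesis
      by (intro exI[of _ "vector [0, - w $ 3 / w $ 2, 1]"] exI[of _ "vector [w $ 2, - w $ 1, 0]"])
        (simp add: cross_def vec_eq_iff forall_3 vector_3)
  next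
    case 3 then show ?thesis
      by (intro exI[of _ "vector [1, 0, - w $ 1 / w $ 3]"] exI[of _ "vector [0, w $ 3, - w $ 2]"])
        (simp add: cross_def vec_eq_iff forall_3 vector_3)
  qed
qed

lemma cross_nonzero_ex: assumes "u \<noteq> 0" shows "\<exists>v. cross u v \<noteq> 0"
proof -
  consider "u $ 1 \<noteq> 0" | "u $ 2 \<noteq> 0" | "u $ 3 \<noteq> 0" using assms by (auto simp: vec_eq_iff forall_3)
  then show ?thesis
  proof cases
    case 1 then show ?thesis
      by (intro exI[of _ "axis 2 1"]) (simp add: cross_def vec_eq_iff forall_3 axis_def)
  next
    case 2 then show ?thesis
      by (intro exI[of _ "axis 3 1"]) (simp add: cross_def vec_eq_iff forall_3 axis_def)
  next
    case 3 then show ?thesis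
      by (intro exI[of _ "axis 1 1"]) (simp add: cross_def vec_eq_iff forall_3 axis_def)
  qed
qed

lemma col_comb_lin: "col_comb R (a *s u + b *s v) i = a *s col_comb R u i + b *s col_comb R v i"
  by (simp add: col_comb_def vec_eq_iff sum_3 algebra_simps)

text \<open>In dimension three every coefficient vector is a cross product, so every combination of
  the minors is itself the determinant of two column combinations.\<close>

lemma stable_iff_cross:
  "R \<in> stable_matrices \<longleftrightarrow> (\<forall>u v. cross u v \<noteq> 0 \<longrightarrow>
     col_comb R u 1 \<odot> col_comb R v 2 \<noteq> col_comb R v 1 \<odot> col_comb R u 2)"
proof -
  have "R \<in> stable_matrices \<longleftrightarrow> (\<forall>w. (\<Sum>j\<in>UNIV. w $ j *s minor R j) = 0 \<longrightarrow> w = 0)"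
    unfolding stable_matrices_def mem_Collect_eq lin_indep_triple_iff
  proof (safe)
    fix w assume "\<forall>k. (\<Sum>j\<in>UNIV. k j *s minor R j) = 0 \<longrightarrow> (\<forall>j. k j = 0)" "(\<Sum>j\<in>UNIV. w $ j *s minor R j) = 0"
    then have "\<forall>j. w $ j = 0" by blast
    then show "w = 0" by (simp add: vec_eq_iff)
  next
    fix k j assume a: "\<forall>w. (\<Sum>j\<in>UNIV. w $ j *s minor R j) = 0 \<longrightarrow> w = 0" "(\<Sum>j\<in>UNIV. k j *s minor R j) = 0"
    have "(\<chi> j. k j) = (0 :: complex^3)" using a(1)[rule_format, of "\<chi> j. k j"] a(2) by simp
    then show "k j = 0" by (simp add: vec_eq_iff)
  qed
  also have "\<dots> \<longleftrightarrow> (\<forall>u v. cross u v \<noteq> 0 \<longrightarrow> (\<Sum>j\<in>UNIV. cross u v $ j *s minor R j) \<noteq> 0)"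
  proof safe
    fix w assume *: "\<forall>u v. cross u v \<noteq> 0 \<longrightarrow> (\<Sum>j\<in>UNIV. cross u v $ j *s minor R j) \<noteq> 0"
      "(\<Sum>j\<in>UNIV. w $ j *s minor R j) = 0"
    obtain u v where "cross u v = w" using cross_surj by blast
    with * show "w = 0" by blast
  qed blast
  finally show ?thesis unfolding col_comb_bracket[symmetric] right_minus_eq .
qed

text \<open>A vanishing determinant comes from dependent columns or dependent rows by
  \<open>sym_mult_eq_cases\<close>. This turns the quadratic stability condition into linear ones,
  the form in which it can be dualised.\<close>

lemma stable_iff_pencil:
  "R \<in> stable_matrices \<longleftrightarrow>
     (\<forall>u. col_comb R u 1 = 0 \<longrightarrow> col_comb R u 2 = 0 \<longrightarrow> u = 0) \<and>
     (\<forall>\<alpha> \<beta> u v. \<alpha> \<noteq> 0 \<or> \<beta> \<noteq> 0 \<longrightarrow> \<alpha> *s col_comb R u 1 + \<beta> *s col_comb R u 2 = 0 \<longrightarrow>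
        \<alpha> *s col_comb R v 1 + \<beta> *s col_comb R v 2 = 0 \<longrightarrow> cross u v = 0)"
   (is "_ \<longleftrightarrow> ?inj \<and> ?pencil")
proof
  assume s: "R \<in> stable_matrices"
  have z: "0 \<odot> w = 0" "w \<odot> 0 = 0" for w by (auto simp: vec_eq_iff sym_mult_nth)
  have ?inj
  proof (intro allI impI, rule ccontr)
    fix u assume "col_comb R u 1 = 0" "col_comb R u 2 = 0" "u \<noteq> 0"
    moreover obtain v where "cross u v \<noteq> 0" using cross_nonzero_ex \<open>u \<noteq> 0\<close> by blast
    ultimately show False using s[unfolded stable_iff_cross, rule_format, of u v] by (simp add: z)
  qed
  moreover have ?pencil
  proof (intro allI impI, rule ccontr)
    fix \<alpha> \<beta> :: complex and u v
    assume ab: "\<alpha> \<noteq> 0 \<or> \<beta> \<noteq> 0" and uv: "\<alpha> *s col_comb R u 1 + \<beta> *s col_comb R u 2 = 0"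
      "\<alpha> *s col_comb R v 1 + \<beta> *s col_comb R v 2 = 0" and c: "cross u v \<noteq> 0"
    have "col_comb R u 1 \<odot> col_comb R v 2 = col_comb R v 1 \<odot> col_comb R u 2"
    proof -
      let ?a = "($) (col_comb R u 1)" and ?b = "($) (col_comb R u 2)"
      let ?c = "($) (col_comb R v 1)" and ?d = "($) (col_comb R v 2)"
      have z: "\<alpha> * ?a i = - (\<beta> * ?b i)" "\<alpha> * ?c i = - (\<beta> * ?d i)" for i
        using uv by (auto simp: vec_eq_iff eq_neg_iff_add_eq_0)
      have "\<alpha> * (?a i * ?d k + ?d i * ?a k) = \<alpha> * (?c i * ?b k + ?b i * ?c k)"
        "\<beta> * (?a i * ?d k + ?d i * ?a k) = \<beta> * (?c i * ?b k + ?b i * ?c k)" for i k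
        using z[of i] z[of k] by algebra+
      then have "?a i * ?d k + ?d i * ?a k = ?c i * ?b k + ?b i * ?c k" for i k
        using ab by (metis mult_cancel_left)
      then show ?thesis by (simp add: vec_eq_iff sym_mult_nth)
    qed
    then show False using s[unfolded stable_iff_cross, rule_format, OF c] by simp
  qed
  ultimately show "?inj \<and> ?pencil" ..
next
  assume ip: "?inj \<and> ?pencil"
  show "R \<in> stable_matrices"
    unfolding stable_iff_cross
  proof (intro allI impI notI)
    fix u v assume c: "cross u v \<noteq> 0" and eq: "col_comb R u 1 \<odot> col_comb R v 2 = col_comb R v 1 \<odot> col_comb R u 2"
    from eq show False
    proof (cases rule: sym_mult_eq_cases)
      case (rows \<alpha> \<beta>)
      then show False using conjunct2[OF ip, rule_format, of \<alpha> \<beta> u v] c by simp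
    next
      case (columns \<alpha> \<beta>)
      then have "\<alpha> *s u + \<beta> *s v = 0"
        using conjunct1[OF ip, rule_format, of "\<alpha> *s u + \<beta> *s v"] by (simp add: col_comb_lin)
      then show False using c columns(1) cross_eq_0_iff[of u v] by blast
    qed
  qed
qed

section \<open>The annihilator of a matrix\<close>

lemma mult_axis: "(A :: complex^'n^'m) *v axis j 1 = column j A"
  by (simp add: vec_eq_iff matrix_vector_mult_def axis_def column_def if_distrib[of "\<lambda>c. _ * c"] sum.delta cong: if_cong)

text \<open>The columns of \<open>M\<close> are three independent vectors in dimension six.
  Completing them to a basis, killing them and sending the three new vectors to the unit vectors
  gives the quotient map.\<close>

lemma annihilator_matrix:
  fixes M :: "complex^3^(2 \<times> 3)"
  assumes inj: "\<And>u. M *v u = 0 \<Longrightarrow> u = 0"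
  obtains N :: "complex^(2 \<times> 3)^3" where "N ** M = 0" "surj ((*v) N)"
proof -
  let ?C = "range (\<lambda>j. M *v axis j 1)"
  have inj': "inj ((*v) M)"
    using inj by (intro injI) (metis matrix_vector_mult_diff_distrib right_minus_eq)
  have C: "vec.independent ?C"
  proof -
    have "vec.independent ((*v) M ` cart_basis)"
      by (rule vec.linear_independent_injective_image)
        (simp, rule independent_cart_basis, rule inj_on_subset[OF inj' subset_UNIV])
    moreover have "(*v) M ` cart_basis = ?C" by (auto simp: cart_basis_def)
    ultimately show ?thesis by simp
  qed
  have cC: "card ?C = 3"
  proof (subst card_image)
    show "inj (\<lambda>j. M *v axis j 1)"
      using inj' by (intro injI) (simp add: inj_eq axis_eq_axis)
  qed simp
  define B where "B = vec.extend_basis ?C"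
  have B: "?C \<subseteq> B" "vec.independent B" "vec.span B = UNIV"
    unfolding B_def using vec.extend_basis_superset[OF C] vec.independent_extend_basis[OF C] vec.span_extend_basis[OF C]
    by auto
  have "card B = 6"
    using vec.basis_card_eq_dim[of B UNIV, unfolded vec_dim_card] B by simp
  then have "card (B - ?C) = 3"
    using cC B(1) by (subst card_Diff_subset) auto
  moreover have "finite (B - ?C)"
    using B(2) vec.finiteI_independent by blast
  ultimately obtain f :: "complex^(2 \<times> 3) \<Rightarrow> 3" where f: "bij_betw f (B - ?C) UNIV"
    using finite_same_card_bij[of "B - ?C" "UNIV :: 3 set"] by auto
  obtain h where h: "Vector_Spaces.linear (*s) (*s) h"
    "\<And>v. v \<in> B \<Longrightarrow> h v = (if v \<in> ?C then 0 else axis (f v) 1 :: complex^3)"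
    using vec.linear_independent_extend[OF B(2), of "\<lambda>v. if v \<in> ?C then 0 else axis (f v) 1 :: complex^3"] by auto
  have hN: "matrix h *v v = h v" for v using matrix_works[OF h(1)] .
  have 0: "(matrix h ** M) *v axis j 1 = 0" for j
  proof -
    have "M *v axis j 1 \<in> B" using B(1) by auto
    then show ?thesis using h(2)[of "M *v axis j 1"] by (simp flip: matrix_vector_mul_assoc add: hN)
  qed
  show thesis
  proof
    show "matrix h ** M = 0"
    proof -
      have "column j (matrix h ** M) = 0" for j
        using 0[of j] by (simp only: mult_axis)
      then show ?thesis by (simp add: column_def vec_eq_iff)
    qed
    have "\<exists>v. matrix h *v v = w" for w
    proof -
      have "\<exists>v. matrix h *v v = axis k 1" for k
      proof -
        have "k \<in> f ` (B - ?C)" using bij_betw_imp_surj_on[OF f] by simp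
        then obtain v where v: "v \<in> B - ?C" "k = f v" by (rule imageE)
        then have "h v = axis k 1" using h(2)[of v] by simp
        then show ?thesis unfolding hN by blast
      qed
      then obtain g where g: "\<And>k. matrix h *v g k = axis k 1" by metis
      have "matrix h *v (\<Sum>k\<in>UNIV. w $ k *s g k) = w"
        by (simp add: vec.linear_sum[OF matrix_vector_mul_linear_gen] vector_scalar_commute g)
          (simp add: vec_eq_iff axis_def if_distrib[of "\<lambda>c. _ * c"] sum.delta cong: if_cong)
      then show ?thesis by blast
    qed
    then show "surj ((*v) (matrix h))" unfolding surj_def by metis
  qed
qed

section \<open>The form J and orthogonality of matrices\<close>

definition J_pair :: "W \<Rightarrow> W \<Rightarrow> complex" where
  "J_pair v w = v $ 1 * w $ 3 + v $ 2 * w $ 2 + v $ 3 * w $ 1"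

definition flip :: "W \<Rightarrow> W" where
  "flip v = vector [v $ 3, v $ 2, v $ 1]"

lemma flip_nth [simp]: "flip v $ 1 = v $ 3" "flip v $ 2 = v $ 2" "flip v $ 3 = v $ 1"
  by (simp_all add: flip_def vector_3)

lemma flip_flip [simp]: "flip (flip v) = v"
  by (simp add: vec_eq_iff forall_3)

lemma flip_lin: "flip (a *s u + b *s v) = a *s flip u + b *s flip v"
  by (simp add: vec_eq_iff forall_3)

lemma flip_eq_0 [simp]: "flip v = 0 \<longleftrightarrow> v = 0"
  by (auto simp add: vec_eq_iff forall_3)

lemma flip_0 [simp]: "flip 0 = 0" by simp

lemma g2_form_mult: "g2_form *v v = flip v"
  by (simp add: vec_eq_iff forall_3 g2_form_def matrix_vector_mult_def sum_3 vector_3)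

lemma J_pair_commute: "J_pair v w = J_pair w v"
  by (simp add: J_pair_def algebra_simps)

lemma J_pair_dual: "J_pair v w = dual_pair (flip v) w"
  by (simp add: J_pair_def dual_pair_def sum_3 algebra_simps)

text \<open>Columns are viewed as vectors of the six-dimensional space of pairs in W. Vanishing of
  \<open>gram S R\<close> says that the column spaces are orthogonal; when both have rank three,
  each is the annihilator of the other.\<close>

definition gram :: "W_matrix \<Rightarrow> W_matrix \<Rightarrow> complex^3^3" where
  "gram S R = (\<chi> c a. J_pair (S $ 1 $ c) (R $ 1 $ a) + J_pair (S $ 2 $ c) (R $ 2 $ a))"

lemma gram_commute: "gram R S = transpose (gram S R)"
  by (simp add: gram_def transpose_def vec_eq_iff J_pair_commute)

lemma gram_col_act: "gram (col_act S X) R = transpose X ** gram S R"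
proof -
  have "gram (col_act S X) R $ c $ a = (transpose X ** gram S R) $ c $ a" for c a
    by (simp add: gram_def transpose_def matrix_matrix_mult_def col_act_def col_comb_def column_def
        J_pair_def sum_3) (simp add: algebra_simps)
  then show ?thesis by (simp add: vec_eq_iff)
qed

lemma gram_col_comb: "J_pair (col_comb S u 1) w + J_pair (col_comb S u 2) w'
    = (\<Sum>c\<in>UNIV. u $ c * (J_pair (S $ 1 $ c) w + J_pair (S $ 2 $ c) w'))"
  by (simp add: col_comb_def J_pair_def sum_3 algebra_simps)

lemma gram_annihilator:
  assumes inj: "\<And>u. col_comb R u 1 = 0 \<Longrightarrow> col_comb R u 2 = 0 \<Longrightarrow> u = 0"
  obtains S where "gram S R = 0" "\<And>u. col_comb S u 1 = 0 \<Longrightarrow> col_comb S u 2 = 0 \<Longrightarrow> u = 0"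
proof -
  define M :: "complex^3^(2 \<times> 3)" where "M = (\<chi> m j. R $ fst m $ j $ snd m)"
  have M: "(M *v u) $ (i, k) = col_comb R u i $ k" for u i k
    by (simp add: M_def matrix_vector_mult_def col_comb_def mult.commute)
  have Minj: "u = 0" if "M *v u = 0" for u
  proof (rule inj)
    show "col_comb R u 1 = 0" "col_comb R u 2 = 0"
      using that by (simp_all add: vec_eq_iff[of "col_comb R u _"] flip: M)
  qed
  obtain N :: "complex^(2 \<times> 3)^3" where N: "N ** M = 0" "surj ((*v) N)"
    by (rule annihilator_matrix[OF Minj])
  \<comment> \<open>The flip converts evaluation of the rows of \<open>N\<close> into the form
    J.\<close>
  define S :: W_matrix where "S = (\<chi> i c. flip (\<chi> k. N $ c $ (i, k)))"
  show thesis
  proof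
    have "gram S R $ c $ a = (N ** M) $ c $ a" for c a
      by (simp add: gram_def S_def matrix_matrix_mult_def M_def J_pair_dual sum_pair sum_2 dual_pair_def)
    then show "gram S R = 0" using N(1) by (simp add: vec_eq_iff)
    fix u assume u: "col_comb S u 1 = 0" "col_comb S u 2 = 0"
    have flat: "(\<Sum>c\<in>UNIV. u $ c * N $ c $ m) = 0" for m
    proof -
      obtain i k where m: "m = (i, k)" by force
      have "flip (col_comb S u i) $ k = 0" using u exhaust_2[of i] by auto
      moreover have "flip (col_comb S u i) $ k = (\<Sum>c\<in>UNIV. u $ c * flip (S $ i $ c) $ k)"
        using exhaust_3[of k] by (auto simp: col_comb_def)
      ultimately have "(\<Sum>c\<in>UNIV. u $ c * flip (S $ i $ c) $ k) = 0" by simp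
      then show ?thesis by (simp add: S_def m)
    qed
    show "u = 0"
      unfolding vec_eq_iff
    proof
      fix k
      obtain v where v: "N *v v = axis k 1" using N(2) by (metis surjD)
      have "u $ k = (\<Sum>c\<in>UNIV. u $ c * (N *v v) $ c)"
        unfolding v by (simp add: axis_def if_distrib[of "\<lambda>c. _ * c"] sum.delta cong: if_cong)
      also have "\<dots> = (\<Sum>c\<in>UNIV. \<Sum>m\<in>UNIV. v $ m * (u $ c * N $ c $ m))"
        by (simp add: matrix_vector_mult_def sum_distrib_left algebra_simps)
      also have "\<dots> = (\<Sum>m\<in>UNIV. v $ m * (\<Sum>c\<in>UNIV. u $ c * N $ c $ m))"
        by (subst sum.swap) (simp add: sum_distrib_left)
      finally show "u $ k = 0 $ k" by (simp add: flat)
    qed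
  qed
qed

text \<open>A system dual to the columns of \<open>R\<close>, read off from a left inverse. It
  serves to correct an approximate annihilator to an exact one.\<close>

lemma gram_dual:
  assumes inj: "\<And>u. col_comb R u 1 = 0 \<Longrightarrow> col_comb R u 2 = 0 \<Longrightarrow> u = 0"
  obtains D where "gram D R = mat 1"
proof -
  define M :: "complex^3^(2 \<times> 3)" where "M = (\<chi> m j. R $ fst m $ j $ snd m)"
  have M: "(M *v u) $ (i, k) = col_comb R u i $ k" for u i k
    by (simp add: M_def matrix_vector_mult_def col_comb_def mult.commute)
  have "\<forall>u. M *v u = 0 \<longrightarrow> u = 0"
  proof (intro allI impI, rule inj)
    fix u assume "M *v u = 0"
    then show "col_comb R u 1 = 0" "col_comb R u 2 = 0"
      by (simp_all add: vec_eq_iff[of "col_comb R u _"] flip: M)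
  qed
  then obtain N where N: "N ** M = mat 1" unfolding matrix_left_invertible_ker[symmetric] ..
  define D :: W_matrix where "D = (\<chi> i c. flip (\<chi> k. N $ c $ (i, k)))"
  have "gram D R $ c $ a = (N ** M) $ c $ a" for c a
    by (simp add: gram_def D_def matrix_matrix_mult_def M_def J_pair_dual sum_pair sum_2 dual_pair_def)
  then have "gram D R = mat 1" using N by (simp add: vec_eq_iff)
  then show thesis by (rule that)
qed

lemma perp_cross:
  assumes "cross a b \<noteq> 0" "dual_pair a m = 0" "dual_pair b m = 0"
  shows "\<exists>r. m = r *s cross a b"
proof -
  obtain i where i: "cross a b $ i \<noteq> 0" using assms(1) by (auto simp: vec_eq_iff)
  have "m $ j * cross a b $ i = m $ i * cross a b $ j" for j
  proof -
    have "a $ 1 * m $ 1 + a $ 2 * m $ 2 + a $ 3 * m $ 3 = 0" "b $ 1 * m $ 1 + b $ 2 * m $ 2 + b $ 3 * m $ 3 = 0"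
      using assms(2,3) by (simp_all add: dual_pair_def sum_3)
    then have "\<forall>i j. m $ j * cross a b $ i = m $ i * cross a b $ j"
      unfolding forall_3 by (simp add: cross_def) (intro conjI; algebra)
    then show ?thesis by blast
  qed
  then have "m = (m $ i / cross a b $ i) *s cross a b" using i by (simp add: vec_eq_iff field_simps)
  then show ?thesis by blast
qed

lemma independent_pair_perp: "\<exists>u v. cross u v \<noteq> 0 \<and> (\<Sum>j\<in>UNIV. u $ j * r $ j) = 0 \<and> (\<Sum>j\<in>UNIV. v $ j * r $ j) = 0"
proof (cases "r = 0")
  case True
  have "axis 1 1 \<noteq> (0 :: complex^3)" by simp
  then obtain v where "cross (axis 1 1) v \<noteq> 0" using cross_nonzero_ex by blast
  then show ?thesis by (intro exI[of _ "axis 1 1"] exI[of _ v]) (simp add: True)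
next
  case False
  obtain u v where uv: "cross u v = r" using cross_surj by blast
  have "(\<Sum>j\<in>UNIV. u $ j * cross u v $ j) = 0" "(\<Sum>j\<in>UNIV. v $ j * cross u v $ j) = 0"
    by (simp_all add: cross_def sum_3 algebra_simps)
  with False uv show ?thesis by metis
qed

text \<open>A violation of the pencil condition for \<open>S\<close> puts columns of the form
  (\<beta> w, - \<alpha> w) and (\<beta> w', - \<alpha> w') with independent \<open>w\<close>,
  \<open>w'\<close> into its column space. Orthogonality then forces all entries of the row
  combination \<beta> R_1 - \<alpha> R_2 onto the single line perpendicular to \<open>w\<close> and
  \<open>w'\<close>, so it vanishes on two independent column combinations, against the stability of
  \<open>R\<close>.\<close>

lemma stable_annihilator:
  assumes R: "R \<in> stable_matrices" and 0: "gram S R = 0"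
    and inj: "\<And>u. col_comb S u 1 = 0 \<Longrightarrow> col_comb S u 2 = 0 \<Longrightarrow> u = 0"
  shows "S \<in> stable_matrices"
  unfolding stable_iff_pencil
proof (intro conjI allI impI)
  fix \<alpha> \<beta> :: complex and u v
  assume ab: "\<alpha> \<noteq> 0 \<or> \<beta> \<noteq> 0" and u: "\<alpha> *s col_comb S u 1 + \<beta> *s col_comb S u 2 = 0"
    and v: "\<alpha> *s col_comb S v 1 + \<beta> *s col_comb S v 2 = 0"
  show "cross u v = 0"
  proof (rule ccontr)
    assume c: "cross u v \<noteq> 0"
    have "\<exists>w. col_comb S u 1 = \<beta> *s w \<and> col_comb S u 2 = - \<alpha> *s w"
      if "\<alpha> *s col_comb S u 1 + \<beta> *s col_comb S u 2 = 0" for u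
    proof (cases "\<beta> = 0")
      case False
      then show ?thesis using that
        by (intro exI[of _ "(1 / \<beta>) *s col_comb S u 1"]) (auto simp: vec_eq_iff field_simps eq_neg_iff_add_eq_0)
    next
      case True
      then show ?thesis using that ab
        by (intro exI[of _ "- (1 / \<alpha>) *s col_comb S u 2"]) (auto simp: vec_eq_iff field_simps)
    qed
    then obtain w w' where w: "col_comb S u 1 = \<beta> *s w" "col_comb S u 2 = - \<alpha> *s w"
      and w': "col_comb S v 1 = \<beta> *s w'" "col_comb S v 2 = - \<alpha> *s w'" using u v by meson
    have cw: "cross (flip w) (flip w') \<noteq> 0"
    proof
      assume "cross (flip w) (flip w') = 0"
      then obtain a b where nz: "a \<noteq> 0 \<or> b \<noteq> 0" and "a *s flip w + b *s flip w' = 0"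
        unfolding cross_eq_0_iff by blast
      then have "flip (a *s w + b *s w') = 0" by (simp only: flip_lin)
      then have s: "a *s w + b *s w' = 0" by (simp only: flip_eq_0)
      have "col_comb S (a *s u + b *s v) 1 = \<beta> *s (a *s w + b *s w')"
        unfolding col_comb_lin w w' by (simp add: vec_eq_iff algebra_simps)
      moreover have "col_comb S (a *s u + b *s v) 2 = - \<alpha> *s (a *s w + b *s w')"
        unfolding col_comb_lin w w' by (simp add: vec_eq_iff algebra_simps)
      ultimately have "a *s u + b *s v = 0" using inj[of "a *s u + b *s v"] by (simp add: s)
      then show False using nz c cross_eq_0_iff[of u v] by blast
    qed
    define m where "m j = \<beta> *s R $ 1 $ j - \<alpha> *s R $ 2 $ j" for j
    have orth: "J_pair w (m j) = 0 \<and> J_pair w' (m j) = 0" for j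
    proof -
      have z: "J_pair (S $ 1 $ c) (R $ 1 $ j) + J_pair (S $ 2 $ c) (R $ 2 $ j) = 0" for c
        using 0 by (simp add: gram_def vec_eq_iff)
      have "J_pair (col_comb S u 1) (R $ 1 $ j) + J_pair (col_comb S u 2) (R $ 2 $ j) = 0" for u
        unfolding gram_col_comb by (simp add: z)
      from this[of u] this[of v] show ?thesis
        unfolding w w' by (simp add: m_def J_pair_def algebra_simps)
    qed
    have "\<exists>r. m j = r *s cross (flip w) (flip w')" for j
      using perp_cross[OF cw] orth[of j] by (simp add: J_pair_dual)
    then obtain r where r: "\<And>j. m j = r j *s cross (flip w) (flip w')" by metis
    obtain p q where pq: "cross p q \<noteq> 0" "(\<Sum>j\<in>UNIV. p $ j * r j) = 0" "(\<Sum>j\<in>UNIV. q $ j * r j) = 0"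
      using independent_pair_perp[of "\<chi> j. r j"] by auto
    have "\<beta> *s col_comb R x 1 + (- \<alpha>) *s col_comb R x 2 = (\<Sum>j\<in>UNIV. x $ j * r j) *s cross (flip w) (flip w')" for x
    proof -
      have "\<beta> *s col_comb R x 1 + (- \<alpha>) *s col_comb R x 2 = (\<Sum>j\<in>UNIV. x $ j *s m j)"
        by (simp add: col_comb_def m_def sum_3 vec_eq_iff algebra_simps)
      also have "\<dots> = (\<Sum>j\<in>UNIV. x $ j * r j) *s cross (flip w) (flip w')"
        by (simp add: r vec.scale_sum_left)
      finally show ?thesis .
    qed
    from this[of p] this[of q] pq
    have "\<beta> *s col_comb R p 1 + (- \<alpha>) *s col_comb R p 2 = 0" "\<beta> *s col_comb R q 1 + (- \<alpha>) *s col_comb R q 2 = 0"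
      by simp_all
    moreover have "\<beta> \<noteq> 0 \<or> - \<alpha> \<noteq> 0" using ab by auto
    ultimately show False
      using R[unfolded stable_iff_pencil, THEN conjunct2, rule_format, of \<beta> "- \<alpha>" p q] pq(1) by blast
  qed
qed (rule inj)

lemma stable_injective: "R \<in> stable_matrices \<Longrightarrow> col_comb R u 1 = 0 \<Longrightarrow> col_comb R u 2 = 0 \<Longrightarrow> u = 0"
  unfolding stable_iff_pencil by blast

lemma stable_annihilator_exists:
  assumes "R \<in> stable_matrices" obtains S where "S \<in> stable_matrices" "gram S R = 0"
proof (rule gram_annihilator[OF stable_injective[OF assms]])
  fix S assume S: "gram S R = 0" "\<And>u. col_comb S u 1 = 0 \<Longrightarrow> col_comb S u 2 = 0 \<Longrightarrow> u = 0"
  from stable_annihilator[OF assms S] S(1) show thesis by (rule that)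
qed

section \<open>Independence and spans under limits\<close>

lemma lin_indep_triple_left_inverse:
  assumes "lin_indep_triple u"
  obtains L :: "complex^(3 \<times> 3)^3" where "\<And>j. L *v u j = axis j 1"
proof -
  define M :: "complex^3^(3 \<times> 3)" where "M = (\<chi> m j. u j $ m)"
  have M: "M *v k = (\<Sum>j\<in>UNIV. k $ j *s u j)" for k
    by (simp add: M_def matrix_vector_mult_def vec_eq_iff mult.commute)
  have "\<forall>k. M *v k = 0 \<longrightarrow> k = 0"
    using assms unfolding lin_indep_triple_iff M by (auto simp: vec_eq_iff[of _ 0])
  then obtain L where L: "L ** M = mat 1" unfolding matrix_left_invertible_ker[symmetric] ..
  have "L *v u j = axis j 1" for j
  proof -
    have "u j = M *v axis j 1"
      by (simp add: M_def mult_axis column_def vec_eq_iff)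
    then show ?thesis by (simp add: matrix_vector_mul_assoc L)
  qed
  then show thesis by (rule that)
qed

text \<open>A determinant after projection to dimension three: nonvanishing certifies independence,
  and continuity in \<open>u\<close> makes independence an open condition.\<close>

definition triple_det :: "complex^(3 \<times> 3)^3 \<Rightarrow> (3 \<Rightarrow> W_tensor_W) \<Rightarrow> complex" where
  "triple_det L u = det (\<chi> a b. (L *v u b) $ a)"

lemma triple_matrix:
  fixes L :: "complex^(3 \<times> 3)^3"
  shows "(\<chi> a b. (L *v u b) $ a) *v k = L *v (\<Sum>j\<in>UNIV. k $ j *s u j)"
proof -
  have "L *v (\<Sum>j\<in>UNIV. k $ j *s u j) = (\<Sum>j\<in>UNIV. k $ j *s (L *v u j))"
    by (simp add: vec.linear_sum[OF matrix_vector_mul_linear_gen] vector_scalar_commute)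
  moreover have "((\<chi> a b. (L *v u b) $ a) *v k) $ i = (\<Sum>j\<in>UNIV. k $ j *s (L *v u j)) $ i" for i
    unfolding sum_component vector_smult_component
    by (subst matrix_vector_mult_def) (simp add: mult.commute)
  ultimately show ?thesis by (simp add: vec_eq_iff)
qed

lemma triple_det_nonzero:
  assumes "triple_det L u \<noteq> 0" shows "lin_indep_triple u"
  unfolding lin_indep_triple_iff
proof (intro allI impI)
  fix k j assume "(\<Sum>j\<in>UNIV. k j *s u j) = 0"
  then have "(\<chi> a b. (L *v u b) $ a) *v (\<chi> j. k j) = 0"
    unfolding triple_matrix by simp
  moreover obtain G where "G ** (\<chi> a b. (L *v u b) $ a) = mat 1"
    using assms unfolding triple_det_def invertible_det_nz[symmetric] invertible_def by blast
  ultimately have "(\<chi> j. k j) = 0"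
    by (metis matrix_vector_mul_assoc matrix_vector_mul_lid matrix_vector_mult_0_right)
  then show "k j = 0" by (simp add: vec_eq_iff)
qed

lemma tendsto_matrix_vector_mult:
  fixes v :: "'x \<Rightarrow> complex^'n" and A :: "'x \<Rightarrow> complex^'n^'m"
  assumes "(A \<longlongrightarrow> B) F" "(v \<longlongrightarrow> w) F" shows "((\<lambda>x. A x *v v x) \<longlongrightarrow> B *v w) F"
  unfolding matrix_vector_mult_def
  by (intro tendsto_vec_lambda tendsto_sum tendsto_mult tendsto_vec_nth assms)

lemmas tendsto_mult_vec = tendsto_matrix_vector_mult[OF tendsto_const]

lemma tendsto_triple_det:
  assumes "\<And>j. ((\<lambda>x. u x j) \<longlongrightarrow> v j) F" shows "((\<lambda>x. triple_det L (u x)) \<longlongrightarrow> triple_det L v) F"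
  unfolding triple_det_def det_3 vec_lambda_beta
  by (intro tendsto_intros tendsto_mult_vec assms)

lemma lin_indep_triple_eventually:
  assumes lim: "\<And>j. ((\<lambda>x. u x j) \<longlongrightarrow> v j) F" and v: "lin_indep_triple v"
  shows "eventually (\<lambda>x. lin_indep_triple (u x)) F"
proof -
  obtain L where L: "\<And>j. L *v v j = axis j 1" using lin_indep_triple_left_inverse[OF v] by blast
  have "triple_det L v = 1"
    by (simp add: triple_det_def L det_3 axis_def)
  then have "eventually (\<lambda>x. triple_det L (u x) \<noteq> 0) F"
    by (intro tendsto_imp_eventually_ne[OF tendsto_triple_det[OF lim]]) simp
  then show ?thesis by (rule eventually_mono) (rule triple_det_nonzero)
qed

text \<open>Membership in the span is expressed by Cramer's rule with denominators cleared,
  \<open>lhs u v = rhs u v\<close>. This is an identity between continuous expressions, so it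
  survives the limit, where the determinant is 1.\<close>

lemma span_triple_closed:
  assumes F: "F \<noteq> bot" and u: "\<And>j. ((\<lambda>x. u x j) \<longlongrightarrow> u0 j) F" and v: "(v \<longlongrightarrow> v0) F"
    and u0: "lin_indep_triple u0" and ev: "eventually (\<lambda>x. v x \<in> vec.span (range (u x))) F"
  shows "v0 \<in> vec.span (range u0)"
proof -
  obtain L where L: "\<And>j. L *v u0 j = axis j 1" using lin_indep_triple_left_inverse[OF u0] by blast
  define G where "G u = (\<chi> a b. (L *v u b) $ a)" for u :: "3 \<Rightarrow> W_tensor_W"
  have G1: "G u0 = mat 1" by (simp add: G_def L vec_eq_iff axis_def mat_def)
  define lhs where "lhs u v = det (G u) *s v" for u and v :: W_tensor_W
  define rhs where "rhs u v = (\<Sum>b\<in>UNIV. (transpose (cof (G u)) *v (L *v v)) $ b *s u b)" for u v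
  have eq: "lhs u v = rhs u v" if v: "v \<in> vec.span (range u)" for u v
  proof -
    obtain k where k: "v = (\<Sum>j\<in>UNIV. k j *s u j)" using v unfolding span_range3 by blast
    have "L *v v = G u *v (\<chi> j. k j)" unfolding G_def triple_matrix k by simp
    then have "transpose (cof (G u)) *v (L *v v) = det (G u) *s (\<chi> j. k j)"
      by (simp add: matrix_vector_mul_assoc cof_transpose_mult)
        (simp add: mat_def matrix_vector_mult_def vec_eq_iff if_distrib[of "\<lambda>c. c * _"] sum.delta cong: if_cong)
    then show ?thesis by (simp add: lhs_def rhs_def k vec.scale_sum_right)
  qed
  have tG: "((\<lambda>x. G (u x) $ a $ b) \<longlongrightarrow> G u0 $ a $ b) F" for a b
    unfolding G_def vec_lambda_beta by (intro tendsto_intros tendsto_mult_vec u)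
  have 1: "((\<lambda>x. lhs (u x) (v x)) \<longlongrightarrow> lhs u0 v0) F"
    unfolding lhs_def det_3 vector_scalar_mult_def
    by (intro tendsto_vec_lambda tendsto_mult tendsto_add tendsto_diff tG tendsto_vec_nth v)
  have 2: "((\<lambda>x. rhs (u x) (v x)) \<longlongrightarrow> rhs u0 v0) F"
    unfolding rhs_def vector_scalar_mult_def transpose_def cof_def vec_lambda_beta
    by (intro tendsto_sum tendsto_vec_lambda tendsto_mult tendsto_diff tG tendsto_vec_nth tendsto_matrix_vector_mult
        tendsto_const v u)
  have "eventually (\<lambda>x. lhs (u x) (v x) = rhs (u x) (v x)) F"
    using ev by (rule eventually_mono) (rule eq)
  then have "lhs u0 v0 = rhs u0 v0"
    by (intro tendsto_unique[OF F _ 2] Lim_transform_eventually[OF 1])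
  then have "v0 = rhs u0 v0" by (simp add: lhs_def G1)
  then show ?thesis unfolding span_range3 rhs_def by blast
qed

lemma tendsto_minor:
  assumes "(R \<longlongrightarrow> R0) F" shows "((\<lambda>x. minor (R x) j) \<longlongrightarrow> minor R0 j) F"
  unfolding minor_def sym_mult_def minus_vec_def
  by (intro tendsto_intros tendsto_vec_lambda assms) simp_all

lemma stable_eventually:
  assumes "(R \<longlongrightarrow> R0) F" "R0 \<in> stable_matrices" shows "eventually (\<lambda>x. R x \<in> stable_matrices) F"
  using lin_indep_triple_eventually[OF tendsto_minor[OF assms(1)]] assms(2) by (simp add: stable_matrices_def)

text \<open>The failure of \<open>S0\<close> to annihilate \<open>R\<close> is removed by
  subtracting a combination of the dual system \<open>D\<close>. Multiplying through by
  \<open>det (gram D R)\<close> avoids division, so the formula is exact for every \<open>R\<close>,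
  and at \<open>R0\<close> it returns \<open>S0\<close>.\<close>

lemma annihilator_family:
  assumes R0: "R0 \<in> stable_matrices" and S0: "gram S0 R0 = 0"
  obtains T where "\<And>R. gram (T R) R = 0" "\<And>R (F :: 'b filter). (R \<longlongrightarrow> R0) F \<Longrightarrow> ((\<lambda>x. T (R x)) \<longlongrightarrow> S0) F"
proof -
  obtain D where D: "gram D R0 = mat 1" by (rule gram_dual[OF stable_injective[OF R0]])
  define X where "X R = cof (gram D R) ** transpose (gram S0 R)" for R
  define T where "T R = (\<chi> i c. det (gram D R) *s S0 $ i $ c - col_act D (X R) $ i $ c)" for R
  show thesis
  proof
    fix R
    have "gram (T R) R = (\<chi> c a. det (gram D R) * gram S0 R $ c $ a) - gram (col_act D (X R)) R"
      by (simp add: gram_def T_def vec_eq_iff J_pair_def algebra_simps)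
    also have "gram (col_act D (X R)) R = gram S0 R ** (transpose (cof (gram D R)) ** gram D R)"
      by (simp add: gram_col_act X_def matrix_transpose_mul matrix_mul_assoc)
    also have "\<dots> = (\<chi> c a. det (gram D R) * gram S0 R $ c $ a)"
      unfolding cof_transpose_mult
      by (simp add: matrix_matrix_mult_def mat_def vec_eq_iff if_distrib[of "\<lambda>c. _ * c"] sum.delta cong: if_cong)
    finally show "gram (T R) R = 0" by simp
  next
    fix R and F :: "'b filter" assume R: "(R \<longlongrightarrow> R0) F"
    have tg: "((\<lambda>x. gram D (R x) $ c $ a) \<longlongrightarrow> gram D R0 $ c $ a) F" for D c a
      unfolding gram_def vec_lambda_beta J_pair_def by (intro tendsto_intros R)
    have tX: "((\<lambda>x. X (R x) $ c $ a) \<longlongrightarrow> X R0 $ c $ a) F" for c a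
      unfolding X_def matrix_matrix_mult_def cof_def transpose_def vec_lambda_beta
      by (intro tendsto_sum tendsto_mult tendsto_diff tg)
    have "((\<lambda>x. T (R x)) \<longlongrightarrow> T R0) F"
      unfolding T_def col_act_def col_comb_def column_def det_3 vector_scalar_mult_def minus_vec_def vec_lambda_beta sum_component
      by (intro tendsto_vec_lambda tendsto_diff tendsto_add tendsto_sum tendsto_mult tg tX tendsto_const)
    moreover have "T R0 = S0"
      by (simp add: T_def D X_def S0 vec_eq_iff col_act_def col_comb_def column_def matrix_matrix_mult_def transpose_def)
    ultimately show "((\<lambda>x. T (R x)) \<longlongrightarrow> S0) F" by simp
  qed
qed

section \<open>Limits in \<open>Y\<close>\<close>

lemma topspace_Y: "topspace Y_topology = Y"
  using quotient_map_minor_net unfolding quotient_map_def by (simp add: Y_def)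

lemma limitin_Y:
  assumes R: "(R \<longlongrightarrow> R0) F" and R0: "R0 \<in> stable_matrices"
    and ev: "eventually (\<lambda>x. R x \<in> stable_matrices \<and> minor_net (R x) = H x) F"
  shows "limitin Y_topology H (minor_net R0) F"
  unfolding limitin_def topspace_Y
proof (intro conjI allI impI)
  show "minor_net R0 \<in> Y" using R0 by (simp add: Y_def)
  fix U assume U: "openin Y_topology U \<and> minor_net R0 \<in> U"
  then obtain V where V: "open V" "{R \<in> stable_matrices. minor_net R \<in> U} = stable_matrices \<inter> V"
    unfolding openin_Y_topology openin_open by blast
  have evV: "eventually (\<lambda>x. R x \<in> V) F"
    using R V U R0 by (intro topological_tendstoD) auto
  have imp: "minor_net S \<in> U" if "S \<in> stable_matrices" "S \<in> V" for S
    using V(2) that by blast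
  from ev evV show "eventually (\<lambda>x. H x \<in> U) F"
    by eventually_elim (use imp in metis)
qed

section \<open>Cells of diagonal tori and Pluecker coordinates\<close>

text \<open>The weights are a parameter because the torus of the cells and its conjugate are treated
  alike.\<close>

definition weight_matrix :: "(3 \<Rightarrow> nat) \<Rightarrow> complex \<Rightarrow> complex^3^3" where
  "weight_matrix w t = (\<chi> i j. if i = j then t ^ w i else 0)"

definition weight :: "(3 \<Rightarrow> nat) \<Rightarrow> 3 \<times> 3 \<Rightarrow> nat" where
  "weight w m = w (fst m) + w (snd m)"

lemma sym_act_weight_matrix: "sym_act (weight_matrix w t) q $ m = t ^ weight w m * q $ m"
proof -
  obtain i k where m: "m = (i, k)" by force
  have "sym_act (weight_matrix w t) q $ m =
     (\<Sum>a\<in>UNIV. \<Sum>b\<in>UNIV. (if i = a then t ^ w i else 0) * (if k = b then t ^ w k else 0) * q $ (a, b))"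
    unfolding sym_act_def weight_matrix_def m sum_pair vec_lambda_beta fst_conv snd_conv ..
  also have "\<dots> = (\<Sum>a\<in>UNIV. (if i = a then t ^ w i else 0) * (t ^ w k * q $ (a, k)))"
    by (intro sum.cong refl) (simp add: if_distrib[of "\<lambda>c. _ * c"] if_distrib[of "\<lambda>c. c * _"] mult.assoc sum.delta' cong: if_cong)
  also have "\<dots> = t ^ w i * (t ^ w k * q $ (i, k))"
    by (simp add: if_distrib[of "\<lambda>c. c * _"] sum.delta' cong: if_cong)
  finally show ?thesis by (simp add: m weight_def power_add)
qed

definition weight_cell :: "(3 \<Rightarrow> nat) \<Rightarrow> W_tensor_W set \<Rightarrow> W_tensor_W set set" where
  "weight_cell w H\<^sub>0 = {H \<in> Y. limitin Y_topology (\<lambda>t. sym_act (weight_matrix w t) ` H) H\<^sub>0 at_infinity}"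

definition pluecker :: "(3 \<Rightarrow> 3 \<times> 3) \<Rightarrow> (3 \<Rightarrow> W_tensor_W) \<Rightarrow> complex" where
  "pluecker I u = det (\<chi> a b. u b $ I a)"

lemma pluecker_nonzero:
  assumes "pluecker I u \<noteq> 0" shows "lin_indep_triple u"
proof (rule triple_det_nonzero)
  have "((\<chi> a. axis (I a) 1) *v v) $ a = v $ I a" for v :: W_tensor_W and a
    by (simp add: matrix_vector_mult_def axis_def if_distrib[of "\<lambda>c. c * _"] sum.delta cong: if_cong)
  then show "triple_det (\<chi> a. axis (I a) 1) u \<noteq> 0"
    using assms by (simp add: triple_det_def pluecker_def)
qed

lemma pluecker_combination:
  assumes "\<And>b. v b = (\<Sum>k\<in>UNIV. C $ k $ b *s u k)"
  shows "pluecker I v = pluecker I u * det C"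
proof -
  have "(\<chi> a b. v b $ I a) = (\<chi> a b. u b $ I a) ** C"
    by (simp add: assms matrix_matrix_mult_def vec_eq_iff mult.commute)
  then show ?thesis by (simp add: pluecker_def det_mul)
qed

lemma minor_net_eq_combination:
  assumes "minor_net R = minor_net R'"
  shows "\<exists>C :: complex^3^3. \<forall>b. minor R' b = (\<Sum>k\<in>UNIV. C $ k $ b *s minor R k)"
proof -
  have "\<exists>c. minor R' b = (\<Sum>k\<in>UNIV. c k *s minor R k)" for b
  proof -
    have "minor R' b \<in> minor_net R'" unfolding minor_net_def by (intro vec.span_base) simp
    then have "minor R' b \<in> minor_net R" using assms by simp
    then show ?thesis unfolding minor_net_def span_range3 by blast
  qed
  then obtain c where "\<And>b. minor R' b = (\<Sum>k\<in>UNIV. c b k *s minor R k)" by metis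
  then show ?thesis by (intro exI[of _ "\<chi> k b. c b k"]) simp
qed

text \<open>A change of basis multiplies all Pluecker coordinates by one determinant, so the
  comparison of norms depends on the net alone and defines an open subset of \<open>Y\<close>; no
  quotient of coordinates has to be formed.\<close>

definition pluecker_less :: "(3 \<Rightarrow> 3 \<times> 3) \<Rightarrow> (3 \<Rightarrow> 3 \<times> 3) \<Rightarrow> W_matrix \<Rightarrow> bool" where
  "pluecker_less I' I R \<longleftrightarrow> norm (pluecker I' (minor R)) < norm (pluecker I (minor R))"

lemma pluecker_less_net:
  assumes "minor_net R = minor_net R'" "pluecker_less I' I R'"
  shows "pluecker_less I' I R"
proof -
  obtain C :: "complex^3^3" where C: "\<forall>b. minor R' b = (\<Sum>k\<in>UNIV. C $ k $ b *s minor R k)"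
    using minor_net_eq_combination[OF assms(1)] ..
  show ?thesis
    using assms(2) unfolding pluecker_less_def pluecker_combination[OF C[rule_format]] norm_mult
    by (rule mult_right_less_imp_less) simp
qed

lemma openin_pluecker_less:
  "openin Y_topology {H \<in> Y. \<forall>R\<in>stable_matrices. minor_net R = H \<longrightarrow> pluecker_less I' I R}"
  (is "openin _ ?Op")
  unfolding openin_Y_topology
proof
  have "{R \<in> stable_matrices. minor_net R \<in> ?Op} = stable_matrices \<inter> {R. pluecker_less I' I R}"
    by (auto simp: Y_def dest: pluecker_less_net)
  moreover have "open {R. pluecker_less I' I R}"
  proof -
    have "continuous (at R) (\<lambda>R. pluecker I (minor R))" for R I
      unfolding pluecker_def det_3 vec_lambda_beta continuous_at
      by (intro tendsto_intros tendsto_minor)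
    then show ?thesis
      unfolding pluecker_less_def
      by (intro open_Collect_less continuous_on_norm) (simp_all add: continuous_at_imp_continuous_on)
  qed
  ultimately show "openin (top_of_set stable_matrices) {R \<in> stable_matrices. minor_net R \<in> ?Op}"
    by (simp add: openin_open_Int)
qed auto

text \<open>\<open>I b\<close> is the position of the monomial occurring in \<open>minor R\<^sub>0 b\<close>; mixed monomials also occupy the
  transposed position.\<close>

definition monomial_minors :: "W_matrix \<Rightarrow> (3 \<Rightarrow> 3 \<times> 3) \<Rightarrow> bool" where
  "monomial_minors R\<^sub>0 I \<longleftrightarrow> R\<^sub>0 \<in> stable_matrices \<and> (\<forall>a b. minor R\<^sub>0 b $ I a \<noteq> 0 \<longleftrightarrow> a = b) \<and>
     (\<forall>b m. m \<noteq> I b \<longrightarrow> m \<noteq> prod.swap (I b) \<longrightarrow> minor R\<^sub>0 b $ m = 0)"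

text \<open>Column operations act on the minors through a cofactor matrix, so a prescribed change of
  basis is attained up to a common scalar. Keeping \<open>\<kappa>\<close> avoids extracting a
  square root.\<close>

definition reduced :: "W_matrix \<Rightarrow> (3 \<Rightarrow> 3 \<times> 3) \<Rightarrow> complex \<Rightarrow> bool" where
  "reduced R I \<kappa> \<longleftrightarrow> R \<in> stable_matrices \<and> \<kappa> \<noteq> 0 \<and> (\<forall>a b. minor R b $ I a = (if a = b then \<kappa> else 0))"

text \<open>Replacing one position in an otherwise diagonal situation makes a single coefficient of
  the basis visible as a Pluecker coordinate.\<close>

lemma pluecker_update_diagonal:
  assumes "\<And>a b. a \<noteq> b \<Longrightarrow> u b $ I a = 0"
  shows "pluecker (I(b := m)) u = u (b + 1) $ I (b + 1) * u (b + 2) $ I (b + 2) * u b $ m"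
proof -
  have "b = 1 \<or> b = 2 \<or> b = 3" by (rule exhaust_3)
  then show ?thesis
    by (elim disjE) (simp_all add: pluecker_def det_3 assms)
qed

lemma reduced_exists:
  assumes "pluecker I (minor R) \<noteq> 0"
  obtains R' \<kappa> where "reduced R' I \<kappa>" "minor_net R' = minor_net R"
proof -
  define M where "M = (\<chi> a b. minor R b $ I a)"
  define X where "X = transpose (cof M)"
  define \<kappa> where "\<kappa> = det X * det M"
  have dM: "det M \<noteq> 0" using assms by (simp add: M_def pluecker_def)
  have MX: "M ** X = mat (det M)" by (simp add: X_def mult_cof_transpose)
  have "det (mat (det M) :: complex^3^3) = det M ^ 3"
    by (subst det_3) (simp add: mat_def power3_eq_cube)
  then have "det M * det X = det M ^ 3"
    using arg_cong[OF MX, of det] by (simp add: det_mul)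
  then have \<kappa>: "\<kappa> \<noteq> 0" using dM by (auto simp: \<kappa>_def)
  \<comment> \<open>By \<open>cof_cof\<close> the minors change by \<open>det X\<close> times
    \<open>X\<close>, and \<open>X\<close> is the adjugate of the coefficient matrix
    \<open>M\<close>; this explains the value of \<open>\<kappa>\<close>.\<close>
  define R' where "R' = col_act R (cof X)"
  have m: "minor R' b = (\<Sum>k\<in>UNIV. (det X * X $ k $ b) *s minor R k)" for b
    by (simp add: R'_def minor_col_act cof_cof)
  have diag: "minor R' b $ I a = (if a = b then \<kappa> else 0)" for a b
  proof -
    have "minor R' b $ I a = det X * (M ** X) $ a $ b"
      by (simp add: m matrix_matrix_mult_def M_def sum_distrib_left algebra_simps)
    then show ?thesis by (simp add: MX mat_def \<kappa>_def)
  qed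
  have li: "lin_indep_triple (minor R')"
    by (rule pluecker_nonzero[of I]) (simp add: pluecker_def det_3 diag \<kappa>)
  have "minor_net R' = minor_net R"
    unfolding minor_net_def
  proof (rule span_triple_eqI[OF li])
    show "minor R' j \<in> vec.span (range (minor R))" for j
      unfolding m by (intro vec.span_sum vec.span_scale vec.span_base rangeI)
  qed
  then show thesis using li \<kappa> diag by (intro that[of R' \<kappa>]) (auto simp: reduced_def stable_matrices_def)
qed

lemma pluecker_weight_matrix:
  "pluecker I (\<lambda>b. sym_act (weight_matrix w t) (u b)) = t ^ (weight w (I 1) + weight w (I 2) + weight w (I 3)) * pluecker I u"
  by (simp add: pluecker_def det_3 sym_act_weight_matrix power_add algebra_simps)

text \<open>At the fixed point the coordinate at \<open>I\<close> dominates every coordinate at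
  \<open>I(b := m)\<close>, hence also along the orbit for large \<open>t\<close>. On a reduced
  basis these coordinates are powers of \<open>t\<close> times \<open>\<kappa>\<close> cubed and
  \<open>\<kappa>\<close> squared times a coefficient; a coefficient of greater weight would
  eventually win, so it is zero.\<close>

lemma weight_cell_reduced:
  assumes R0: "monomial_minors R\<^sub>0 I" and H: "H \<in> weight_cell w (minor_net R\<^sub>0)"
  obtains R \<kappa> where "reduced R I \<kappa>" "minor_net R = H"
    "\<And>b m. weight w m > weight w (I b) \<Longrightarrow> minor R b $ m = 0"
proof -
  define Op where "Op I' = {H \<in> Y. \<forall>R\<in>stable_matrices. minor_net R = H \<longrightarrow> pluecker_less I' I R}" for I'
  have s0: "R\<^sub>0 \<in> stable_matrices" and nz: "\<And>a b. minor R\<^sub>0 b $ I a \<noteq> 0 \<longleftrightarrow> a = b"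
    and z: "\<And>b m. m \<noteq> I b \<Longrightarrow> m \<noteq> prod.swap (I b) \<Longrightarrow> minor R\<^sub>0 b $ m = 0"
    using R0 by (auto simp: monomial_minors_def)
  have off: "minor R\<^sub>0 b $ I a = 0" if "a \<noteq> b" for a b
    using nz that by blast
  have "pluecker I (minor R\<^sub>0) = minor R\<^sub>0 2 $ I 2 * minor R\<^sub>0 3 $ I 3 * minor R\<^sub>0 1 $ I 1"
    using pluecker_update_diagonal[of "minor R\<^sub>0" I 1 "I 1", OF off] by simp
  then have p0: "pluecker I (minor R\<^sub>0) \<noteq> 0"
    using nz by simp
  have ev_less: "eventually (\<lambda>t. norm t \<ge> 1 \<and> pluecker_less (I(b := m)) I (W_act (weight_matrix w t) R)) at_infinity"
    if R: "R \<in> stable_matrices" "minor_net R = H" and m: "m \<noteq> I b" "m \<noteq> prod.swap (I b)" for R b m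
  proof -
    have "pluecker (I(b := m)) (minor R\<^sub>0) = 0"
      using z[OF m] by (subst pluecker_update_diagonal[OF off]) auto
    then have "pluecker_less (I(b := m)) I R\<^sub>0" using p0 by (simp add: pluecker_less_def)
    then have "minor_net R\<^sub>0 \<in> Op (I(b := m))"
      using s0 by (auto simp: Op_def Y_def dest: pluecker_less_net)
    moreover have "openin Y_topology (Op (I(b := m)))" unfolding Op_def by (rule openin_pluecker_less)
    ultimately have "eventually (\<lambda>t. sym_act (weight_matrix w t) ` H \<in> Op (I(b := m))) at_infinity"
      using H unfolding weight_cell_def limitin_def by blast
    moreover have "eventually (\<lambda>t :: complex. norm t \<ge> 1) at_infinity"
      by (auto simp: eventually_at_infinity)
    ultimately show ?thesis
    proof eventually_elim
      case (elim t)
      have t: "t \<noteq> 0" using elim by auto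
      have inv: "invertible (weight_matrix w t)"
        unfolding invertible_det_nz weight_matrix_def det_3 using t by simp
      show ?case
        using elim stable_W_act[OF inv] R unfolding Op_def by (auto simp: minor_net_W_act)
    qed
  qed
  have "H \<in> Y" using H by (simp add: weight_cell_def)
  then obtain R1 where R1: "R1 \<in> stable_matrices" "minor_net R1 = H" unfolding Y_def by blast
  \<comment> \<open>A strict inequality between norms at a single replacement already makes the
    larger coordinate nonzero; \<open>b = 1\<close> is taken.\<close>
  have "pluecker I (minor R1) \<noteq> 0"
  proof -
    have "\<exists>m. m \<noteq> I 1 \<and> m \<noteq> prod.swap (I 1)"
    proof (cases "I 1 = (1, 1)")
      case True
      then show ?thesis by (intro exI[of _ "(2, 2)"]) simp
    next
      case False
      then show ?thesis by (intro exI[of _ "(1, 1)"]) (cases "I 1"; auto)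
    qed
    then obtain m where m: "m \<noteq> I 1" "m \<noteq> prod.swap (I 1)" by blast
    from eventually_happens'[OF trivial_limit_at_infinity ev_less[OF R1 m]]
    show ?thesis
      unfolding pluecker_less_def minor_W_act pluecker_weight_matrix by auto
  qed
  then obtain R \<kappa> where R: "reduced R I \<kappa>" "minor_net R = H" using R1(2) reduced_exists by metis
  show thesis
  proof (rule that[OF R])
    fix b m assume wm: "weight w m > weight w (I b)"
    then have "m \<noteq> I b" "m \<noteq> prod.swap (I b)" by (auto simp: weight_def)
    from ev_less[OF _ R(2) this]
    have ev: "eventually (\<lambda>t. norm t \<ge> 1 \<and> pluecker_less (I(b := m)) I (W_act (weight_matrix w t) R)) at_infinity"
      using R(1) by (simp add: reduced_def)
    have d: "minor R b $ I a = (if a = b then \<kappa> else 0)" for a b using R by (simp add: reduced_def)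
    have p1: "pluecker (I(b := m)) (minor R) = \<kappa> * \<kappa> * minor R b $ m"
      by (subst pluecker_update_diagonal) (simp_all add: d)
    have p2: "pluecker I (minor R) = \<kappa> * \<kappa> * \<kappa>"
      by (simp add: pluecker_def det_3 d)
    define e where "e = weight w (I (b + 1)) + weight w (I (b + 2))"
    have e1: "weight w ((I(b := m)) 1) + weight w ((I(b := m)) 2) + weight w ((I(b := m)) 3) = e + weight w m"
      and e2: "weight w (I 1) + weight w (I 2) + weight w (I 3) = e + weight w (I b)"
      using exhaust_3[of b] by (auto simp: e_def)
    show "minor R b $ m = 0"
    proof (rule ccontr)
      assume nz: "minor R b $ m \<noteq> 0"
      \<comment> \<open>Beyond this bound one extra power of \<open>t\<close> compensates the ratio
        of \<open>\<kappa>\<close> to the coefficient, and the weights differ by at least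
        one.\<close>
      have "eventually (\<lambda>t :: complex. norm t \<ge> max 1 (norm \<kappa> / norm (minor R b $ m))) at_infinity"
        unfolding eventually_at_infinity by blast
      from eventually_happens'[OF trivial_limit_at_infinity eventually_conj[OF ev this]]
      obtain t :: complex where less: "pluecker_less (I(b := m)) I (W_act (weight_matrix w t) R)"
        and t1: "norm t \<ge> 1" and t2: "norm t \<ge> norm \<kappa> / norm (minor R b $ m)" by auto
      have t0: "t \<noteq> 0" using t1 by auto
      have "(norm (t ^ e) * norm (\<kappa> * \<kappa>)) * (norm (t ^ weight w m) * norm (minor R b $ m))
          < (norm (t ^ e) * norm (\<kappa> * \<kappa>)) * (norm (t ^ weight w (I b)) * norm \<kappa>)"
        using less unfolding pluecker_less_def minor_W_act pluecker_weight_matrix e1 e2 p1 p2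
        by (simp add: power_add norm_mult mult_ac)
      then have t: "norm (t ^ weight w m) * norm (minor R b $ m) < norm (t ^ weight w (I b)) * norm \<kappa>"
        by (rule mult_less_cancel_left_pos[THEN iffD1, rotated]) (use t0 R in \<open>simp add: reduced_def\<close>)
      have "norm \<kappa> \<le> norm t * norm (minor R b $ m)"
        using t2 nz by (simp add: pos_divide_le_eq)
      then have "norm (t ^ weight w (I b)) * norm \<kappa> \<le> norm (t ^ weight w (I b)) * (norm t * norm (minor R b $ m))"
        by (intro mult_left_mono) auto
      also have "\<dots> = norm t ^ (Suc (weight w (I b))) * norm (minor R b $ m)"
        by (simp add: norm_power mult_ac)
      also have "\<dots> \<le> norm t ^ weight w m * norm (minor R b $ m)"
        using wm t1 by (intro mult_right_mono power_increasing) auto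
      finally show False using t by (simp add: norm_power)
    qed
  qed
qed

section \<open>Recovering a matrix from its syzygies\<close>

text \<open>For symmetric \<open>u a\<close> this is, up to a constant factor, the symmetric tensor
  of the cubic obtained by summing the products of \<open>r $ a\<close> and \<open>u a\<close>. It
  vanishes exactly when \<open>r\<close> is a linear syzygy of the quadrics.\<close>

definition syzygy :: "(3 \<Rightarrow> W_tensor_W) \<Rightarrow> W^3 \<Rightarrow> complex^3^3^3" where
  "syzygy u r = (\<chi> i j k. \<Sum>a\<in>UNIV. r $ a $ i * u a $ (j, k) + r $ a $ j * u a $ (i, k) + r $ a $ k * u a $ (i, j))"

text \<open>Laplace expansion of the 3x3 determinant in which row \<open>l\<close> is
  repeated.\<close>

lemma syzygy_minor: "syzygy (minor R) (R $ l) = 0"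
proof -
  have "syzygy (minor R) (R $ l) $ i $ j $ k = 0" for i j k
    using exhaust_2[of l]
    by (elim disjE) (simp_all add: syzygy_def sum_3 minor_nth, simp_all add: field_simps)
  then show ?thesis by (simp add: vec_eq_iff)
qed

lemma syzygy_scale_left: "syzygy (\<lambda>a. c *s u a) r $ i $ j $ k = c * syzygy u r $ i $ j $ k"
  by (simp add: syzygy_def sum_3 algebra_simps)

lemma syzygy_diff_left: "syzygy (\<lambda>a. u a - v a) r = syzygy u r - syzygy v r"
  by (simp add: syzygy_def sum_3 vec_eq_iff algebra_simps)

lemma syzygy_lin: "syzygy u (\<chi> a. c *s r $ a + d *s s $ a) $ i $ j $ k
    = c * syzygy u r $ i $ j $ k + d * syzygy u s $ i $ j $ k"
  by (simp add: syzygy_def sum_3 algebra_simps)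

lemma norm_vec_le_sum: "norm (x :: 'a::real_normed_vector^'n) \<le> (\<Sum>i\<in>UNIV. norm (x $ i))"
  unfolding norm_vec_def by (rule L2_set_le_sum) simp

text \<open>The constant counts 27 entries with three products each.\<close>

lemma norm_syzygy_le: "norm (syzygy u r) \<le> 81 * (\<Sum>a\<in>UNIV. norm (u a)) * norm r"
proof -
  have "norm (r $ a $ i * u a $ m) \<le> norm r * norm (u a)" for a i m
    unfolding norm_mult
    by (intro mult_mono order_trans[OF Finite_Cartesian_Product.norm_nth_le Finite_Cartesian_Product.norm_nth_le]
        Finite_Cartesian_Product.norm_nth_le) auto
  then have "norm (r $ a $ i * u a $ (j, k) + r $ a $ j * u a $ (i, k) + r $ a $ k * u a $ (i, j)) \<le> 3 * (norm r * norm (u a))" for a i j k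
    by (smt (verit, best) norm_triangle_ineq)
  then have "norm (syzygy u r $ i $ j $ k) \<le> (\<Sum>a\<in>UNIV. 3 * (norm r * norm (u a)))" for i j k
    unfolding syzygy_def vec_lambda_beta by (rule sum_norm_le)
  then have "norm (syzygy u r) \<le> (\<Sum>i\<in>(UNIV::3 set). \<Sum>j\<in>(UNIV::3 set). \<Sum>k\<in>(UNIV::3 set). \<Sum>a\<in>UNIV. 3 * (norm r * norm (u a)))"
    by (intro order_trans[OF norm_vec_le_sum] sum_mono)
  also have "\<dots> = 81 * (\<Sum>a\<in>UNIV. norm (u a)) * norm r"
    by (simp add: sum_distrib_left sum_distrib_right mult_ac)
  finally show ?thesis .
qed

section \<open>Continuous recovery of a matrix from a net\<close>

definition row_act :: "complex \<Rightarrow> complex \<Rightarrow> complex \<Rightarrow> complex \<Rightarrow> W_matrix \<Rightarrow> W_matrix" where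
  "row_act a b c d R = (\<chi> i j. if i = 1 then a *s R $ 1 $ j + b *s R $ 2 $ j else c *s R $ 1 $ j + d *s R $ 2 $ j)"

lemma minor_row_act: "minor (row_act a b c d R) j = (a * d - b * c) *s minor R j"
  by (simp add: vec_eq_iff minor_nth row_act_def split_paired_all) (simp add: field_simps)

lemma stable_scaled_minors:
  assumes "R \<in> stable_matrices" "c \<noteq> 0" "\<And>j. minor R' j = c *s minor R j"
  shows "R' \<in> stable_matrices" "minor_net R' = minor_net R"
proof -
  show s: "R' \<in> stable_matrices"
    unfolding stable_matrices_def mem_Collect_eq lin_indep_triple_iff
  proof (intro allI impI)
    fix k j assume "(\<Sum>j\<in>UNIV. k j *s minor R' j) = 0"
    then have "(\<Sum>j\<in>UNIV. (k j * c) *s minor R j) = 0" by (simp add: assms(3))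
    then have "k j * c = 0"
      using assms(1)[unfolded stable_matrices_def mem_Collect_eq lin_indep_triple_iff, THEN spec, of "\<lambda>j. k j * c"]
      by blast
    then show "k j = 0" using assms(2) by simp
  qed
  show "minor_net R' = minor_net R"
    unfolding minor_net_def
  proof (rule span_triple_eqI)
    show "lin_indep_triple (minor R')" using s by (simp add: stable_matrices_def)
    show "minor R' j \<in> vec.span (range (minor R))" for j
      unfolding assms(3) by (intro vec.span_scale vec.span_base) simp
  qed
qed

text \<open>The positions \<open>(a\<^sub>1, k\<^sub>1)\<close>, \<open>(a\<^sub>2, k\<^sub>2)\<close> normalise the two rows, so that a syzygy vanishing
  there has to be zero if the rows span all linear syzygies.\<close>

definition syzygies_are_rows :: "W_matrix \<Rightarrow> 3 \<Rightarrow> 3 \<Rightarrow> 3 \<Rightarrow> 3 \<Rightarrow> bool" where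
  "syzygies_are_rows R\<^sub>0 a\<^sub>1 k\<^sub>1 a\<^sub>2 k\<^sub>2 \<longleftrightarrow>
     R\<^sub>0 $ 1 $ a\<^sub>1 $ k\<^sub>1 = 1 \<and> R\<^sub>0 $ 1 $ a\<^sub>2 $ k\<^sub>2 = 0 \<and> R\<^sub>0 $ 2 $ a\<^sub>1 $ k\<^sub>1 = 0 \<and> R\<^sub>0 $ 2 $ a\<^sub>2 $ k\<^sub>2 = 1 \<and>
     (\<forall>r. syzygy (minor R\<^sub>0) r = 0 \<longrightarrow> r $ a\<^sub>1 $ k\<^sub>1 = 0 \<longrightarrow> r $ a\<^sub>2 $ k\<^sub>2 = 0 \<longrightarrow> r = 0)"

lemma syzygy_bounded_below:
  assumes "syzygies_are_rows R\<^sub>0 a\<^sub>1 k\<^sub>1 a\<^sub>2 k\<^sub>2"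
  shows "\<exists>B>0. \<forall>r. r $ a\<^sub>1 $ k\<^sub>1 = 0 \<longrightarrow> r $ a\<^sub>2 $ k\<^sub>2 = 0 \<longrightarrow> B * norm r \<le> norm (syzygy (minor R\<^sub>0) r)"
proof -
  \<comment> \<open>The two normalising coordinates are added to the target to make the map
    injective; an injective linear map in finite dimension is bounded below.\<close>
  define f where "f r = (syzygy (minor R\<^sub>0) r, r $ a\<^sub>1 $ k\<^sub>1, r $ a\<^sub>2 $ k\<^sub>2)" for r
  have lin: "linear f"
    by (intro linearI) (simp_all add: f_def syzygy_def vec_eq_iff sum_3 algebra_simps)
  have "inj f"
    unfolding linear_injective_0[OF lin] f_def using assms by (auto simp: syzygies_are_rows_def zero_prod_def)
  from linear_inj_bounded_below_pos[OF lin this]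
  obtain B where B: "B > 0" "\<And>r. B * norm r \<le> norm (f r)" by blast
  show ?thesis
  proof (intro exI[of _ B] conjI B(1) allI impI)
    fix r :: "W^3" assume "r $ a\<^sub>1 $ k\<^sub>1 = 0" "r $ a\<^sub>2 $ k\<^sub>2 = 0"
    then show "B * norm r \<le> norm (syzygy (minor R\<^sub>0) r)"
      using B(2)[of r] by (simp add: f_def norm_Pair)
  qed
qed

lemma stable_rows_independent:
  assumes "R \<in> stable_matrices" "\<And>j. \<alpha> *s R $ 1 $ j + \<beta> *s R $ 2 $ j = 0"
  shows "\<alpha> = 0 \<and> \<beta> = 0"
proof (rule ccontr)
  assume "\<not> ?thesis"
  then have nz: "\<alpha> \<noteq> 0 \<or> \<beta> \<noteq> 0" by blast
  have "\<alpha> *s col_comb R u 1 + \<beta> *s col_comb R u 2 = (\<Sum>j\<in>UNIV. u $ j *s (\<alpha> *s R $ 1 $ j + \<beta> *s R $ 2 $ j))" for u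
    by (simp add: col_comb_def sum_3 vec_eq_iff algebra_simps)
  then have 0: "\<alpha> *s col_comb R u 1 + \<beta> *s col_comb R u 2 = 0" for u
    by (simp add: assms(2))
  have "axis 1 1 \<noteq> (0 :: complex^3)" by simp
  then obtain v where "cross (axis 1 1) v \<noteq> 0" using cross_nonzero_ex by blast
  then show False
    using assms(1)[unfolded stable_iff_pencil, THEN conjunct2, rule_format, OF nz 0 0] by blast
qed

text \<open>Near a net whose syzygies are the rows of \<open>R\<^sub>0\<close>, the matrix is recovered continuously from the net
  as its space of linear syzygies.\<close>

lemma limitin_Y_syzygies:
  assumes R0: "R\<^sub>0 \<in> stable_matrices" and syz: "syzygies_are_rows R\<^sub>0 a\<^sub>1 k\<^sub>1 a\<^sub>2 k\<^sub>2"
    and q: "\<And>b. ((\<lambda>x. q x b) \<longlongrightarrow> minor R\<^sub>0 b) F"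
    and ev: "eventually (\<lambda>x. R x \<in> stable_matrices \<and> c x \<noteq> 0 \<and> (\<forall>b. minor (R x) b = c x *s q x b)) F"
  shows "limitin Y_topology (\<lambda>x. minor_net (R x)) (minor_net R\<^sub>0) F"
proof -
  obtain B where B: "B > 0"
    "\<And>r. r $ a\<^sub>1 $ k\<^sub>1 = 0 \<Longrightarrow> r $ a\<^sub>2 $ k\<^sub>2 = 0 \<Longrightarrow> B * norm r \<le> norm (syzygy (minor R\<^sub>0) r)"
    using syzygy_bounded_below[OF syz] by blast
  have n0: "R\<^sub>0 $ 1 $ a\<^sub>1 $ k\<^sub>1 = 1" "R\<^sub>0 $ 1 $ a\<^sub>2 $ k\<^sub>2 = 0" "R\<^sub>0 $ 2 $ a\<^sub>1 $ k\<^sub>1 = 0" "R\<^sub>0 $ 2 $ a\<^sub>2 $ k\<^sub>2 = 1"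
    using syz by (auto simp: syzygies_are_rows_def)
  define D where "D R = R $ 1 $ a\<^sub>1 $ k\<^sub>1 * R $ 2 $ a\<^sub>2 $ k\<^sub>2 - R $ 1 $ a\<^sub>2 $ k\<^sub>2 * R $ 2 $ a\<^sub>1 $ k\<^sub>1" for R :: W_matrix
  \<comment> \<open>The rows are multiplied by the inverse of the 2x2 block of entries at the
    normalising positions, whose determinant is \<open>D R\<close>. The result agrees with
    \<open>R\<^sub>0\<close> at these positions.\<close>
  define N where "N R = row_act (R $ 2 $ a\<^sub>2 $ k\<^sub>2 / D R) (- R $ 1 $ a\<^sub>2 $ k\<^sub>2 / D R)
      (- R $ 2 $ a\<^sub>1 $ k\<^sub>1 / D R) (R $ 1 $ a\<^sub>1 $ k\<^sub>1 / D R) R" for R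
  define e where "e x = 81 * (\<Sum>b\<in>UNIV. norm (minor R\<^sub>0 b - q x b))" for x
  have bound: "norm (syzygy (minor R\<^sub>0) r) \<le> e x * norm r" if "syzygy (q x) r = 0" for x r
    using norm_syzygy_le[of "\<lambda>b. minor R\<^sub>0 b - q x b" r] that unfolding e_def syzygy_diff_left by simp
  have e: "(e \<longlongrightarrow> 0) F"
    unfolding e_def using q by (auto intro!: tendsto_eq_intros)
  have ker: "syzygy (q x) (R x $ l) = 0"
    if "R x \<in> stable_matrices \<and> c x \<noteq> 0 \<and> (\<forall>b. minor (R x) b = c x *s q x b)" for x l
  proof -
    have "minor (R x) = (\<lambda>b. c x *s q x b)" using that by auto
    then have "c x * syzygy (q x) (R x $ l) $ i $ j $ k = 0" for i j k
      using syzygy_minor[of "R x" l] by (simp flip: syzygy_scale_left)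
    then show ?thesis using that by (simp add: vec_eq_iff)
  qed
  have small: "eventually (\<lambda>x. e x < d) F" if "d > 0" for d
    using order_tendstoD(2)[OF e that] .
  have evD: "eventually (\<lambda>x. R x \<in> stable_matrices \<and> D (R x) \<noteq> 0 \<and> (\<forall>l. syzygy (q x) (R x $ l) = 0)) F"
    using ev small[OF B(1)]
  proof eventually_elim
    case (elim x)
    \<comment> \<open>If the block were singular, a nontrivial row combination would vanish at both
      positions. It is a syzygy of \<open>q x\<close>, so the lower bound \<open>B\<close> and the
      error \<open>e x < B\<close> force it to be zero, contradicting independence of the
      rows.\<close>
    have "D (R x) \<noteq> 0"
    proof
      assume D0: "D (R x) = 0"
      define n where "n i = (R x $ i $ a\<^sub>1 $ k\<^sub>1, R x $ i $ a\<^sub>2 $ k\<^sub>2)" for i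
      have "\<exists>\<alpha> \<beta>. (\<alpha> \<noteq> 0 \<or> \<beta> \<noteq> 0) \<and> \<alpha> * fst (n 1) + \<beta> * fst (n 2) = 0 \<and> \<alpha> * snd (n 1) + \<beta> * snd (n 2) = 0"
      proof (cases "n 1 = 0")
        case True
        then show ?thesis by (intro exI[of _ 1] exI[of _ 0]) (simp add: zero_prod_def)
      next
        case False
        then consider "fst (n 1) \<noteq> 0" | "snd (n 1) \<noteq> 0" by (auto simp: zero_prod_def prod_eq_iff)
        then show ?thesis
        proof cases
          case 1 then show ?thesis
            using D0 by (intro exI[of _ "fst (n 2)"] exI[of _ "- fst (n 1)"]) (simp add: n_def D_def algebra_simps)
        next
          case 2 then show ?thesis
            using D0 by (intro exI[of _ "snd (n 2)"] exI[of _ "- snd (n 1)"]) (simp add: n_def D_def algebra_simps)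
        qed
      qed
      then obtain \<alpha> \<beta> where ab: "\<alpha> \<noteq> 0 \<or> \<beta> \<noteq> 0" "\<alpha> * fst (n 1) + \<beta> * fst (n 2) = 0" "\<alpha> * snd (n 1) + \<beta> * snd (n 2) = 0"
        by blast
      define r where "r = (\<chi> a. \<alpha> *s R x $ 1 $ a + \<beta> *s R x $ 2 $ a)"
      have "syzygy (q x) r = 0"
        unfolding r_def using ker[OF elim(1)] by (simp add: vec_eq_iff syzygy_lin)
      moreover have "r $ a\<^sub>1 $ k\<^sub>1 = 0" "r $ a\<^sub>2 $ k\<^sub>2 = 0" using ab(2,3) by (simp_all add: r_def n_def)
      ultimately have "B * norm r \<le> e x * norm r" using B(2) bound order_trans by blast
      then have "norm r = 0"
        using elim(2) mult_less_cancel_right_pos[of "norm r" "e x" B] by (cases "norm r = 0") auto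
      then have "\<alpha> *s R x $ 1 $ j + \<beta> *s R x $ 2 $ j = 0" for j
        unfolding norm_eq_zero r_def vec_eq_iff[of _ 0] by simp
      then show False using stable_rows_independent elim(1) ab(1) by blast
    qed
    then show ?case using elim(1) ker[OF elim(1)] by blast
  qed
  have close: "eventually (\<lambda>x. \<forall>l. dist (N (R x) $ l) (R\<^sub>0 $ l) < d) F" if d: "d > 0" for d
  proof -
    define C where "C = 1 + norm (R\<^sub>0 $ 1) + norm (R\<^sub>0 $ 2)"
    have C: "C > 0" "norm (R\<^sub>0 $ l) \<le> C" for l
      using exhaust_2[of l] by (auto simp: C_def add_pos_nonneg)
    \<comment> \<open>The bound \<open>B / 2\<close> lets the term \<open>e x * norm s\<close> be
      absorbed on the left; the second bound then gives \<open>norm s < d\<close>, with 3 instead of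
      2 leaving room for strictness.\<close>
    have "min (B / 2) (d * B / (3 * C)) > 0" using B(1) C(1) d by simp
    from evD small[OF this] show ?thesis
    proof eventually_elim
      case (elim x)
      have D: "D (R x) \<noteq> 0" using elim by blast
      show ?case
      proof
        fix l
        have "\<exists>\<alpha> \<beta>. N (R x) $ l = (\<chi> a. \<alpha> *s R x $ 1 $ a + \<beta> *s R x $ 2 $ a)"
        proof (cases "l = 1")
          case True
          then show ?thesis unfolding N_def row_act_def vec_lambda_beta if_P[OF True] by blast
        next
          case False
          then show ?thesis unfolding N_def row_act_def vec_lambda_beta if_not_P[OF False] by blast
        qed
        then obtain \<alpha> \<beta> where "N (R x) $ l = (\<chi> a. \<alpha> *s R x $ 1 $ a + \<beta> *s R x $ 2 $ a)" by blast
        then have ker': "syzygy (q x) (N (R x) $ l) = 0"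
          using elim by (simp only: vec_eq_iff[of _ 0] syzygy_lin zero_index) simp
        define s where "s = N (R x) $ l - R\<^sub>0 $ l"
        have "syzygy (minor R\<^sub>0) s = syzygy (minor R\<^sub>0) (N (R x) $ l)"
        proof -
          have s: "s = (\<chi> a. 1 *s N (R x) $ l $ a + (- 1) *s R\<^sub>0 $ l $ a)"
            by (simp add: s_def vec_eq_iff)
          have "syzygy (minor R\<^sub>0) s $ i $ j $ k = syzygy (minor R\<^sub>0) (N (R x) $ l) $ i $ j $ k" for i j k
            unfolding s syzygy_lin syzygy_minor by simp
          then show ?thesis by (simp add: vec_eq_iff)
        qed
        moreover have "s $ a\<^sub>1 $ k\<^sub>1 = 0" "s $ a\<^sub>2 $ k\<^sub>2 = 0"
        proof -
          let ?p = "R x $ 1 $ a\<^sub>1 $ k\<^sub>1 * R x $ 2 $ a\<^sub>2 $ k\<^sub>2" and ?m = "R x $ 1 $ a\<^sub>2 $ k\<^sub>2 * R x $ 2 $ a\<^sub>1 $ k\<^sub>1"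
          have "?p / D (R x) - ?m / D (R x) = D (R x) / D (R x)"
            unfolding diff_divide_distrib[symmetric] D_def ..
          then have "N (R x) $ 1 $ a\<^sub>1 $ k\<^sub>1 = D (R x) / D (R x)" "N (R x) $ 2 $ a\<^sub>2 $ k\<^sub>2 = D (R x) / D (R x)"
            by (simp_all add: N_def row_act_def mult.commute)
          moreover have "N (R x) $ 1 $ a\<^sub>2 $ k\<^sub>2 = 0" "N (R x) $ 2 $ a\<^sub>1 $ k\<^sub>1 = 0"
            by (simp_all add: N_def row_act_def)
          ultimately show "s $ a\<^sub>1 $ k\<^sub>1 = 0" "s $ a\<^sub>2 $ k\<^sub>2 = 0"
            using exhaust_2[of l] D by (auto simp: s_def n0)
        qed
        ultimately have 1: "B * norm s \<le> e x * norm (N (R x) $ l)"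
          using B(2)[of s] bound[OF ker'] by simp
        have e0: "0 \<le> e x" unfolding e_def by (intro mult_nonneg_nonneg sum_nonneg) auto
        have "norm (N (R x) $ l) \<le> norm s + C"
          using norm_triangle_sub[of "N (R x) $ l" "R\<^sub>0 $ l"] C(2)[of l] by (simp add: s_def)
        then have "B * norm s \<le> e x * norm s + e x * C"
          using 1 mult_left_mono[OF _ e0] by (fastforce simp: distrib_left)
        moreover have "e x * norm s \<le> B / 2 * norm s"
          using elim by (intro mult_right_mono) auto
        ultimately have "B / 2 * norm s \<le> e x * C" by simp
        also have "\<dots> < d * B / 2"
        proof -
          have "e x < d * B / (3 * C)" using elim by simp
          then have "e x * C < d * B / 3" using C(1) by (simp add: field_simps)
          moreover have "d * B / 3 < d * B / 2" using d B(1) by simp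
          ultimately show ?thesis by linarith
        qed
        finally show "dist (N (R x) $ l) (R\<^sub>0 $ l) < d"
          using B(1) by (simp add: s_def dist_norm field_simps)
      qed
    qed
  qed
  have "((\<lambda>x. N (R x)) \<longlongrightarrow> R\<^sub>0) F"
  proof (rule vec_tendstoI, rule tendstoI)
    fix l and d :: real assume "d > 0"
    from close[OF this] show "eventually (\<lambda>x. dist (N (R x) $ l) (R\<^sub>0 $ l) < d) F"
      by (rule eventually_mono) blast
  qed
  moreover have "eventually (\<lambda>x. N (R x) \<in> stable_matrices \<and> minor_net (N (R x)) = minor_net (R x)) F"
    using evD
  proof eventually_elim
    case (elim x)
    have "R x $ 2 $ a\<^sub>2 $ k\<^sub>2 / D (R x) * (R x $ 1 $ a\<^sub>1 $ k\<^sub>1 / D (R x)) -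
        - R x $ 1 $ a\<^sub>2 $ k\<^sub>2 / D (R x) * (- R x $ 2 $ a\<^sub>1 $ k\<^sub>1 / D (R x)) = D (R x) / (D (R x) * D (R x))"
      by (simp add: D_def diff_divide_distrib algebra_simps)
    also have "\<dots> = 1 / D (R x)" by simp
    finally have "minor (N (R x)) j = (1 / D (R x)) *s minor (R x) j" for j
      unfolding N_def minor_row_act by simp
    with elim show ?case using stable_scaled_minors[of "R x" "1 / D (R x)" "N (R x)"] by simp
  qed
  ultimately show ?thesis using R0 by (intro limitin_Y)
qed

section \<open>Nets with a reduced basis lie in the cell\<close>

lemma minor_symmetric: "minor R b $ prod.swap m = minor R b $ m"
  by (cases m) (simp add: minor_nth algebra_simps)

lemma weight_swap [simp]: "weight w (prod.swap m) = weight w m"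
  by (simp add: weight_def)

text \<open>After rescaling each quadric to keep its leading coefficient, every other surviving
  monomial has smaller weight and dies as \<open>t\<close> grows. Convergence of the quadrics is
  then lifted to \<open>Y\<close> through the syzygies.\<close>

lemma reduced_weight_cell:
  assumes R0: "monomial_minors R\<^sub>0 I" and syz: "syzygies_are_rows R\<^sub>0 a\<^sub>1 k\<^sub>1 a\<^sub>2 k\<^sub>2" and R: "reduced R I \<kappa>"
    and low: "\<And>b m. m \<noteq> I b \<Longrightarrow> m \<noteq> prod.swap (I b) \<Longrightarrow> weight w m \<ge> weight w (I b) \<Longrightarrow> minor R b $ m = 0"
  shows "minor_net R \<in> weight_cell w (minor_net R\<^sub>0)"
proof -
  have sR: "R \<in> stable_matrices" and \<kappa>: "\<kappa> \<noteq> 0" and d: "\<And>a b. minor R b $ I a = (if a = b then \<kappa> else 0)"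
    using R by (auto simp: reduced_def)
  have s0: "R\<^sub>0 \<in> stable_matrices" and nz: "\<And>b. minor R\<^sub>0 b $ I b \<noteq> 0"
    and z: "\<And>b m. m \<noteq> I b \<Longrightarrow> m \<noteq> prod.swap (I b) \<Longrightarrow> minor R\<^sub>0 b $ m = 0"
    using R0 by (auto simp: monomial_minors_def)
  define q where "q t b = (minor R\<^sub>0 b $ I b / \<kappa> / t ^ weight w (I b)) *s sym_act (weight_matrix w t) (minor R b)" for t b
  define \<beta> where "\<beta> t b = t ^ weight w (I b) / minor R\<^sub>0 b $ I b" for t b
  \<comment> \<open>Scaling column \<open>b\<close> by \<open>\<beta> t b\<close> multiplies minor
    \<open>b\<close> by the product of the other two factors, that is by \<open>c t\<close> divided
    by \<open>\<kappa>\<close> and \<open>\<beta> t b\<close>. So the minors become the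
    \<open>q t b\<close> up to the common factor \<open>c t\<close>.\<close>
  define S where "S t = col_act (W_act (weight_matrix w t) R) (\<chi> a b. if a = b then \<beta> t b else 0)" for t
  define c where "c t = \<kappa> * \<beta> t 1 * \<beta> t 2 * \<beta> t 3" for t
  have q: "((\<lambda>t. q t b) \<longlongrightarrow> minor R\<^sub>0 b) at_infinity" for b
  proof (rule vec_tendstoI)
    fix m
    have qm: "q t b $ m = (minor R\<^sub>0 b $ I b / \<kappa> * minor R b $ m) * (t ^ weight w m / t ^ weight w (I b))" for t
      by (simp add: q_def sym_act_weight_matrix)
    have nz1: "eventually (\<lambda>t :: complex. norm t \<ge> 1) at_infinity"
      by (auto simp: eventually_at_infinity)
    consider "m = I b \<or> m = prod.swap (I b)" | "m \<noteq> I b" "m \<noteq> prod.swap (I b)" by blast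
    then show "((\<lambda>t. q t b $ m) \<longlongrightarrow> minor R\<^sub>0 b $ m) at_infinity"
    proof cases
      case 1
      then have eqs: "minor R b $ m = \<kappa>" "weight w m = weight w (I b)" "minor R\<^sub>0 b $ m = minor R\<^sub>0 b $ I b"
        using d[of b b] by (auto simp: minor_symmetric)
      have "eventually (\<lambda>t. q t b $ m = minor R\<^sub>0 b $ m) at_infinity"
        using nz1
      proof eventually_elim
        case (elim t)
        then have "t \<noteq> 0" by auto
        then show ?case using \<kappa> by (simp add: qm eqs)
      qed
      then show ?thesis by (rule tendsto_eventually)
    next
      case 2
      show ?thesis
      proof (cases "weight w m \<ge> weight w (I b)")
        case True
        then show ?thesis using low[OF 2] z[OF 2] by (simp add: qm)
      next
        case False
        have "((\<lambda>t. inverse ((t :: complex) ^ (weight w (I b) - weight w m))) \<longlongrightarrow> 0) at_infinity"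
          using False by (intro tendsto_inverse_0[THEN filterlim_compose] filterlim_power_at_infinity filterlim_ident) auto
        moreover have "eventually (\<lambda>t :: complex. inverse (t ^ (weight w (I b) - weight w m)) = t ^ weight w m / t ^ weight w (I b)) at_infinity"
          using nz1
        proof eventually_elim
          case (elim t)
          then have "t \<noteq> 0" by auto
          then show ?case using False by (simp add: power_diff field_simps)
        qed
        ultimately have "((\<lambda>t. (t :: complex) ^ weight w m / t ^ weight w (I b)) \<longlongrightarrow> 0) at_infinity"
          by (rule Lim_transform_eventually)
        then show ?thesis unfolding qm z[OF 2] by (rule tendsto_mult_right_zero)
      qed
    qed
  qed
  have key: "S t \<in> stable_matrices \<and> c t \<noteq> 0 \<and> (\<forall>b. minor (S t) b = c t *s q t b)
      \<and> minor_net (S t) = sym_act (weight_matrix w t) ` minor_net R" if t: "t \<noteq> 0" for t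
  proof -
    have \<beta>: "\<beta> t b \<noteq> 0" for b using t nz by (simp add: \<beta>_def)
    have inv: "invertible (weight_matrix w t)"
      unfolding invertible_det_nz weight_matrix_def det_3 using t by simp
    have m: "minor (S t) b = (\<beta> t (b + 1) * \<beta> t (b + 2)) *s sym_act (weight_matrix w t) (minor R b)" for b
      using exhaust_3[of b] by (elim disjE) (simp_all add: S_def minor_col_act cof_def sum_3 minor_W_act)
    have eq: "c t * (minor R\<^sub>0 b $ I b / \<kappa> / t ^ weight w (I b)) = \<beta> t (b + 1) * \<beta> t (b + 2)" for b
    proof -
      have "c t = \<kappa> * \<beta> t b * (\<beta> t (b + 1) * \<beta> t (b + 2))"
        using exhaust_3[of b] by (elim disjE) (simp_all add: c_def)
      then show ?thesis using t \<kappa> nz[of b] by (simp add: \<beta>_def[of t b])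
    qed
    have cq: "minor (S t) b = c t *s q t b" for b
      unfolding m q_def vector_smult_assoc eq ..
    have W: "W_act (weight_matrix w t) R \<in> stable_matrices" by (rule stable_W_act[OF inv sR])
    have li: "lin_indep_triple (minor (S t))"
      unfolding lin_indep_triple_iff
    proof (intro allI impI)
      fix k j assume "(\<Sum>j\<in>UNIV. k j *s minor (S t) j) = 0"
      then have "(\<Sum>j\<in>UNIV. (k j * (\<beta> t (j + 1) * \<beta> t (j + 2))) *s minor (W_act (weight_matrix w t) R) j) = 0"
        by (simp add: m minor_W_act)
      then have "k j * (\<beta> t (j + 1) * \<beta> t (j + 2)) = 0"
        using W[unfolded stable_matrices_def mem_Collect_eq lin_indep_triple_iff, THEN spec,
            of "\<lambda>j. k j * (\<beta> t (j + 1) * \<beta> t (j + 2))"] by blast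
      then show "k j = 0" using \<beta> by simp
    qed
    have "minor_net (S t) = minor_net (W_act (weight_matrix w t) R)"
      unfolding minor_net_def
    proof (rule span_triple_eqI[OF li])
      show "minor (S t) j \<in> vec.span (range (minor (W_act (weight_matrix w t) R)))" for j
        unfolding m minor_W_act[symmetric] by (intro vec.span_scale vec.span_base) simp
    qed
    then show ?thesis using li cq \<beta> \<kappa> by (simp add: stable_matrices_def minor_net_W_act c_def)
  qed
  have ev: "eventually (\<lambda>t :: complex. t \<noteq> 0) at_infinity"
    unfolding eventually_at_infinity by (intro exI[of _ 1]) auto
  have "limitin Y_topology (\<lambda>t. minor_net (S t)) (minor_net R\<^sub>0) at_infinity"
  proof (rule limitin_Y_syzygies[OF s0 syz q])
    show "eventually (\<lambda>t. S t \<in> stable_matrices \<and> c t \<noteq> 0 \<and> (\<forall>b. minor (S t) b = c t *s q t b)) at_infinity"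
      using ev by (rule eventually_mono) (use key in blast)
  qed
  moreover have "eventually (\<lambda>t. minor_net (S t) = sym_act (weight_matrix w t) ` minor_net R) at_infinity"
    using ev by (rule eventually_mono) (use key in blast)
  ultimately have "limitin Y_topology (\<lambda>t. sym_act (weight_matrix w t) ` minor_net R) (minor_net R\<^sub>0) at_infinity"
    by (rule limitin_transform_eventually[rotated])
  then show ?thesis using sR by (auto simp: weight_cell_def Y_def)
qed

section \<open>The open orbit\<close>

definition triangle :: "complex^3^3 \<Rightarrow> W_tensor_W set" where
  "triangle A = vec.span (range (\<lambda>k. column (k + 1) A \<odot> column (k + 2) A))"

lemma sym_mult_commute: "v \<odot> w = w \<odot> v"
  by (simp add: vec_eq_iff sym_mult_nth split_paired_all algebra_simps)

lemma triangle_sym_act: "triangle A = sym_act A ` triangle (mat 1)"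
proof -
  have "column k (mat 1 :: complex^3^3) = axis k 1" for k
    by (simp add: column_def mat_def axis_def vec_eq_iff)
  then show ?thesis
    by (simp add: triangle_def sym_act_span image_image sym_act_mult mult_axis)
qed

lemma triangle_1: "triangle (mat 1) = \<langle>x\<^sub>W \<odot> y\<^sub>W, x\<^sub>W \<odot> z\<^sub>W, y\<^sub>W \<odot> z\<^sub>W\<rangle>"
proof -
  have c: "column k (mat 1 :: complex^3^3) = axis k 1" for k
    by (simp add: column_def mat_def axis_def vec_eq_iff)
  have "range (\<lambda>k :: 3. axis (k + 1) 1 \<odot> axis (k + 2) 1) = {x\<^sub>W \<odot> y\<^sub>W, x\<^sub>W \<odot> z\<^sub>W, y\<^sub>W \<odot> z\<^sub>W}"
    unfolding UNIV_3 x\<^sub>W_def y\<^sub>W_def z\<^sub>W_def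
    using sym_mult_commute[of "axis 3 1" "axis 1 1"] by auto
  then show ?thesis by (simp add: triangle_def net_def c)
qed

lemma open_orbit_eq: "open_orbit = {triangle A | A. invertible A}"
  unfolding open_orbit_def triangle_1[symmetric] triangle_sym_act[symmetric] ..

lemma quadric_eval_sum: "quadric_eval (\<Sum>j\<in>UNIV. c j *s u j) p = (\<Sum>j\<in>(UNIV::3 set). c j * quadric_eval (u j) p)"
  by (simp add: quadric_eval_def sum_pair sum_3 algebra_simps)

lemma quadric_eval_scale: "quadric_eval q (c *s p) = c\<^sup>2 * quadric_eval q p"
  by (simp add: quadric_eval_def sum_distrib_left power2_eq_square mult_ac)

lemma dual_pair_row_column: "dual_pair (row k B) (column l A) = (B ** A) $ k $ l"
  by (simp add: dual_pair_def row_def column_def matrix_matrix_mult_def)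

lemma triangle_lin_indep:
  assumes "A' ** A = mat 1"
  shows "lin_indep_triple (\<lambda>k. column (k + 1) A \<odot> column (k + 2) A)"
  unfolding lin_indep_triple_iff
proof (intro allI impI)
  fix c :: "3 \<Rightarrow> complex" and j
  assume "(\<Sum>k\<in>UNIV. c k *s (column (k + 1) A \<odot> column (k + 2) A)) = 0"
  then have 0: "quadric_eval (\<Sum>k\<in>UNIV. c k *s (column (k + 1) A \<odot> column (k + 2) A)) p = 0" for p
    by (simp add: quadric_eval_def)
  have add: "dual_pair (row i A' + row j A') (column l A) = (if i = l then 1 else 0) + (if j = l then 1 else 0)" for i j l
    unfolding dual_pair_add dual_pair_row_column assms by (simp add: mat_def)
  show "c j = 0"
    \<comment> \<open>At the sum of the dual vectors \<open>j + 1\<close> and \<open>j + 2\<close>,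
      only the product of the corresponding two columns is nonzero.\<close>
    using 0[of "row (j + 1) A' + row (j + 2) A'", unfolded quadric_eval_sum quadric_eval_mult add] exhaust_3[of j]
    by (auto simp: sum_3)
qed

text \<open>In the coordinates given by \<open>A\<close> the vertices are the coordinate points, and
  a quadric vanishes there exactly when its diagonal coefficients are zero.\<close>

lemma triangle_vanishing:
  assumes "A' ** A = mat 1" "A ** A' = mat 1"
  shows "triangle A = {q. (\<forall>i k. q $ (k, i) = q $ (i, k)) \<and> (\<forall>k. quadric_eval q (row k A') = 0)}"
proof (intro subset_antisym subsetI CollectI conjI allI; (elim CollectE conjE)?)
  fix q assume "q \<in> triangle A"
  then obtain c where q: "q = (\<Sum>k\<in>UNIV. c k *s (column (k + 1) A \<odot> column (k + 2) A))"
    unfolding triangle_def span_range3 by blast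
  show "q $ (k, i) = q $ (i, k)" for i k
    by (simp add: q sym_mult_nth algebra_simps)
  show "quadric_eval q (row k A') = 0" for k
    unfolding q quadric_eval_sum quadric_eval_mult dual_pair_row_column assms
    using exhaust_3[of k] by (auto simp: mat_def sum_3)
next
  fix q assume sym: "\<forall>i k. q $ (k, i) = q $ (i, k)" and van: "\<forall>k. quadric_eval q (row k A') = 0"
  define p where "p = sym_act A' q"
  have "q = sym_act A p" by (simp add: p_def sym_act_compose assms)
  \<comment> \<open>The factor 2 compensates the division by 2 in the symmetric product.\<close>
  also have "p = (\<Sum>k\<in>UNIV. (2 * p $ (k + 1, k + 2)) *s (axis (k + 1) 1 \<odot> axis (k + 2) 1))"
  proof -
    have "p $ (k, k) = 0" for k
    proof -
      have "p $ (k, k) = quadric_eval q (row k A')"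
        by (simp add: p_def sym_act_def quadric_eval_def row_def mult_ac)
      then show ?thesis using van by simp
    qed
    moreover have "p $ (k, i) = p $ (i, k)" for i k
    proof -
      have "p $ (k, i) = (\<Sum>a\<in>UNIV. \<Sum>b\<in>UNIV. A' $ k $ a * A' $ i $ b * q $ (a, b))"
        by (simp add: p_def sym_act_def sum_pair)
      also have "\<dots> = (\<Sum>b\<in>UNIV. \<Sum>a\<in>UNIV. A' $ i $ b * A' $ k $ a * q $ (b, a))"
        by (subst sum.swap) (use sym in \<open>simp add: mult_ac\<close>)
      also have "\<dots> = p $ (i, k)"
        by (simp add: p_def sym_act_def sum_pair)
      finally show ?thesis .
    qed
    ultimately show ?thesis
      by (simp add: vec_eq_iff split_paired_all forall_3 sum_3 sym_mult_nth axis_def)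
  qed
  also have "sym_act A \<dots> = (\<Sum>k\<in>UNIV. (2 * p $ (k + 1, k + 2)) *s (column (k + 1) A \<odot> column (k + 2) A))"
    by (simp add: sym_act_sum sym_act_scale sym_act_mult mult_axis)
  finally show "q \<in> triangle A"
    unfolding triangle_def span_range3 mem_Collect_eq by (intro exI[of _ "\<lambda>k. 2 * p $ (k + 1, k + 2)"]) simp
qed

lemma row_expansion:
  assumes "A ** A' = mat 1" shows "p = (\<Sum>k\<in>UNIV. dual_pair p (column k A) *s row k (A' :: complex^3^3))"
proof -
  have "(\<Sum>k\<in>UNIV. dual_pair p (column k A) *s row k A') $ i = (\<Sum>j\<in>UNIV. p $ j * (A ** A') $ j $ i)" for i
  proof -
    have "(\<Sum>k\<in>UNIV. dual_pair p (column k A) *s row k A') $ i = (\<Sum>k\<in>UNIV. \<Sum>j\<in>UNIV. p $ j * (A $ j $ k * A' $ k $ i))"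
      by (simp add: dual_pair_def column_def row_def sum_distrib_left sum_distrib_right mult_ac)
    also have "\<dots> = (\<Sum>j\<in>UNIV. \<Sum>k\<in>UNIV. p $ j * (A $ j $ k * A' $ k $ i))"
      by (rule sum.swap)
    finally show ?thesis by (simp add: matrix_matrix_mult_def sum_distrib_left)
  qed
  then show ?thesis
    by (simp add: vec_eq_iff assms mat_def if_distrib[of "\<lambda>c. _ * c"] sum.delta cong: if_cong)
qed

lemma row_nonzero:
  assumes "A' ** A = mat 1" shows "row k A' \<noteq> (0 :: complex^3)"
proof
  assume "row k A' = 0"
  then have "dual_pair (row k A') (column k A) = 0" by (simp add: dual_pair_def)
  then show False unfolding dual_pair_row_column assms by (simp add: mat_def)
qed

text \<open>All products of two coordinates of a common zero with respect to the dual basis vanish,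
  so at most one coordinate survives.\<close>

lemma common_zeros_triangle:
  assumes "A' ** A = mat 1" "A ** A' = mat 1"
  shows "common_zeros (triangle A) = range (\<lambda>k. vec.span {row k A'})"
proof (intro subset_antisym subsetI)
  fix l assume "l \<in> common_zeros (triangle A)"
  then obtain p where l: "l = vec.span {p}" and p: "p \<noteq> 0" "\<And>q. q \<in> triangle A \<Longrightarrow> quadric_eval q p = 0"
    unfolding common_zeros_def by blast
  define d where "d k = dual_pair p (column k A)" for k
  have "d (k + 1) * d (k + 2) = 0" for k
    using p(2)[of "column (k + 1) A \<odot> column (k + 2) A"]
    unfolding d_def quadric_eval_mult[symmetric] triangle_def by (simp add: vec.span_base)
  from this[of 1] this[of 2] this[of 3]
  have dd: "d 1 = 0 \<and> d 2 = 0 \<or> d 1 = 0 \<and> d 3 = 0 \<or> d 2 = 0 \<and> d 3 = 0" by auto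
  have "p = d 1 *s row 1 A' + d 2 *s row 2 A' + d 3 *s row 3 A'"
    using row_expansion[OF assms(2), of p] by (simp add: sum_3 d_def)
  with dd obtain k where k: "p = d k *s row k A'" by auto
  then have "d k \<noteq> 0" using p(1) by auto
  then have "vec.span {p} = vec.span {row k A'}"
    by (subst k) (simp add: vec.span_insert_0 vec.span_image_scale[of "{row k A'}" "\<lambda>_. d k", simplified])
  then show "l \<in> range (\<lambda>k. vec.span {row k A'})" using l by blast
next
  fix l assume "l \<in> range (\<lambda>k. vec.span {row k A'})"
  then obtain k where "l = vec.span {row k A'}" by blast
  then show "l \<in> common_zeros (triangle A)"
    unfolding common_zeros_def triangle_vanishing[OF assms] using row_nonzero[OF assms(1)] by blast
qed

text \<open>The net is recovered from its common zeros. This matters because \<open>is_g2\<close>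
  prescribes only the zeros of the image.\<close>

lemma triangle_common_zeros:
  assumes "A' ** A = mat 1" "A ** A' = mat 1"
  shows "triangle A = {q. (\<forall>i k. q $ (k, i) = q $ (i, k)) \<and> (\<forall>l\<in>common_zeros (triangle A). \<forall>p\<in>l. quadric_eval q p = 0)}"
proof -
  have "(\<forall>l\<in>range (\<lambda>k. vec.span {row k A'}). \<forall>p\<in>l. quadric_eval q p = 0) \<longleftrightarrow> (\<forall>k. quadric_eval q (row k A') = 0)" for q
    by (auto simp: vec.span_singleton quadric_eval_scale)
  then show ?thesis
    unfolding common_zeros_triangle[OF assms] by (subst triangle_vanishing[OF assms]) simp
qed

section \<open>The effect of the automorphism on triangles\<close>

text \<open>The side joining two vertices is cut out by the remaining column of \<open>A\<close>,
  which J sends to its flip. Vanishing conditions suffice, since they determine the net.\<close>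

lemma g2_triple_vanishing:
  assumes "A' ** A = mat 1" "A ** A' = mat 1"
  shows "(\<forall>l\<in>g2_triple (common_zeros (triangle A)). \<forall>p\<in>l. quadric_eval q p = 0) \<longleftrightarrow>
    (\<forall>m. quadric_eval q (flip (column m A)) = 0)"
proof -
  have ann: "w \<in> line_as_point (vec.span (vec.span {p} \<union> vec.span {p'})) \<longleftrightarrow> dual_pair p w = 0 \<and> dual_pair p' w = 0"
    for w p p'
  proof -
    have sub: "vec.subspace {p. dual_pair p w = 0}"
      by (auto simp: vec.subspace_def dual_pair_add) (simp_all add: dual_pair_def sum_distrib_left[symmetric] mult.assoc)
    have span_le: "vec.span S \<subseteq> {p. dual_pair p w = 0} \<longleftrightarrow> S \<subseteq> {p. dual_pair p w = 0}" for S
      using vec.span_minimal[of S, OF _ sub] vec.span_superset[of S] by (metis subset_trans)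
    have "w \<in> line_as_point L \<longleftrightarrow> L \<subseteq> {p. dual_pair p w = 0}" for L
      by (auto simp: line_as_point_def)
    then show ?thesis by (simp add: span_le)
  qed
  have distinct: "vec.span {row k A'} \<noteq> vec.span {row k' A'}" if "k \<noteq> k'" for k k'
  proof
    assume "vec.span {row k A'} = vec.span {row k' A'}"
    then have "row k A' \<in> vec.span {row k' A'}" using vec.span_base[of "row k A'" "{row k A'}"] by simp
    then obtain c where "row k A' = c *s row k' A'" by (auto simp: vec.span_singleton)
    then have "dual_pair (row k A') (column k A) = c * dual_pair (row k' A') (column k A)"
      by (simp add: dual_pair_def sum_distrib_left mult_ac)
    then show False using that unfolding dual_pair_row_column assms by (simp add: mat_def)
  qed
  have "(\<forall>l\<in>g2_triple (common_zeros (triangle A)). \<forall>p\<in>l. quadric_eval q p = 0) \<longleftrightarrow>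
     (\<forall>k k'. vec.span {row k A'} \<noteq> vec.span {row k' A'} \<longrightarrow>
        (\<forall>w. dual_pair (row k A') w = 0 \<and> dual_pair (row k' A') w = 0 \<longrightarrow> quadric_eval q (flip w) = 0))"
    unfolding g2_triple_def joining_lines_def common_zeros_triangle[OF assms] ann[symmetric]
    by (fastforce simp: g2_form_mult)
  also have "\<dots> \<longleftrightarrow> (\<forall>m. quadric_eval q (flip (column m A)) = 0)"
  proof (intro iffI allI impI)
    fix m :: 3 assume a: "\<forall>k k'. vec.span {row k A'} \<noteq> vec.span {row k' A'} \<longrightarrow>
        (\<forall>w. dual_pair (row k A') w = 0 \<and> dual_pair (row k' A') w = 0 \<longrightarrow> quadric_eval q (flip w) = 0)"
    have "m + 1 \<noteq> m + 2" "m + 1 \<noteq> m" "m + 2 \<noteq> m" using exhaust_3[of m] by auto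
    then show "quadric_eval q (flip (column m A)) = 0"
      using a[rule_format, OF distinct, of "m + 1" "m + 2" "column m A"]
      unfolding dual_pair_row_column assms by (simp add: mat_def)
  next
    fix k k' :: 3 and w assume a: "\<forall>m. quadric_eval q (flip (column m A)) = 0"
      and d: "vec.span {row k A'} \<noteq> vec.span {row k' A'}" and "dual_pair (row k A') w = 0 \<and> dual_pair (row k' A') w = 0"
    then have w: "dual_pair (row k A') w = 0" "dual_pair (row k' A') w = 0" by simp_all
    have "k \<noteq> k'" using d by auto
    have expand: "w = (\<Sum>m\<in>UNIV. dual_pair (row m A') w *s column m A)"
    proof -
      have "w = (A ** A') *v w" by (simp add: assms)
      also have "\<dots> = A *v (A' *v w)" by (simp add: matrix_vector_mul_assoc)
      also have "\<dots> = (\<Sum>m\<in>UNIV. dual_pair (row m A') w *s column m A)"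
        by (simp add: vec_eq_iff matrix_vector_mult_def dual_pair_def row_def column_def mult.commute)
      finally show ?thesis .
    qed
    have "\<exists>m d. w = d *s column m A"
    proof -
      have "\<exists>m. \<forall>j. j = m \<or> j = k \<or> j = k'"
      proof (cases "k + 1 = k'")
        case True
        then show ?thesis using exhaust_3[of k] by (intro exI[of _ "k + 2"]) (auto simp: forall_3)
      next
        case False
        then show ?thesis using exhaust_3[of k] exhaust_3[of k'] \<open>k \<noteq> k'\<close>
          by (intro exI[of _ "k + 1"]) (auto simp: forall_3)
      qed
      then obtain m where m: "\<And>j. j = m \<or> j = k \<or> j = k'" by blast
      then have "dual_pair (row j A') w *s column j A = (if j = m then dual_pair (row m A') w *s column m A else 0)"
        for j using w m[of j] by auto
      then have "(\<Sum>j\<in>UNIV. dual_pair (row j A') w *s column j A) = (\<Sum>j\<in>UNIV. if j = m then dual_pair (row m A') w *s column m A else 0)"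
        by (intro sum.cong) auto
      also have "\<dots> = dual_pair (row m A') w *s column m A" by (simp add: sum.delta)
      finally have "w = dual_pair (row m A') w *s column m A" by (rule trans[OF expand])
      then show ?thesis by blast
    qed
    then obtain m d where "w = d *s column m A" by blast
    then have "flip w = d *s flip (column m A)" using flip_lin[of d "column m A" 0 0] by simp
    then show "quadric_eval q (flip w) = 0" using a by (simp add: quadric_eval_scale)
  qed
  finally show ?thesis .
qed

text \<open>J times the transpose of \<open>A'\<close>, hence the contragredient of \<open>A\<close>
  twisted by J when \<open>A'\<close> is the inverse of \<open>A\<close>.\<close>

definition J_dual :: "complex^3^3 \<Rightarrow> complex^3^3" where
  "J_dual A' = (\<chi> i k. flip (row k A') $ i)"

lemma column_J_dual: "column k (J_dual A') = flip (row k A')"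
  by (simp add: J_dual_def column_def vec_eq_iff)

lemma dual_pair_flip: "dual_pair (flip p) (flip w) = dual_pair p w"
  by (simp add: dual_pair_def sum_3)

text \<open>The prescribed zeros determine the image net. The new vertices, the flipped columns of
  \<open>A\<close>, are the rows of the inverse of \<open>J_dual A'\<close>, so both nets have the
  same description by vanishing.\<close>

lemma is_g2_triangle:
  assumes g: "is_g2 g" and A: "A' ** A = mat 1" "A ** A' = mat 1"
  shows "g (triangle A) = triangle (J_dual A')"
proof -
  have inv: "invertible A" using A unfolding invertible_def by blast
  then have o: "g (triangle A) \<in> open_orbit" and cz: "common_zeros (g (triangle A)) = g2_triple (common_zeros (triangle A))"
    using g unfolding is_g2_def open_orbit_eq by blast+
  then obtain B B' where B: "g (triangle A) = triangle B" "B' ** B = mat 1" "B ** B' = mat 1"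
    unfolding open_orbit_eq invertible_def by blast
  define G' where "G' = (\<chi> m. flip (column m A))"
  have rG: "row m G' = flip (column m A)" for m by (simp add: G'_def row_def vec_eq_iff)
  have "(G' ** J_dual A') $ m $ k = mat 1 $ m $ k" for m k
  proof -
    have "(G' ** J_dual A') $ m $ k = dual_pair (row k A') (column m A)"
      unfolding dual_pair_row_column[symmetric] rG column_J_dual dual_pair_flip
      by (simp add: dual_pair_def mult.commute)
    then show ?thesis unfolding dual_pair_row_column A by (auto simp: mat_def)
  qed
  then have G: "G' ** J_dual A' = mat 1" by (simp add: vec_eq_iff)
  then have G2: "J_dual A' ** G' = mat 1" by (simp add: matrix_left_right_inverse)
  have "triangle B = {q. (\<forall>i k. q $ (k, i) = q $ (i, k)) \<and> (\<forall>l\<in>g2_triple (common_zeros (triangle A)). \<forall>p\<in>l. quadric_eval q p = 0)}"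
    using triangle_common_zeros[OF B(2,3)] unfolding cz[unfolded B(1)] .
  also have "\<dots> = triangle (J_dual A')"
    unfolding g2_triple_vanishing[OF A] triangle_vanishing[OF G G2] rG ..
  finally show ?thesis unfolding B(1) .
qed

section \<open>The automorphism on all of \<open>Y\<close>\<close>

text \<open>As a pencil of square matrices the rows are \<open>A\<close> and
  \<open>A diag(c)\<close>; the values of \<open>c\<close> are the eigenvalues of the
  pencil.\<close>

definition diagonal_matrix :: "complex^3^3 \<Rightarrow> (3 \<Rightarrow> complex) \<Rightarrow> W_matrix" where
  "diagonal_matrix A c = (\<chi> i k. if i = 1 then column k A else c k *s column k A)"

lemma minor_diagonal_matrix:
  "minor (diagonal_matrix A c) j = (c (j + 2) - c (j + 1)) *s (column (j + 1) A \<odot> column (j + 2) A)"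
  by (simp add: vec_eq_iff split_paired_all minor_nth diagonal_matrix_def sym_mult_nth) (simp add: field_simps)

definition generic_matrix :: "W_matrix \<Rightarrow> complex^3^3 \<Rightarrow> complex^3^3 \<Rightarrow> bool" where
  "generic_matrix R A A' \<longleftrightarrow> A' ** A = mat 1 \<and> A ** A' = mat 1 \<and>
     (\<exists>B c. inj c \<and> col_act R B = diagonal_matrix A c)"

lemma minor_col_act_in_net: "minor (col_act R B) j \<in> vec.span (range (minor R))"
  unfolding minor_col_act by (intro vec.span_sum vec.span_scale vec.span_base rangeI)

lemma generic_minor_net:
  assumes "generic_matrix R A A'" and R: "R \<in> stable_matrices"
  shows "minor_net R = triangle A"
proof -
  obtain B c where A: "A' ** A = mat 1" and c: "inj c" and B: "col_act R B = diagonal_matrix A c"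
    using assms(1) unfolding generic_matrix_def by blast
  have "column (j + 1) A \<odot> column (j + 2) A \<in> vec.span (range (minor R))" for j
  proof -
    have "j + 2 \<noteq> j + 1" using exhaust_3[of j] by auto
    then have "c (j + 2) - c (j + 1) \<noteq> 0" using c by (simp add: inj_eq)
    then have "column (j + 1) A \<odot> column (j + 2) A = inverse (c (j + 2) - c (j + 1)) *s minor (col_act R B) j"
      unfolding B minor_diagonal_matrix vector_smult_assoc by simp
    then show ?thesis using minor_col_act_in_net[of R B j] by (metis vec.span_scale)
  qed
  from span_triple_eqI[OF triangle_lin_indep[OF A] this] show ?thesis
    by (simp add: minor_net_def triangle_def)
qed

lemma gram_col_act_right: "gram S (col_act R B) = gram S R ** B"
  unfolding gram_commute[of S] gram_col_act matrix_transpose_mul transpose_transpose ..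

text \<open>A vector orthogonal to the pairs formed by column \<open>k\<close> of \<open>A\<close>
  and its multiple by \<open>c k\<close> is a combination of the columns of \<open>T\<close>, built
  from the dual basis with eigenvalues moved to the first row and negated. So the annihilator is
  again diagonalised, now by \<open>J_dual A'\<close>.\<close>

lemma generic_annihilator_net:
  assumes "generic_matrix R A A'" and S: "S \<in> stable_matrices" and SR: "gram S R = 0"
  shows "minor_net S = triangle (J_dual A')"
proof -
  obtain B c where A: "A' ** A = mat 1" "A ** A' = mat 1" and B: "col_act R B = diagonal_matrix A c"
    using assms(1) unfolding generic_matrix_def by blast
  define T :: W_matrix where "T = (\<chi> i k. if i = 1 then - c k *s flip (row k A') else flip (row k A'))"
  define M where "M = (\<chi> k a. J_pair (S $ 2 $ a) (column k A))"
  have "gram S (diagonal_matrix A c) = 0"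
    unfolding B[symmetric] gram_col_act_right SR by simp
  then have "gram S (diagonal_matrix A c) $ a $ k = 0" for a k by simp
  then have rel: "J_pair (S $ 1 $ a) (column k A) = - c k * J_pair (S $ 2 $ a) (column k A)" for a k
    by (simp add: gram_def diagonal_matrix_def J_pair_def algebra_simps eq_neg_iff_add_eq_0)
  have expand: "v = (\<Sum>k\<in>UNIV. J_pair v (column k A) *s flip (row k A'))" for v
  proof -
    have "flip v = (\<Sum>k\<in>UNIV. J_pair v (column k A) *s row k A')"
      using row_expansion[OF A(2), of "flip v"] by (simp add: J_pair_dual)
    from arg_cong[OF this, of flip] show ?thesis
      by (simp add: vec_eq_iff forall_3 sum_3)
  qed
  have "S = col_act T M"
  proof -
    have "S $ 2 $ a = col_act T M $ 2 $ a" for a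
      using expand[of "S $ 2 $ a"] by (simp add: col_act_def col_comb_def column_def T_def M_def)
    moreover have "S $ 1 $ a = col_act T M $ 1 $ a" for a
      using expand[of "S $ 1 $ a"] unfolding rel
      by (simp add: col_act_def col_comb_def column_def T_def M_def mult.commute)
    ultimately show ?thesis by (simp add: vec_eq_iff[of _ "_ :: W_matrix"] vec_eq_iff[of _ "_ :: W^3"] forall_2)
  qed
  have mT: "minor T j \<in> triangle (J_dual A')" for j
  proof -
    have "minor T j = (c (j + 2) - c (j + 1)) *s (column (j + 1) (J_dual A') \<odot> column (j + 2) (J_dual A'))"
      unfolding column_J_dual
      by (simp add: vec_eq_iff split_paired_all minor_nth T_def sym_mult_nth) (simp add: field_simps)
    then show ?thesis unfolding triangle_def
      by (elim ssubst) (intro vec.span_scale vec.span_base rangeI)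
  qed
  have "minor S j \<in> triangle (J_dual A')" for j
    unfolding \<open>S = col_act T M\<close> minor_col_act triangle_def
    by (intro vec.span_sum vec.span_scale mT[unfolded triangle_def])
  then show ?thesis
    unfolding minor_net_def triangle_def using S
    by (intro span_triple_eqI) (simp_all add: stable_matrices_def)
qed

section \<open>Generic matrices through the discriminant of the pencil\<close>

text \<open>The discriminant of the cubic a X^3 + b X^2 + c X + d.\<close>

definition disc :: "complex \<Rightarrow> complex \<Rightarrow> complex \<Rightarrow> complex \<Rightarrow> complex" where
  "disc a b c d = b\<^sup>2 * c\<^sup>2 - 4 * a * c ^ 3 - 4 * b ^ 3 * d - 27 * a\<^sup>2 * d\<^sup>2 + 18 * a * b * c * d"

lemma disc_nonzero_roots:
  assumes a: "a \<noteq> 0" and D: "disc a b c d \<noteq> 0"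
  shows "\<exists>r :: 3 \<Rightarrow> complex. inj r \<and> (\<forall>k. d + c * r k + b * (r k)\<^sup>2 + a * r k ^ 3 = 0)"
proof -
  define p where "p = [:d, c, b, a:]"
  have ev: "poly p x = d + c * x + b * x\<^sup>2 + a * x ^ 3" for x
    by (simp add: p_def algebra_simps power2_eq_square power3_eq_cube)
  have "rsquarefree p"
    unfolding rsquarefree_roots
  proof (intro allI notI)
    fix x assume x: "poly p x = 0 \<and> poly (pderiv p) x = 0"
    have "poly (pderiv p) x = c + 2 * b * x + 3 * a * x\<^sup>2"
      by (simp add: p_def pderiv_pCons algebra_simps power2_eq_square)
    \<comment> \<open>A common root of the cubic and its derivative expresses \<open>c\<close> and
      \<open>d\<close> through \<open>a\<close>, \<open>b\<close>, \<open>x\<close>, and for these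
      values the discriminant vanishes identically.\<close>
    with x have c: "c = - 2 * b * x - 3 * a * x\<^sup>2" by (simp add: algebra_simps eq_neg_iff_add_eq_0)
    have "d = - c * x - b * x\<^sup>2 - a * x ^ 3" using x unfolding ev by (simp add: algebra_simps eq_neg_iff_add_eq_0)
    then have d: "d = b * x\<^sup>2 + 2 * a * x ^ 3" unfolding c by (simp add: algebra_simps power2_eq_square power3_eq_cube)
    have "disc a b c d = 0"
      unfolding disc_def c d by algebra
    with D show False ..
  qed
  from complex_poly_decompose_rsquarefree[OF this]
  have dec: "smult (lead_coeff p) (\<Prod>z|poly p z = 0. [:- z, 1:]) = p" .
  have dp: "degree p = 3" and lc: "lead_coeff p = a" using a by (simp_all add: p_def)
  have "p \<noteq> 0" using a by (simp add: p_def)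
  then have fin: "finite {z. poly p z = 0}" by (rule poly_roots_finite)
  have "degree (smult (lead_coeff p) (\<Prod>z|poly p z = 0. [:- z, 1:])) = card {z. poly p z = 0}"
    using a by (simp add: lc degree_prod_eq_sum_degree)
  then have "card {z. poly p z = 0} = 3" unfolding dec using dp by simp
  then obtain r where "bij_betw r (UNIV :: 3 set) {z. poly p z = 0}"
    using finite_same_card_bij[of "UNIV :: 3 set" "{z. poly p z = 0}"] fin by auto
  then show ?thesis
    by (intro exI[of _ r]) (auto simp: bij_betw_def ev[symmetric])
qed

definition row_matrix :: "W_matrix \<Rightarrow> 2 \<Rightarrow> complex^3^3" where
  "row_matrix R i = (\<chi> l k. R $ i $ k $ l)"

text \<open>The discriminant in \<open>r\<close> of the determinant of N - r M, with the
  coefficients of \<open>det_pencil\<close>.\<close>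

definition pencil_disc :: "W_matrix \<Rightarrow> complex" where
  "pencil_disc R = (let M = row_matrix R 1; N = row_matrix R 2 in
     disc (- det M) (\<Sum>i\<in>UNIV. \<Sum>j\<in>UNIV. cof M $ i $ j * N $ i $ j) (- (\<Sum>i\<in>UNIV. \<Sum>j\<in>UNIV. cof N $ i $ j * M $ i $ j)) (det N))"

lemma det_pencil:
  "det (N - (\<chi> i j. r * M $ i $ j)) = det N + (- (\<Sum>i\<in>UNIV. \<Sum>j\<in>UNIV. cof N $ i $ j * M $ i $ j)) * r +
     (\<Sum>i\<in>UNIV. \<Sum>j\<in>UNIV. cof M $ i $ j * N $ i $ j) * r\<^sup>2 + (- det M) * r ^ 3" for M N :: "complex^3^3"
  by (simp add: det_3 sum_3 cof_def) (simp add: algebra_simps power2_eq_square power3_eq_cube)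

lemma det_zero_kernel:
  fixes M :: "complex^3^3" assumes "det M = 0" shows "\<exists>v. v \<noteq> 0 \<and> M *v v = 0"
proof -
  have "\<not> (\<exists>B. B ** M = mat 1)"
    using assms invertible_det_nz[of M] invertible_left_inverse[of M] by blast
  then show ?thesis unfolding matrix_left_invertible_ker by blast
qed

lemma col_comb_row_matrix: "col_comb R u i = row_matrix R i *v u"
  by (simp add: vec_eq_iff col_comb_def row_matrix_def matrix_vector_mult_def mult.commute)

lemma generic_matrix_disc:
  assumes det: "det (row_matrix R 1) \<noteq> 0" and disc: "pencil_disc R \<noteq> 0"
  obtains A A' where "generic_matrix R A A'"
proof -
  define M where "M = row_matrix R 1"
  define N where "N = row_matrix R 2"
  have M: "det M \<noteq> 0" "- det M \<noteq> 0" using det by (simp_all add: M_def)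
  have "\<exists>r :: 3 \<Rightarrow> complex. inj r \<and> (\<forall>k. det (N - (\<chi> i j. r k * M $ i $ j)) = 0)"
    unfolding det_pencil
    by (rule disc_nonzero_roots[OF M(2) disc[unfolded pencil_disc_def Let_def M_def[symmetric] N_def[symmetric]]])
  then obtain r :: "3 \<Rightarrow> complex" where r: "inj r" "\<And>k. det (N - (\<chi> i j. r k * M $ i $ j)) = 0"
    by blast
  have "\<exists>v. v \<noteq> 0 \<and> N *v v = r k *s (M *v v)" for k
  proof -
    obtain v where v: "v \<noteq> 0" "(N - (\<chi> i j. r k * M $ i $ j)) *v v = 0"
      using det_zero_kernel[OF r(2)] by blast
    have "(\<chi> i j. r k * M $ i $ j) *v v = r k *s (M *v v)"
      by (simp add: vec_eq_iff matrix_vector_mult_def sum_distrib_left mult.assoc)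
    then show ?thesis using v by (intro exI[of _ v]) (simp add: matrix_vector_mult_diff_rdistrib)
  qed
  then obtain v where v: "\<And>k. v k \<noteq> 0" "\<And>k. N *v v k = r k *s (M *v v k)" by metis
  define B where "B = (\<chi> i k. v k $ i)"
  have cB: "column k B = v k" for k by (simp add: B_def column_def vec_eq_iff)
  have Minj: "w = 0" if "M *v w = 0" for w
  proof -
    obtain M' where "M' ** M = mat 1" using M(1) unfolding invertible_det_nz[symmetric] invertible_def by blast
    then show ?thesis using that by (metis matrix_vector_mul_assoc matrix_vector_mul_lid matrix_vector_mult_0_right)
  qed
  have "det B \<noteq> 0"
  proof
    assume "det B = 0"
    then obtain \<alpha> where \<alpha>: "\<alpha> \<noteq> 0" "B *v \<alpha> = 0" using det_zero_kernel by blast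
    \<comment> \<open>A relation between the eigenvectors is weighted by powers of the eigenvalues.
      Since \<open>M\<close> is injective and carries \<open>x (Suc n)\<close> to
      \<open>N *v x n\<close>, the sums for n = 0, 1, 2 vanish, and the Vandermonde argument kills
      every term.\<close>
    define x where "x n = (\<Sum>k\<in>UNIV. (\<alpha> $ k * r k ^ n) *s v k)" for n :: nat
    have step: "M *v x (Suc n) = N *v x n" for n
      by (simp add: x_def vec.linear_sum[OF matrix_vector_mul_linear_gen] vector_scalar_commute v(2) mult_ac)
    have x0: "x 0 = 0"
      using \<alpha>(2) by (simp add: x_def B_def matrix_vector_mult_def vec_eq_iff mult.commute)
    then have x1: "x (Suc 0) = 0" using step[of 0] Minj by simp
    then have x2: "x (Suc (Suc 0)) = 0" using step[of "Suc 0"] Minj by simp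
    have "\<alpha> $ k * v k $ i = 0" for k i
    proof -
      define y where "y k = \<alpha> $ k * v k $ i" for k
      have "y 1 + y 2 + y 3 = 0" "r 1 * y 1 + r 2 * y 2 + r 3 * y 3 = 0"
        "r 1 * r 1 * y 1 + r 2 * r 2 * y 2 + r 3 * r 3 * y 3 = 0"
        using arg_cong[OF x0, of "\<lambda>v. v $ i"] arg_cong[OF x1, of "\<lambda>v. v $ i"] arg_cong[OF x2, of "\<lambda>v. v $ i"]
        by (simp_all add: x_def sum_3 y_def mult_ac)
      then have "(r 1 - r 2) * (r 1 - r 3) * y 1 = 0" "(r 2 - r 1) * (r 2 - r 3) * y 2 = 0" "(r 3 - r 1) * (r 3 - r 2) * y 3 = 0"
        by algebra+
      then have "y 1 = 0" "y 2 = 0" "y 3 = 0" using r(1) by (auto simp: inj_eq)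
      then show ?thesis using exhaust_3[of k] by (auto simp: y_def)
    qed
    moreover obtain k where "\<alpha> $ k \<noteq> 0" using \<alpha>(1) by (auto simp: vec_eq_iff)
    ultimately show False using v(1)[of k] by (auto simp: vec_eq_iff)
  qed
  then have "invertible (M ** B)" using M(1) by (simp add: invertible_det_nz det_mul)
  then obtain A' where A': "M ** B ** A' = mat 1" "A' ** (M ** B) = mat 1" unfolding invertible_def by blast
  have cA: "column k (M ** B) = M *v v k" for k
  proof -
    have "column k (M ** B) = (M ** B) *v axis k 1" by (simp only: mult_axis)
    also have "\<dots> = M *v (B *v axis k 1)" by (simp only: matrix_vector_mul_assoc)
    finally show ?thesis by (simp only: mult_axis cB)
  qed
  have "col_act R B = diagonal_matrix (M ** B) r"
  proof -
    have "col_act R B $ i $ k = diagonal_matrix (M ** B) r $ i $ k" for i k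
      using exhaust_2[of i]
      by (auto simp: col_act_def diagonal_matrix_def col_comb_row_matrix cA cB v(2) M_def[symmetric] N_def[symmetric])
    then show ?thesis by (simp add: vec_eq_iff[of _ "_ :: W_matrix"] vec_eq_iff[of _ "_ :: W^3"])
  qed
  then show thesis using A' r(1) that unfolding generic_matrix_def by blast
qed

definition is_poly :: "(complex \<Rightarrow> complex) \<Rightarrow> bool" where
  "is_poly f \<longleftrightarrow> (\<exists>p. f = poly p)"

lemma is_poly_intros:
  "is_poly (\<lambda>s. c)" "is_poly (\<lambda>s. s)"
  "is_poly f \<Longrightarrow> is_poly g \<Longrightarrow> is_poly (\<lambda>s. f s + g s)"
  "is_poly f \<Longrightarrow> is_poly g \<Longrightarrow> is_poly (\<lambda>s. f s - g s)"
  "is_poly f \<Longrightarrow> is_poly g \<Longrightarrow> is_poly (\<lambda>s. f s * g s)"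
  "is_poly f \<Longrightarrow> is_poly (\<lambda>s. - f s)"
  "is_poly f \<Longrightarrow> is_poly (\<lambda>s. f s ^ n)"
proof -
  show "is_poly (\<lambda>s. c)" unfolding is_poly_def by (intro exI[of _ "[:c:]"]) auto
  show "is_poly (\<lambda>s. s)" unfolding is_poly_def by (intro exI[of _ "[:0, 1:]"]) auto
  show "is_poly f \<Longrightarrow> is_poly g \<Longrightarrow> is_poly (\<lambda>s. f s + g s)"
    unfolding is_poly_def by (auto simp flip: poly_add)
  show "is_poly f \<Longrightarrow> is_poly g \<Longrightarrow> is_poly (\<lambda>s. f s - g s)"
    unfolding is_poly_def by (auto simp flip: poly_diff)
  show "is_poly f \<Longrightarrow> is_poly g \<Longrightarrow> is_poly (\<lambda>s. f s * g s)"
    unfolding is_poly_def by (auto simp flip: poly_mult)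
  show "is_poly f \<Longrightarrow> is_poly (\<lambda>s. - f s)"
    unfolding is_poly_def by (auto simp flip: poly_minus)
  show "is_poly f \<Longrightarrow> is_poly (\<lambda>s. f s ^ n)"
    unfolding is_poly_def by (auto simp flip: poly_power)
qed

lemma is_poly_eventually_nonzero:
  assumes "is_poly f" "f x \<noteq> 0" shows "eventually (\<lambda>s. f s \<noteq> 0) (at 0)"
proof -
  obtain p where f: "f = poly p" using assms(1) unfolding is_poly_def by blast
  then have "p \<noteq> 0" using assms(2) by auto
  then have "eventually (\<lambda>s. \<forall>z\<in>{z. poly p z = 0}. s \<noteq> z) (at 0)"
    by (intro eventually_ball_finite poly_roots_finite ballI eventually_neq_at_within)
  then show ?thesis by (rule eventually_mono) (auto simp: f)
qed

text \<open>On the line through \<open>R\<^sub>0\<close> and a diagonal matrix all but finitely many matrices are generic, because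
  the discriminant of the pencil is a nonzero polynomial there.\<close>

lemma generic_dense:
  obtains R :: "complex \<Rightarrow> W_matrix" where "(R \<longlongrightarrow> R\<^sub>0) (at 0)" "eventually (\<lambda>s. \<exists>A A'. generic_matrix (R s) A A') (at 0)"
proof -
  \<comment> \<open>A diagonal pencil with the distinct eigenvalues 0, 1, 2 is the witness at s = 1
    that the polynomial is nonzero; the given matrix sits at s = 0.\<close>
  define R1 where "R1 = diagonal_matrix (mat 1) (\<lambda>k. if k = 1 then 0 else if k = 2 then 1 else 2)"
  define R where "R s = (\<chi> i j. (1 - s) *s R\<^sub>0 $ i $ j + s *s R1 $ i $ j)" for s
  have "((\<lambda>s. R s) \<longlongrightarrow> R 0) (at 0)"
    unfolding R_def vector_scalar_mult_def plus_vec_def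
    by (intro tendsto_vec_lambda tendsto_intros)
  moreover have "R 0 = R\<^sub>0" by (simp add: R_def vec_eq_iff)
  ultimately have lim: "(R \<longlongrightarrow> R\<^sub>0) (at 0)" by simp
  define f where "f R = det (row_matrix R 1) * pencil_disc R" for R
  have "is_poly (\<lambda>s. R s $ i $ j $ k)" for i j k
    unfolding R_def vec_lambda_beta vector_add_component vector_smult_component
    by (intro is_poly_intros)
  then have "is_poly (\<lambda>s. f (R s))"
    unfolding f_def pencil_disc_def Let_def disc_def det_3 sum_3 cof_def row_matrix_def vec_lambda_beta
    by (intro is_poly_intros)
  moreover have "f (R 1) \<noteq> 0"
  proof -
    have "R 1 = R1" by (simp add: R_def vec_eq_iff)
    then show ?thesis
      by (simp add: f_def pencil_disc_def Let_def disc_def det_3 sum_3 cof_def row_matrix_def R1_def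
          diagonal_matrix_def column_def mat_def)
  qed
  ultimately have "eventually (\<lambda>s. f (R s) \<noteq> 0) (at 0)" by (rule is_poly_eventually_nonzero)
  then have "eventually (\<lambda>s. \<exists>A A'. generic_matrix (R s) A A') (at 0)"
  proof (rule eventually_mono)
    fix s assume "f (R s) \<noteq> 0"
    then have "det (row_matrix (R s) 1) \<noteq> 0" "pencil_disc (R s) \<noteq> 0" by (auto simp: f_def)
    then show "\<exists>A A'. generic_matrix (R s) A A'" using generic_matrix_disc by metis
  qed
  with lim show thesis by (rule that)
qed

section \<open>From generic matrices to all of Y\<close>

lemma polynomial_fun_tendsto:
  assumes "polynomial_fun f" "(R \<longlongrightarrow> R0) F" shows "((\<lambda>x. f (R x)) \<longlongrightarrow> f R0) F"
  using assms(1)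
proof induction
  case (const c) show ?case by simp
next
  case (coord i j k) show ?case by (intro tendsto_vec_nth assms(2))
next
  case (add f g) then show ?case by (intro tendsto_add)
next
  case (mult f g) then show ?case by (intro tendsto_mult)
qed

text \<open>Along a line of generic matrices ending at \<open>R0\<close>, the polynomial frame of
  the morphism spans the net of the moving annihilator \<open>T (R s)\<close>. Both sides extend to
  the end point, and the inclusion of spans passes to the limit.\<close>

lemma is_g2_minor_net:
  assumes g: "is_g2 g" and R0: "R0 \<in> stable_matrices" and S0: "S0 \<in> stable_matrices" and orth: "gram S0 R0 = 0"
  shows "g (minor_net R0) = minor_net S0"
proof -
  have "Y_morphism g" using g unfolding is_g2_def Y_automorphism_def by blast
  then obtain Fr where Fr: "\<And>a m. polynomial_fun (\<lambda>R. Fr R a $ m)" "lin_indep_triple (Fr R0)"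
    "\<And>R. R \<in> stable_matrices \<Longrightarrow> lin_indep_triple (Fr R) \<Longrightarrow> g (minor_net R) = vec.span (range (Fr R))"
    using R0 unfolding Y_morphism_def by blast
  obtain R :: "complex \<Rightarrow> W_matrix" where R: "(R \<longlongrightarrow> R0) (at 0)" "eventually (\<lambda>s. \<exists>A A'. generic_matrix (R s) A A') (at 0)"
    by (rule generic_dense)
  obtain T where T: "\<And>R. gram (T R) R = 0" "\<And>(R :: complex \<Rightarrow> _) F. (R \<longlongrightarrow> R0) F \<Longrightarrow> ((\<lambda>x. T (R x)) \<longlongrightarrow> S0) F"
    using annihilator_family[OF R0 orth] by metis
  have FR: "((\<lambda>s. Fr (R s) a) \<longlongrightarrow> Fr R0 a) (at 0)" for a
    by (intro vec_tendstoI polynomial_fun_tendsto[OF Fr(1) R(1)])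
  have TR: "((\<lambda>s. T (R s)) \<longlongrightarrow> S0) (at 0)" using T(2)[OF R(1)] .
  have net: "eventually (\<lambda>s. vec.span (range (Fr (R s))) = minor_net (T (R s))) (at 0)"
    using R(2) stable_eventually[OF R(1) R0] stable_eventually[OF TR S0] lin_indep_triple_eventually[OF FR Fr(2)]
  proof eventually_elim
    case (elim s)
    then obtain A A' where gen: "generic_matrix (R s) A A'" by blast
    then have "A' ** A = mat 1" "A ** A' = mat 1" unfolding generic_matrix_def by blast+
    from is_g2_triangle[OF g this] have "g (minor_net (R s)) = minor_net (T (R s))"
      using generic_minor_net[OF gen elim(2)] generic_annihilator_net[OF gen elim(3) T(1)] by simp
    then show ?case using Fr(3)[OF elim(2) elim(4)] by simp
  qed
  have "Fr R0 a \<in> vec.span (range (minor S0))" for a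
  proof (rule span_triple_closed[where F = "at (0 :: complex)"])
    show "at (0 :: complex) \<noteq> bot" by simp
    show "((\<lambda>s. minor (T (R s)) j) \<longlongrightarrow> minor S0 j) (at 0)" for j by (rule tendsto_minor[OF TR])
    show "((\<lambda>s. Fr (R s) a) \<longlongrightarrow> Fr R0 a) (at 0)" by (rule FR)
    show "lin_indep_triple (minor S0)" using S0 by (simp add: stable_matrices_def)
    show "eventually (\<lambda>s. Fr (R s) a \<in> vec.span (range (minor (T (R s))))) (at 0)"
      using net
    proof (rule eventually_mono)
      fix s assume "vec.span (range (Fr (R s))) = minor_net (T (R s))"
      then show "Fr (R s) a \<in> vec.span (range (minor (T (R s))))"
        unfolding minor_net_def using vec.span_base[of "Fr (R s) a" "range (Fr (R s))"] by auto
    qed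
  qed
  from span_triple_eqI[OF Fr(2) this] Fr(3)[OF R0 Fr(2)] show ?thesis by (simp add: minor_net_def)
qed

lemma is_g2_maps_Y: "is_g2 g \<Longrightarrow> H \<in> Y \<Longrightarrow> g H \<in> Y"
  unfolding is_g2_def Y_automorphism_def Y_morphism_def by blast

text \<open>Orthogonality of two matrices is a symmetric relation.\<close>

lemma is_g2_involution:
  assumes g: "is_g2 g" and H: "H \<in> Y" shows "g (g H) = H"
proof -
  obtain R where R: "R \<in> stable_matrices" "H = minor_net R" using H unfolding Y_def by blast
  obtain S where S: "S \<in> stable_matrices" "gram S R = 0" by (rule stable_annihilator_exists[OF R(1)])
  have "gram R S = 0" using S(2) by (simp add: gram_commute[of R] transpose_def vec_eq_iff)
  then show ?thesis
    using is_g2_minor_net[OF g R(1) S] is_g2_minor_net[OF g S(1) R(1)] R(2) by simp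
qed

text \<open>Near \<open>R0\<close> the continuous family of annihilators lifts the map to stable
  matrices, so openness of preimages can be tested upstairs.\<close>

lemma is_g2_continuous:
  assumes g: "is_g2 g" shows "continuous_map Y_topology Y_topology g"
  unfolding continuous_map_def topspace_Y
proof (intro conjI allI impI)
  show "g \<in> Y \<rightarrow> Y" using is_g2_maps_Y[OF g] by blast
  fix U assume U: "openin Y_topology U"
  show "openin Y_topology {H \<in> Y. g H \<in> U}"
    unfolding openin_Y_topology
  proof (intro conjI)
    have eq: "{R \<in> stable_matrices. minor_net R \<in> {H \<in> Y. g H \<in> U}} = {R \<in> stable_matrices. g (minor_net R) \<in> U}"
      by (auto simp: Y_def)
    obtain V where V: "open V" "{R \<in> stable_matrices. minor_net R \<in> U} = stable_matrices \<inter> V"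
      using U unfolding openin_Y_topology openin_open by blast
    show "openin (top_of_set stable_matrices) {R \<in> stable_matrices. minor_net R \<in> {H \<in> Y. g H \<in> U}}"
      unfolding eq openin_euclidean_subtopology_iff
    proof (intro conjI ballI)
      fix R0 assume "R0 \<in> {R \<in> stable_matrices. g (minor_net R) \<in> U}"
      then have R0: "R0 \<in> stable_matrices" "g (minor_net R0) \<in> U" by blast+
      obtain S0 where S0: "S0 \<in> stable_matrices" "gram S0 R0 = 0" by (rule stable_annihilator_exists[OF R0(1)])
      obtain T where T: "\<And>R. gram (T R) R = 0" "\<And>(R :: W_matrix \<Rightarrow> _) F. (R \<longlongrightarrow> R0) F \<Longrightarrow> ((\<lambda>x. T (R x)) \<longlongrightarrow> S0) F"
        using annihilator_family[OF R0(1) S0(2)] by metis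
      have TR: "(T \<longlongrightarrow> S0) (nhds R0)" using T(2)[of "\<lambda>R. R" "nhds R0"] by (simp add: filterlim_ident)
      have "minor_net S0 \<in> U" using R0(2) is_g2_minor_net[OF g R0(1) S0] by simp
      then have "S0 \<in> V" using V(2) S0(1) by blast
      then have "eventually (\<lambda>R. T R \<in> V) (nhds R0)" using TR V(1) by (rule topological_tendstoD[rotated 2])
      with stable_eventually[OF TR S0(1)]
      have "eventually (\<lambda>R. R \<in> stable_matrices \<longrightarrow> g (minor_net R) \<in> U) (nhds R0)"
      proof eventually_elim
        case (elim R)
        show ?case
        proof
          assume R: "R \<in> stable_matrices"
          have "minor_net (T R) \<in> U" using elim V(2) by blast
          then show "g (minor_net R) \<in> U" using is_g2_minor_net[OF g R elim(1) T(1)] by simp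
        qed
      qed
      then show "\<exists>e>0. \<forall>x'\<in>stable_matrices. dist x' R0 < e \<longrightarrow> x' \<in> {R \<in> stable_matrices. g (minor_net R) \<in> U}"
        unfolding eventually_nhds_metric by auto
    qed blast
  qed blast
qed

section \<open>The exchange of the two tori\<close>

text \<open>J pairs coordinates 1 with 3 and 2 with 2, so these are the weights for which the two
  torus actions multiply the pairing by the scalar \<open>t ^ n\<close> and preserve
  orthogonality.\<close>

definition dual_weights :: "(3 \<Rightarrow> nat) \<Rightarrow> (3 \<Rightarrow> nat) \<Rightarrow> nat \<Rightarrow> bool" where
  "dual_weights w' w n \<longleftrightarrow> w' 1 + w 3 = n \<and> w' 2 + w 2 = n \<and> w' 3 + w 1 = n"

lemma gram_weight_matrix:
  assumes "dual_weights w' w n"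
  shows "gram (W_act (weight_matrix w' t) S) (W_act (weight_matrix w t) R) = (\<chi> c a. t ^ n * gram S R $ c $ a)"
proof -
  have mult: "(weight_matrix w t *v v) $ i = t ^ w i * v $ i" for w v i
    by (simp add: weight_matrix_def matrix_vector_mult_def if_distrib[of "\<lambda>c. c * _"] sum.delta cong: if_cong)
  have n: "t ^ w' 1 * t ^ w 3 = t ^ n" "t ^ w' 2 * t ^ w 2 = t ^ n" "t ^ w' 3 * t ^ w 1 = t ^ n"
    using assms by (simp_all add: dual_weights_def flip: power_add)
  have "J_pair (weight_matrix w' t *v v) (weight_matrix w t *v u) = t ^ n * J_pair v u" for v u
  proof -
    have "J_pair (weight_matrix w' t *v v) (weight_matrix w t *v u) =
       (t ^ w' 1 * t ^ w 3) * (v $ 1 * u $ 3) + (t ^ w' 2 * t ^ w 2) * (v $ 2 * u $ 2) + (t ^ w' 3 * t ^ w 1) * (v $ 3 * u $ 1)"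
      by (simp add: J_pair_def mult mult_ac)
    then show ?thesis unfolding n by (simp add: J_pair_def algebra_simps)
  qed
  then show ?thesis by (simp add: gram_def W_act_def vec_eq_iff algebra_simps)
qed

lemma is_g2_weight_matrix:
  assumes g: "is_g2 g" and w: "dual_weights w' w n" and t: "t \<noteq> 0" and H: "H \<in> Y"
  shows "g (sym_act (weight_matrix w t) ` H) = sym_act (weight_matrix w' t) ` g H"
proof -
  obtain R where R: "R \<in> stable_matrices" "H = minor_net R" using H unfolding Y_def by blast
  obtain S where S: "S \<in> stable_matrices" "gram S R = 0" by (rule stable_annihilator_exists[OF R(1)])
  have inv: "invertible (weight_matrix w t)" for w
    unfolding invertible_det_nz weight_matrix_def det_3 using t by simp
  have "gram (W_act (weight_matrix w' t) S) (W_act (weight_matrix w t) R) = 0"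
    unfolding gram_weight_matrix[OF w] S(2) by (simp add: vec_eq_iff)
  from is_g2_minor_net[OF g stable_W_act[OF inv R(1)] stable_W_act[OF inv S(1)] this] show ?thesis
    using is_g2_minor_net[OF g R(1) S] by (simp add: minor_net_W_act R(2))
qed

lemma is_g2_weight_cell_subset:
  assumes g: "is_g2 g" and w: "dual_weights w' w n" and H: "H \<in> weight_cell w H\<^sub>0"
  shows "g H \<in> weight_cell w' (g H\<^sub>0)"
proof -
  have HY: "H \<in> Y" and lim: "limitin Y_topology (\<lambda>t. sym_act (weight_matrix w t) ` H) H\<^sub>0 at_infinity"
    using H by (auto simp: weight_cell_def)
  have "limitin Y_topology (g \<circ> (\<lambda>t. sym_act (weight_matrix w t) ` H)) (g H\<^sub>0) at_infinity"
    by (rule continuous_map_limit[OF is_g2_continuous[OF g] lim])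
  moreover have "eventually (\<lambda>t. (g \<circ> (\<lambda>t. sym_act (weight_matrix w t) ` H)) t = sym_act (weight_matrix w' t) ` g H) at_infinity"
    unfolding eventually_at_infinity o_def
    by (intro exI[of _ 1] allI impI is_g2_weight_matrix[OF g w _ HY]) fastforce
  ultimately show ?thesis
    using is_g2_maps_Y[OF g HY] by (auto simp: weight_cell_def elim: limitin_transform_eventually[rotated])
qed

text \<open>Continuity and equivariance give one inclusion; the involution, with the roles of the
  weights exchanged, gives the other.\<close>

lemma is_g2_weight_cell:
  assumes g: "is_g2 g" and w: "dual_weights w' w n" and w': "dual_weights w w' n" and H0: "H\<^sub>0 \<in> Y"
  shows "g ` weight_cell w H\<^sub>0 = weight_cell w' (g H\<^sub>0)"
proof (intro subset_antisym subsetI)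
  fix K assume K: "K \<in> weight_cell w' (g H\<^sub>0)"
  then have "g K \<in> weight_cell w H\<^sub>0"
    using is_g2_weight_cell_subset[OF g w' K] is_g2_involution[OF g H0] by simp
  moreover have "K = g (g K)" using K is_g2_involution[OF g] by (simp add: weight_cell_def)
  ultimately show "K \<in> g ` weight_cell w H\<^sub>0" by blast
qed (use is_g2_weight_cell_subset[OF g w] in blast)

text \<open>Membership in a cell yields a reduced basis, and a reduced basis certifies membership.
  What remains for two weights is a comparison of which coefficients are forced to vanish.\<close>

lemma weight_cell_subset:
  assumes R0: "monomial_minors R\<^sub>0 I" and syz: "syzygies_are_rows R\<^sub>0 a\<^sub>1 k\<^sub>1 a\<^sub>2 k\<^sub>2"
    and low: "\<And>R \<kappa> b m. reduced R I \<kappa> \<Longrightarrow> \<forall>b m. weight w (I b) < weight w m \<longrightarrow> minor R b $ m = 0 \<Longrightarrow>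
      m \<noteq> I b \<Longrightarrow> m \<noteq> prod.swap (I b) \<Longrightarrow> weight w' (I b) \<le> weight w' m \<Longrightarrow> minor R b $ m = 0"
  shows "weight_cell w (minor_net R\<^sub>0) \<subseteq> weight_cell w' (minor_net R\<^sub>0)"
proof
  fix H assume "H \<in> weight_cell w (minor_net R\<^sub>0)"
  then show "H \<in> weight_cell w' (minor_net R\<^sub>0)"
  proof (rule weight_cell_reduced[OF R0])
    fix R \<kappa> assume R: "reduced R I \<kappa>" "minor_net R = H"
      and z: "\<And>b m. weight w (I b) < weight w m \<Longrightarrow> minor R b $ m = 0"
    have "minor_net R \<in> weight_cell w' (minor_net R\<^sub>0)"
      by (rule reduced_weight_cell[OF R0 syz R(1)]) (use low[OF R(1)] z in blast)
    then show ?thesis using R(2) by simp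
  qed
qed

section \<open>Explicit matrices and the two weight systems\<close>

definition triple :: "'a \<Rightarrow> 'a \<Rightarrow> 'a \<Rightarrow> 3 \<Rightarrow> 'a" where
  "triple a b c j = (if j = 1 then a else if j = 2 then b else c)"

lemma triple_simps [simp]: "triple a b c 1 = a" "triple a b c 2 = b" "triple a b c 3 = c"
  by (simp_all add: triple_def)

definition two_rows :: "(3 \<Rightarrow> W) \<Rightarrow> (3 \<Rightarrow> W) \<Rightarrow> W_matrix" where
  "two_rows u v = (\<chi> i j. if i = 1 then u j else v j)"

lemma two_rows_nth [simp]: "two_rows u v $ 1 $ j = u j" "two_rows u v $ 2 $ j = v j"
  by (simp_all add: two_rows_def)

lemma W_basis_nth [simp]:
  "x\<^sub>W $ 1 = 1" "x\<^sub>W $ 2 = 0" "x\<^sub>W $ 3 = 0" "y\<^sub>W $ 1 = 0" "y\<^sub>W $ 2 = 1" "y\<^sub>W $ 3 = 0"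
  "z\<^sub>W $ 1 = 0" "z\<^sub>W $ 2 = 0" "z\<^sub>W $ 3 = 1"
  by (simp_all add: x\<^sub>W_def y\<^sub>W_def z\<^sub>W_def axis_def)

lemma minor_net_eq_net:
  assumes "R \<in> stable_matrices" "\<And>j. minor R j \<in> \<langle>p, q, r\<rangle>"
  shows "minor_net R = \<langle>p, q, r\<rangle>"
proof -
  have "range (triple p q r) = {p, q, r}" unfolding UNIV_3 by auto
  then show ?thesis
    using assms span_triple_eqI[of "minor R" "triple p q r"] by (simp add: net_def minor_net_def stable_matrices_def)
qed

abbreviation weights_g2 :: "3 \<Rightarrow> nat" where "weights_g2 \<equiv> triple 0 2 3"
abbreviation weights_torus :: "3 \<Rightarrow> nat" where "weights_torus \<equiv> triple 0 1 3"

lemma cell_eq: "cell H = weight_cell weights_torus H"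
proof -
  have "torus t = weight_matrix weights_torus t" for t
    by (simp add: torus_def weight_matrix_def vec_eq_iff forall_3 vector_3)
  then show ?thesis by (simp add: cell_def weight_cell_def)
qed

text \<open>As \<open>g\<^sub>2\<close> swaps the two tori, it suffices to compare the cells at one of the two fixed points. This
  spares the treatment of \<open>\<langle>y\<^sup>2, xy, yz\<rangle>\<close>, whose minors have a third linear syzygy.\<close>

lemma is_g2_exchange:
  assumes g: "is_g2 g" and R: "R \<in> stable_matrices" and S: "S \<in> stable_matrices" and orth: "gram S R = 0"
    and cells: "weight_cell weights_torus (minor_net R) = weight_cell weights_g2 (minor_net R)"
  shows "g ` cell (minor_net R) = cell (minor_net S)" "g ` cell (minor_net S) = cell (minor_net R)"
proof -
  have w: "dual_weights weights_g2 weights_torus 3" "dual_weights weights_torus weights_g2 3"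
    by (simp_all add: dual_weights_def)
  have gR: "g (minor_net R) = minor_net S" by (rule is_g2_minor_net[OF g R S orth])
  have Y: "minor_net R \<in> Y" "minor_net S \<in> Y" using R S by (auto simp: Y_def)
  have gS: "g (minor_net S) = minor_net R" using is_g2_involution[OF g Y(1)] gR by simp
  show "g ` cell (minor_net R) = cell (minor_net S)"
    unfolding cell_eq cells using is_g2_weight_cell[OF g w(2) w(1) Y(1)] gR by simp
  show "g ` cell (minor_net S) = cell (minor_net R)"
    unfolding cell_eq cells using is_g2_weight_cell[OF g w(1) w(2) Y(2)] gS by simp
qed

section \<open>The fixed points\<close>

lemma minor_two_rows_nth:
  "minor (two_rows u v) j $ (i, k) = (u (j + 1) $ i * v (j + 2) $ k + v (j + 2) $ i * u (j + 1) $ k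
   - u (j + 2) $ i * v (j + 1) $ k - v (j + 1) $ i * u (j + 2) $ k) / 2"
  by (simp add: minor_nth)

lemma ex_3: "(\<exists>i :: 3. P i) \<longleftrightarrow> P 1 \<or> P 2 \<or> P 3"
  using forall_3[of "\<lambda>i. \<not> P i"] by blast

lemma stable_if_pluecker: "pluecker I (minor R) \<noteq> 0 \<Longrightarrow> R \<in> stable_matrices"
  by (simp add: stable_matrices_def pluecker_nonzero)

lemma monomial_minors_rowsI:
  assumes "pluecker I (minor R) \<noteq> 0"
    "\<forall>a b. minor R b $ I a \<noteq> 0 \<longleftrightarrow> a = b"
    "\<forall>b i k. (i, k) \<noteq> I b \<longrightarrow> (i, k) \<noteq> prod.swap (I b) \<longrightarrow> minor R b $ (i, k) = 0"
  shows "monomial_minors R I"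
  using assms stable_if_pluecker by (auto simp: monomial_minors_def)

abbreviation "R_e3 \<equiv> two_rows (triple 0 x\<^sub>W y\<^sub>W) (triple z\<^sub>W y\<^sub>W 0)"
abbreviation "R_e2 \<equiv> two_rows (triple 0 x\<^sub>W z\<^sub>W) (triple y\<^sub>W z\<^sub>W 0)"
abbreviation "R_f1 \<equiv> two_rows (triple 0 x\<^sub>W z\<^sub>W) (triple x\<^sub>W z\<^sub>W 0)"
abbreviation "R_f2 \<equiv> two_rows (triple 0 x\<^sub>W y\<^sub>W) (triple z\<^sub>W 0 y\<^sub>W)"
abbreviation "R_h3 \<equiv> two_rows (triple 0 x\<^sub>W y\<^sub>W) (triple y\<^sub>W 0 z\<^sub>W)"
abbreviation "R_h2 \<equiv> two_rows (triple 0 x\<^sub>W y\<^sub>W) (triple x\<^sub>W z\<^sub>W 0)"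

abbreviation "I_e3 \<equiv> triple (2, 2) (2, 3) (1, 3)"
abbreviation "I_e2 \<equiv> triple (3, 3) (2, 3) (1, 2)"
abbreviation "I_f1 \<equiv> triple (3, 3) (1, 3) (1, 1)"
abbreviation "I_f2 \<equiv> triple (1, 2) (2, 3) (1, 3)"
abbreviation "I_h3 \<equiv> triple (1, 3) (2, 2) (1, 2)"
abbreviation "I_h2 \<equiv> triple (2, 3) (1, 2) (1, 1)"

lemma monomial_minors_base:
  "monomial_minors R_e3 I_e3" "monomial_minors R_e2 I_e2" "monomial_minors R_f1 I_f1"
  "monomial_minors R_f2 I_f2" "monomial_minors R_h3 I_h3" "monomial_minors R_h2 I_h2"
  by (rule monomial_minors_rowsI; simp add: forall_3 pluecker_def det_3 minor_two_rows_nth)+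

text \<open>The normalising entries are the x in column 2 of the first row, common to all six
  matrices, and the variable in column 1 of the second row.\<close>

lemma syzygies_base:
  "syzygies_are_rows R_e3 2 1 1 3" "syzygies_are_rows R_e2 2 1 1 2" "syzygies_are_rows R_f1 2 1 1 1"
  "syzygies_are_rows R_f2 2 1 1 3" "syzygies_are_rows R_h3 2 1 1 2" "syzygies_are_rows R_h2 2 1 1 1"
  by (simp add: syzygies_are_rows_def vec_eq_iff forall_3 syzygy_def sum_3 minor_two_rows_nth; auto)+

lemma reduced_facts:
  assumes "reduced R I \<kappa>"
  shows "\<kappa> \<noteq> 0" "minor R b $ I a = (if a = b then \<kappa> else 0)" "minor R b $ prod.swap (I a) = (if a = b then \<kappa> else 0)"
  using assms by (auto simp: reduced_def minor_symmetric)

text \<open>The two orders of the monomials differ only in \<open>y\<^sup>2\<close> and \<open>xz\<close>, which matters only if exactly one of them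
  is a leading monomial.\<close>

lemma weight_cell_base_same:
  "weight_cell weights_torus (minor_net R_e3) = weight_cell weights_g2 (minor_net R_e3)"
  "weight_cell weights_torus (minor_net R_e2) = weight_cell weights_g2 (minor_net R_e2)"
  "weight_cell weights_torus (minor_net R_h3) = weight_cell weights_g2 (minor_net R_h3)"
  "weight_cell weights_torus (minor_net R_h2) = weight_cell weights_g2 (minor_net R_h2)"
proof -
  \<comment> \<open>By \<open>cond\<close>, a position that must vanish for \<open>w'\<close> either
    lies strictly above the leading one for \<open>w\<close>, or is the leading position of another
    quadric, where a reduced basis has coefficient zero.\<close>
  have low: "minor R b $ m = 0"
    if R: "reduced R I \<kappa>" and z: "\<forall>b m. weight w (I b) < weight w m \<longrightarrow> minor R b $ m = 0"
      and m: "m \<noteq> I b" "m \<noteq> prod.swap (I b)" "weight w' (I b) \<le> weight w' m"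
      and cond: "\<forall>b i k. (i, k) \<noteq> I b \<longrightarrow> (i, k) \<noteq> prod.swap (I b) \<longrightarrow> weight w' (I b) \<le> weight w' (i, k) \<longrightarrow>
        weight w (I b) < weight w (i, k) \<or> (\<exists>a. a \<noteq> b \<and> ((i, k) = I a \<or> (i, k) = prod.swap (I a)))"
    for R I \<kappa> b m w w'
  proof -
    have "weight w (I b) < weight w m \<or> (\<exists>a. a \<noteq> b \<and> (m = I a \<or> m = prod.swap (I a)))"
      using cond[rule_format, of "fst m" "snd m" b] m by simp
    then show ?thesis
    proof (elim disjE exE conjE)
      assume "weight w (I b) < weight w m" then show ?thesis using z by blast
    qed (use reduced_facts[OF R] in simp_all)
  qed
  have eq: "weight_cell weights_torus (minor_net R\<^sub>0) = weight_cell weights_g2 (minor_net R\<^sub>0)"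
    if R0: "monomial_minors R\<^sub>0 I" "syzygies_are_rows R\<^sub>0 a\<^sub>1 k\<^sub>1 a\<^sub>2 k\<^sub>2"
      and cond: "\<forall>b i k. (i, k) \<noteq> I b \<longrightarrow> (i, k) \<noteq> prod.swap (I b) \<longrightarrow> weight weights_g2 (I b) \<le> weight weights_g2 (i, k) \<longrightarrow>
        weight weights_torus (I b) < weight weights_torus (i, k) \<or> (\<exists>a. a \<noteq> b \<and> ((i, k) = I a \<or> (i, k) = prod.swap (I a)))"
        "\<forall>b i k. (i, k) \<noteq> I b \<longrightarrow> (i, k) \<noteq> prod.swap (I b) \<longrightarrow> weight weights_torus (I b) \<le> weight weights_torus (i, k) \<longrightarrow>
        weight weights_g2 (I b) < weight weights_g2 (i, k) \<or> (\<exists>a. a \<noteq> b \<and> ((i, k) = I a \<or> (i, k) = prod.swap (I a)))"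
    for R\<^sub>0 I a\<^sub>1 k\<^sub>1 a\<^sub>2 k\<^sub>2
    by (intro subset_antisym weight_cell_subset[OF R0] low; (assumption | rule cond))
  show "weight_cell weights_torus (minor_net R_e3) = weight_cell weights_g2 (minor_net R_e3)"
    by (rule eq[OF monomial_minors_base(1) syzygies_base(1)]; simp add: forall_3 weight_def ex_3)
  show "weight_cell weights_torus (minor_net R_e2) = weight_cell weights_g2 (minor_net R_e2)"
    by (rule eq[OF monomial_minors_base(2) syzygies_base(2)]; simp add: forall_3 weight_def ex_3)
  show "weight_cell weights_torus (minor_net R_h3) = weight_cell weights_g2 (minor_net R_h3)"
    by (rule eq[OF monomial_minors_base(5) syzygies_base(5)]; simp add: forall_3 weight_def ex_3)
  show "weight_cell weights_torus (minor_net R_h2) = weight_cell weights_g2 (minor_net R_h2)"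
    by (rule eq[OF monomial_minors_base(6) syzygies_base(6)]; simp add: forall_3 weight_def ex_3)
qed

text \<open>A nonzero coefficient of \<open>y\<^sup>2\<close> in the quadric led by \<open>xz\<close> would leave fewer than two independent
  linear syzygies, whereas the rows of a stable matrix are two.\<close>

lemma reduced_f1:
  assumes R: "reduced R I_f1 \<kappa>"
    and z: "\<forall>b m. weight weights_torus (I_f1 b) < weight weights_torus m \<longrightarrow> minor R b $ m = 0"
  shows "minor R 2 $ (2, 2) = 0"
proof (rule ccontr)
  assume d: "minor R 2 $ (2, 2) \<noteq> 0"
  have sR: "R \<in> stable_matrices" and \<kappa>: "\<kappa> \<noteq> 0" using R by (auto simp: reduced_def)
  have v: "minor R 1 $ (3, 3) = \<kappa>" "minor R 1 $ (1, 3) = 0" "minor R 1 $ (1, 1) = 0"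
    "minor R 2 $ (1, 3) = \<kappa>" "minor R 2 $ (3, 3) = 0" "minor R 2 $ (1, 1) = 0"
    "minor R 3 $ (1, 1) = \<kappa>" "minor R 3 $ (1, 3) = 0" "minor R 3 $ (3, 3) = 0"
    using reduced_facts(2)[OF R, of _ 1] reduced_facts(2)[OF R, of _ 2] reduced_facts(2)[OF R, of _ 3]
    by (metis triple_simps num.distinct(1) one_neq_zero zero_neq_numeral numeral_eq_iff num.inject)+
  have s: "minor R b $ (3, 1) = minor R b $ (1, 3)" "minor R b $ (2, 1) = minor R b $ (1, 2)"
    "minor R b $ (3, 2) = minor R b $ (2, 3)" for b
    using minor_symmetric[of R b "(1, 3)"] minor_symmetric[of R b "(1, 2)"] minor_symmetric[of R b "(2, 3)"] by simp_all
  have z': "minor R 2 $ (2, 3) = 0" "minor R 3 $ (2, 3) = 0" "minor R 3 $ (2, 2) = 0" "minor R 3 $ (1, 2) = 0"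
    using z by (simp_all add: weight_def)
  \<comment> \<open>With this coefficient nonzero every linear syzygy vanishes, so a single row
    gives the contradiction.\<close>
  define r where "r = R $ 1"
  have "syzygy (minor R) r $ i $ j $ k = 0" for i j k by (simp add: r_def syzygy_minor)
  then have eq: "r $ 1 $ i * minor R 1 $ (j, k) + r $ 1 $ j * minor R 1 $ (i, k) + r $ 1 $ k * minor R 1 $ (i, j)
      + (r $ 2 $ i * minor R 2 $ (j, k) + r $ 2 $ j * minor R 2 $ (i, k) + r $ 2 $ k * minor R 2 $ (i, j))
      + (r $ 3 $ i * minor R 3 $ (j, k) + r $ 3 $ j * minor R 3 $ (i, k) + r $ 3 $ k * minor R 3 $ (i, j)) = 0" for i j k
    by (simp add: syzygy_def sum_3)
  \<comment> \<open>The three indices name a cubic monomial; each equation is chosen to contain just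
    one entry of \<open>r\<close> that is still unknown.\<close>
  have z1: "r $ 1 $ 3 = 0" using eq[of 3 3 3] \<kappa> by (simp add: v)
  have y1: "r $ 1 $ 2 = 0" using eq[of 2 3 3] \<kappa> z1 by (simp add: v s z')
  have y2: "r $ 2 $ 2 = 0" using eq[of 2 2 2] d y1 by (simp add: v s z')
  have z2: "r $ 2 $ 3 = 0" using eq[of 2 2 3] d y1 z1 y2 by (simp add: v s z')
  have x1: "r $ 1 $ 1 = 0" using eq[of 1 3 3] \<kappa> z1 z2 by (simp add: v s z')
  have x2: "r $ 2 $ 1 = 0" using eq[of 1 2 2] d x1 y1 y2 by (simp add: v s z')
  have x3: "r $ 3 $ 1 = 0" using eq[of 1 1 1] \<kappa> x1 x2 by (simp add: v s z')
  have y3: "r $ 3 $ 2 = 0" using eq[of 1 1 2] \<kappa> x1 x2 y1 y2 by (simp add: v s z')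
  have z3: "r $ 3 $ 3 = 0" using eq[of 1 1 3] \<kappa> x1 x2 z1 z2 by (simp add: v s z')
  have "r = 0" using x1 x2 x3 y1 y2 y3 z1 z2 z3 by (simp add: vec_eq_iff forall_3)
  then have "1 *s R $ 1 $ j + 0 *s R $ 2 $ j = 0" for j by (simp add: r_def)
  from stable_rows_independent[OF sR this] show False by simp
qed

text \<open>A nonzero coefficient here may leave one syzygy. Those with \<open>r $ 2 $ 1 = 0\<close>
  all vanish, so the space of syzygies has dimension at most one, too small for two independent
  rows.\<close>

lemma reduced_f2:
  assumes R: "reduced R I_f2 \<kappa>"
    and z: "\<forall>b m. weight weights_torus (I_f2 b) < weight weights_torus m \<longrightarrow> minor R b $ m = 0"
  shows "minor R 3 $ (2, 2) = 0"
proof (rule ccontr)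
  assume d: "minor R 3 $ (2, 2) \<noteq> 0"
  have sR: "R \<in> stable_matrices" and \<kappa>: "\<kappa> \<noteq> 0" using R by (auto simp: reduced_def)
  have v: "minor R 1 $ (1, 2) = \<kappa>" "minor R 1 $ (2, 3) = 0" "minor R 1 $ (1, 3) = 0"
    "minor R 2 $ (2, 3) = \<kappa>" "minor R 2 $ (1, 2) = 0" "minor R 2 $ (1, 3) = 0"
    "minor R 3 $ (1, 3) = \<kappa>" "minor R 3 $ (1, 2) = 0" "minor R 3 $ (2, 3) = 0"
    using reduced_facts(2)[OF R, of _ 1] reduced_facts(2)[OF R, of _ 2] reduced_facts(2)[OF R, of _ 3]
    by (metis triple_simps num.distinct(1) one_neq_zero zero_neq_numeral numeral_eq_iff num.inject)+
  have s: "minor R b $ (3, 1) = minor R b $ (1, 3)" "minor R b $ (2, 1) = minor R b $ (1, 2)"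
    "minor R b $ (3, 2) = minor R b $ (2, 3)" for b
    using minor_symmetric[of R b "(1, 3)"] minor_symmetric[of R b "(1, 2)"] minor_symmetric[of R b "(2, 3)"] by simp_all
  have z': "minor R 1 $ (2, 2) = 0" "minor R 1 $ (3, 3) = 0" "minor R 2 $ (3, 3) = 0" "minor R 3 $ (3, 3) = 0"
    using z by (simp_all add: weight_def)
  \<comment> \<open>A nontrivial row combination is chosen whose entry in column 2 has no x.\<close>
  obtain \<alpha> \<beta> where ab: "\<alpha> \<noteq> 0 \<or> \<beta> \<noteq> 0" "\<alpha> * R $ 1 $ 2 $ 1 + \<beta> * R $ 2 $ 2 $ 1 = 0"
  proof (cases "R $ 1 $ 2 $ 1 = 0")
    case True then show thesis using that[of 1 0] by simp
  next
    case False then show thesis using that[of "R $ 2 $ 2 $ 1" "- R $ 1 $ 2 $ 1"] by simp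
  qed
  define r where "r = (\<chi> a. \<alpha> *s R $ 1 $ a + \<beta> *s R $ 2 $ a)"
  have "syzygy (minor R) r $ i $ j $ k = 0" for i j k by (simp add: r_def syzygy_lin syzygy_minor)
  then have eq: "r $ 1 $ i * minor R 1 $ (j, k) + r $ 1 $ j * minor R 1 $ (i, k) + r $ 1 $ k * minor R 1 $ (i, j)
      + (r $ 2 $ i * minor R 2 $ (j, k) + r $ 2 $ j * minor R 2 $ (i, k) + r $ 2 $ k * minor R 2 $ (i, j))
      + (r $ 3 $ i * minor R 3 $ (j, k) + r $ 3 $ j * minor R 3 $ (i, k) + r $ 3 $ k * minor R 3 $ (i, j)) = 0" for i j k
    by (simp add: syzygy_def sum_3)
  have x2: "r $ 2 $ 1 = 0" using ab(2) by (simp add: r_def)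
  have z2: "r $ 2 $ 3 = 0" using eq[of 2 3 3] \<kappa> by (simp add: v s z')
  have z3: "r $ 3 $ 3 = 0" using eq[of 1 3 3] \<kappa> by (simp add: v s z')
  have y2: "r $ 2 $ 2 = 0" using eq[of 2 2 3] \<kappa> z2 z3 by (simp add: v s z')
  have y3: "r $ 3 $ 2 = 0" using eq[of 2 2 2] d y2 by (simp add: v s z')
  have z1: "r $ 1 $ 3 = 0" using eq[of 1 2 3] \<kappa> x2 y3 by (simp add: v s z')
  have x3: "r $ 3 $ 1 = 0" using eq[of 1 1 3] \<kappa> z1 z2 z3 x2 by (simp add: v s z')
  have y1: "r $ 1 $ 2 = 0" using eq[of 1 2 2] \<kappa> x2 x3 y2 y3 by (simp add: v s z')
  have x1: "r $ 1 $ 1 = 0" using eq[of 1 1 2] \<kappa> y1 y2 y3 x2 x3 by (simp add: v s z')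
  have "r = 0" using x1 x2 x3 y1 y2 y3 z1 z2 z3 by (simp add: vec_eq_iff forall_3)
  then have "\<alpha> *s R $ 1 $ j + \<beta> *s R $ 2 $ j = 0" for j by (simp add: r_def vec_eq_iff)
  from stable_rows_independent[OF sR this] ab(1) show False by simp
qed

text \<open>Here xz leads a quadric and y^2 leads none. For the weights (0, 1, 3) y^2 lies below xz,
  for (0, 2, 3) above it. Thus only the inclusion into the cell for (0, 2, 3) needs the vanishing of
  a coefficient of y^2 that the reduced basis does not give.\<close>

lemma weight_cell_base_f:
  "weight_cell weights_torus (minor_net R_f1) = weight_cell weights_g2 (minor_net R_f1)"
  "weight_cell weights_torus (minor_net R_f2) = weight_cell weights_g2 (minor_net R_f2)"
proof -
  have eq: "weight_cell weights_torus (minor_net R\<^sub>0) = weight_cell weights_g2 (minor_net R\<^sub>0)"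
    if R0: "monomial_minors R\<^sub>0 I" "syzygies_are_rows R\<^sub>0 a\<^sub>1 k\<^sub>1 a\<^sub>2 k\<^sub>2"
      and d: "\<And>R \<kappa>. reduced R I \<kappa> \<Longrightarrow> \<forall>b m. weight weights_torus (I b) < weight weights_torus m \<longrightarrow> minor R b $ m = 0
         \<Longrightarrow> minor R c $ (2, 2) = 0"
      and cond: "\<forall>b i k. (i, k) \<noteq> I b \<longrightarrow> (i, k) \<noteq> prod.swap (I b) \<longrightarrow> weight weights_g2 (I b) \<le> weight weights_g2 (i, k) \<longrightarrow>
        weight weights_torus (I b) < weight weights_torus (i, k) \<or> (\<exists>a. a \<noteq> b \<and> ((i, k) = I a \<or> (i, k) = prod.swap (I a)))
          \<or> b = c \<and> (i, k) = (2, 2)"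
        "\<forall>b i k. (i, k) \<noteq> I b \<longrightarrow> (i, k) \<noteq> prod.swap (I b) \<longrightarrow> weight weights_torus (I b) \<le> weight weights_torus (i, k) \<longrightarrow>
        weight weights_g2 (I b) < weight weights_g2 (i, k) \<or> (\<exists>a. a \<noteq> b \<and> ((i, k) = I a \<or> (i, k) = prod.swap (I a)))"
    for R\<^sub>0 I a\<^sub>1 k\<^sub>1 a\<^sub>2 k\<^sub>2 c
  proof (intro subset_antisym weight_cell_subset[OF R0])
    fix R \<kappa> b m
    assume R: "reduced R I \<kappa>" and z: "\<forall>b m. weight weights_torus (I b) < weight weights_torus m \<longrightarrow> minor R b $ m = 0"
      and m: "m \<noteq> I b" "m \<noteq> prod.swap (I b)" "weight weights_g2 (I b) \<le> weight weights_g2 m"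
    have "weight weights_torus (I b) < weight weights_torus m \<or> (\<exists>a. a \<noteq> b \<and> (m = I a \<or> m = prod.swap (I a))) \<or> b = c \<and> m = (2, 2)"
      using cond(1)[rule_format, of "fst m" "snd m" b] m by simp
    then show "minor R b $ m = 0"
    proof (elim disjE exE conjE)
      assume "weight weights_torus (I b) < weight weights_torus m" then show ?thesis using z by blast
    qed (use reduced_facts[OF R] d[OF R z] in simp_all)
  next
    fix R \<kappa> b m
    assume R: "reduced R I \<kappa>" and z: "\<forall>b m. weight weights_g2 (I b) < weight weights_g2 m \<longrightarrow> minor R b $ m = 0"
      and m: "m \<noteq> I b" "m \<noteq> prod.swap (I b)" "weight weights_torus (I b) \<le> weight weights_torus m"
    have "weight weights_g2 (I b) < weight weights_g2 m \<or> (\<exists>a. a \<noteq> b \<and> (m = I a \<or> m = prod.swap (I a)))"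
      using cond(2)[rule_format, of "fst m" "snd m" b] m by simp
    then show "minor R b $ m = 0"
    proof (elim disjE exE conjE)
      assume "weight weights_g2 (I b) < weight weights_g2 m" then show ?thesis using z by blast
    qed (use reduced_facts[OF R] in simp_all)
  qed
  show "weight_cell weights_torus (minor_net R_f1) = weight_cell weights_g2 (minor_net R_f1)"
    by (rule eq[OF monomial_minors_base(3) syzygies_base(3), of 2]; (rule reduced_f1; assumption)?; simp add: forall_3 weight_def ex_3)
  show "weight_cell weights_torus (minor_net R_f2) = weight_cell weights_g2 (minor_net R_f2)"
    by (rule eq[OF monomial_minors_base(4) syzygies_base(4), of 3]; (rule reduced_f2; assumption)?; simp add: forall_3 weight_def ex_3)
qed

section \<open>The annihilators of the six matrices\<close>

text \<open>The only nonzero pairings of basis vectors are x with z and y with y. In the third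
  column the contributions of the two rows can both be nonzero, and the minus sign cancels
  them.\<close>

abbreviation "S_e1 \<equiv> two_rows (triple 0 x\<^sub>W z\<^sub>W) (triple z\<^sub>W 0 (- y\<^sub>W))"
abbreviation "S_e2 \<equiv> two_rows (triple 0 y\<^sub>W z\<^sub>W) (triple z\<^sub>W 0 (- x\<^sub>W))"
abbreviation "S_f3 \<equiv> two_rows (triple 0 y\<^sub>W z\<^sub>W) (triple y\<^sub>W 0 (- x\<^sub>W))"
abbreviation "S_f2 \<equiv> two_rows (triple 0 x\<^sub>W y\<^sub>W) (triple z\<^sub>W 0 (- y\<^sub>W))"
abbreviation "S_h1 \<equiv> two_rows (triple 0 x\<^sub>W y\<^sub>W) (triple z\<^sub>W 0 (- x\<^sub>W))"
abbreviation "S_h2 \<equiv> two_rows (triple 0 x\<^sub>W z\<^sub>W) (triple y\<^sub>W 0 (- x\<^sub>W))"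

lemma stable_base: 
  "R_e3 \<in> stable_matrices" "R_e2 \<in> stable_matrices" "R_f1 \<in> stable_matrices"
  "R_f2 \<in> stable_matrices" "R_h3 \<in> stable_matrices" "R_h2 \<in> stable_matrices"
  using monomial_minors_base by (simp_all add: monomial_minors_def)

lemma stable_dual:
  "S_e1 \<in> stable_matrices" "S_e2 \<in> stable_matrices" "S_f3 \<in> stable_matrices"
  "S_f2 \<in> stable_matrices" "S_h1 \<in> stable_matrices" "S_h2 \<in> stable_matrices"
proof -
  show "S_e1 \<in> stable_matrices"
    by (rule stable_if_pluecker[of "triple (1, 2) (3, 3) (1, 3)"]) (simp add: pluecker_def det_3 minor_two_rows_nth)
  show "S_e2 \<in> stable_matrices"
    by (rule stable_if_pluecker[of "triple (1, 2) (3, 3) (2, 3)"]) (simp add: pluecker_def det_3 minor_two_rows_nth)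
  show "S_f3 \<in> stable_matrices"
    by (rule stable_if_pluecker[of "triple (1, 2) (2, 3) (2, 2)"]) (simp add: pluecker_def det_3 minor_two_rows_nth)
  show "S_f2 \<in> stable_matrices"
    by (rule stable_if_pluecker[of "triple (1, 2) (2, 3) (1, 3)"]) (simp add: pluecker_def det_3 minor_two_rows_nth)
  show "S_h1 \<in> stable_matrices"
    by (rule stable_if_pluecker[of "triple (1, 1) (2, 3) (1, 3)"]) (simp add: pluecker_def det_3 minor_two_rows_nth)
  show "S_h2 \<in> stable_matrices"
    by (rule stable_if_pluecker[of "triple (1, 1) (2, 3) (1, 2)"]) (simp add: pluecker_def det_3 minor_two_rows_nth)
qed

lemma gram_base:
  "gram S_e1 R_e3 = 0" "gram S_e2 R_e2 = 0" "gram S_f3 R_f1 = 0"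
  "gram S_f2 R_f2 = 0" "gram S_h1 R_h3 = 0" "gram S_h2 R_h2 = 0"
  by (simp_all add: gram_def vec_eq_iff forall_3 J_pair_def)

lemma minor_net_eq_netI:
  assumes R: "R \<in> stable_matrices"
    and cases: "\<And>j. minor R j \<in> {p, - p, q, - q, r, - r}"
  shows "minor_net R = \<langle>p, q, r\<rangle>"
proof (rule minor_net_eq_net[OF R])
  show "minor R j \<in> \<langle>p, q, r\<rangle>" for j
    using cases[of j] unfolding net_def by (elim insertE emptyE; simp add: vec.span_neg vec.span_base)
qed

lemma minor_base:
  "minor R_e3 = triple (- (y\<^sub>W \<odot> y\<^sub>W)) (y\<^sub>W \<odot> z\<^sub>W) (- (x\<^sub>W \<odot> z\<^sub>W))"
  "minor R_e2 = triple (- (z\<^sub>W \<odot> z\<^sub>W)) (y\<^sub>W \<odot> z\<^sub>W) (- (x\<^sub>W \<odot> y\<^sub>W))"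
  "minor R_f1 = triple (- (z\<^sub>W \<odot> z\<^sub>W)) (x\<^sub>W \<odot> z\<^sub>W) (- (x\<^sub>W \<odot> x\<^sub>W))"
  "minor R_f2 = triple (x\<^sub>W \<odot> y\<^sub>W) (y\<^sub>W \<odot> z\<^sub>W) (- (x\<^sub>W \<odot> z\<^sub>W))"
  "minor R_h3 = triple (x\<^sub>W \<odot> z\<^sub>W) (y\<^sub>W \<odot> y\<^sub>W) (- (x\<^sub>W \<odot> y\<^sub>W))"
  "minor R_h2 = triple (- (y\<^sub>W \<odot> z\<^sub>W)) (x\<^sub>W \<odot> y\<^sub>W) (- (x\<^sub>W \<odot> x\<^sub>W))"
  "minor S_e1 = triple (- (x\<^sub>W \<odot> y\<^sub>W)) (z\<^sub>W \<odot> z\<^sub>W) (- (x\<^sub>W \<odot> z\<^sub>W))"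
  "minor S_f3 = triple (- (x\<^sub>W \<odot> y\<^sub>W)) (y\<^sub>W \<odot> z\<^sub>W) (- (y\<^sub>W \<odot> y\<^sub>W))"
  "minor S_h1 = triple (- (x\<^sub>W \<odot> x\<^sub>W)) (y\<^sub>W \<odot> z\<^sub>W) (- (x\<^sub>W \<odot> z\<^sub>W))"
  "minor S_e2 = triple (- (x\<^sub>W \<odot> y\<^sub>W)) (z\<^sub>W \<odot> z\<^sub>W) (- (y\<^sub>W \<odot> z\<^sub>W))"
  "minor S_f2 = triple (- (x\<^sub>W \<odot> y\<^sub>W)) (y\<^sub>W \<odot> z\<^sub>W) (- (x\<^sub>W \<odot> z\<^sub>W))"
  "minor S_h2 = triple (- (x\<^sub>W \<odot> x\<^sub>W)) (y\<^sub>W \<odot> z\<^sub>W) (- (x\<^sub>W \<odot> y\<^sub>W))"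
  by (simp_all add: fun_eq_iff forall_3 vec_eq_iff split_paired_All minor_two_rows_nth sym_mult_nth)

lemma minor_net_base:
  "minor_net S_e1 = \<langle>z\<^sub>W \<odot> z\<^sub>W, x\<^sub>W \<odot> z\<^sub>W, x\<^sub>W \<odot> y\<^sub>W\<rangle>"
  "minor_net R_e2 = \<langle>z\<^sub>W \<odot> z\<^sub>W, y\<^sub>W \<odot> z\<^sub>W, x\<^sub>W \<odot> y\<^sub>W\<rangle>"
  "minor_net S_e2 = \<langle>z\<^sub>W \<odot> z\<^sub>W, y\<^sub>W \<odot> z\<^sub>W, x\<^sub>W \<odot> y\<^sub>W\<rangle>"
  "minor_net R_e3 = \<langle>y\<^sub>W \<odot> y\<^sub>W, y\<^sub>W \<odot> z\<^sub>W, x\<^sub>W \<odot> z\<^sub>W\<rangle>"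
  "minor_net R_f1 = \<langle>z\<^sub>W \<odot> z\<^sub>W, x\<^sub>W \<odot> z\<^sub>W, x\<^sub>W \<odot> x\<^sub>W\<rangle>"
  "minor_net R_f2 = \<langle>y\<^sub>W \<odot> z\<^sub>W, x\<^sub>W \<odot> z\<^sub>W, x\<^sub>W \<odot> y\<^sub>W\<rangle>"
  "minor_net S_f2 = \<langle>y\<^sub>W \<odot> z\<^sub>W, x\<^sub>W \<odot> z\<^sub>W, x\<^sub>W \<odot> y\<^sub>W\<rangle>"
  "minor_net S_f3 = \<langle>y\<^sub>W \<odot> y\<^sub>W, x\<^sub>W \<odot> y\<^sub>W, y\<^sub>W \<odot> z\<^sub>W\<rangle>"
  "minor_net S_h1 = \<langle>x\<^sub>W \<odot> x\<^sub>W, x\<^sub>W \<odot> z\<^sub>W, y\<^sub>W \<odot> z\<^sub>W\<rangle>"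
  "minor_net R_h2 = \<langle>x\<^sub>W \<odot> x\<^sub>W, x\<^sub>W \<odot> y\<^sub>W, y\<^sub>W \<odot> z\<^sub>W\<rangle>"
  "minor_net S_h2 = \<langle>x\<^sub>W \<odot> x\<^sub>W, x\<^sub>W \<odot> y\<^sub>W, y\<^sub>W \<odot> z\<^sub>W\<rangle>"
  "minor_net R_h3 = \<langle>x\<^sub>W \<odot> y\<^sub>W, x\<^sub>W \<odot> z\<^sub>W, y\<^sub>W \<odot> y\<^sub>W\<rangle>"
proof -
  show "minor_net S_e1 = \<langle>z\<^sub>W \<odot> z\<^sub>W, x\<^sub>W \<odot> z\<^sub>W, x\<^sub>W \<odot> y\<^sub>W\<rangle>"
    by (rule minor_net_eq_netI[OF stable_dual(1)]) (simp add: minor_base triple_def)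
  show "minor_net R_e2 = \<langle>z\<^sub>W \<odot> z\<^sub>W, y\<^sub>W \<odot> z\<^sub>W, x\<^sub>W \<odot> y\<^sub>W\<rangle>"
    by (rule minor_net_eq_netI[OF stable_base(2)]) (simp add: minor_base triple_def)
  show "minor_net S_e2 = \<langle>z\<^sub>W \<odot> z\<^sub>W, y\<^sub>W \<odot> z\<^sub>W, x\<^sub>W \<odot> y\<^sub>W\<rangle>"
    by (rule minor_net_eq_netI[OF stable_dual(2)]) (simp add: minor_base triple_def)
  show "minor_net R_e3 = \<langle>y\<^sub>W \<odot> y\<^sub>W, y\<^sub>W \<odot> z\<^sub>W, x\<^sub>W \<odot> z\<^sub>W\<rangle>"
    by (rule minor_net_eq_netI[OF stable_base(1)]) (simp add: minor_base triple_def)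
  show "minor_net R_f1 = \<langle>z\<^sub>W \<odot> z\<^sub>W, x\<^sub>W \<odot> z\<^sub>W, x\<^sub>W \<odot> x\<^sub>W\<rangle>"
    by (rule minor_net_eq_netI[OF stable_base(3)]) (simp add: minor_base triple_def)
  show "minor_net R_f2 = \<langle>y\<^sub>W \<odot> z\<^sub>W, x\<^sub>W \<odot> z\<^sub>W, x\<^sub>W \<odot> y\<^sub>W\<rangle>"
    by (rule minor_net_eq_netI[OF stable_base(4)]) (simp add: minor_base triple_def)
  show "minor_net S_f2 = \<langle>y\<^sub>W \<odot> z\<^sub>W, x\<^sub>W \<odot> z\<^sub>W, x\<^sub>W \<odot> y\<^sub>W\<rangle>"
    by (rule minor_net_eq_netI[OF stable_dual(4)]) (simp add: minor_base triple_def)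
  show "minor_net S_f3 = \<langle>y\<^sub>W \<odot> y\<^sub>W, x\<^sub>W \<odot> y\<^sub>W, y\<^sub>W \<odot> z\<^sub>W\<rangle>"
    by (rule minor_net_eq_netI[OF stable_dual(3)]) (simp add: minor_base triple_def)
  show "minor_net S_h1 = \<langle>x\<^sub>W \<odot> x\<^sub>W, x\<^sub>W \<odot> z\<^sub>W, y\<^sub>W \<odot> z\<^sub>W\<rangle>"
    by (rule minor_net_eq_netI[OF stable_dual(5)]) (simp add: minor_base triple_def)
  show "minor_net R_h2 = \<langle>x\<^sub>W \<odot> x\<^sub>W, x\<^sub>W \<odot> y\<^sub>W, y\<^sub>W \<odot> z\<^sub>W\<rangle>"
    by (rule minor_net_eq_netI[OF stable_base(6)]) (simp add: minor_base triple_def)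
  show "minor_net S_h2 = \<langle>x\<^sub>W \<odot> x\<^sub>W, x\<^sub>W \<odot> y\<^sub>W, y\<^sub>W \<odot> z\<^sub>W\<rangle>"
    by (rule minor_net_eq_netI[OF stable_dual(6)]) (simp add: minor_base triple_def)
  show "minor_net R_h3 = \<langle>x\<^sub>W \<odot> y\<^sub>W, x\<^sub>W \<odot> z\<^sub>W, y\<^sub>W \<odot> y\<^sub>W\<rangle>"
    by (rule minor_net_eq_netI[OF stable_base(5)]) (simp add: minor_base triple_def)
qed

lemma interiors:
  "interior_e1 = cell (minor_net S_e1)" "interior_e2 = cell (minor_net R_e2)" "interior_e3 = cell (minor_net R_e3)"
  "interior_f1 = cell (minor_net R_f1)" "interior_f2 = cell (minor_net R_f2)" "interior_f3 = cell (minor_net S_f3)"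
  "interior_h1 = cell (minor_net S_h1)" "interior_h2 = cell (minor_net R_h2)" "interior_h3 = cell (minor_net R_h3)"
  unfolding minor_net_base interior_e1_def interior_e2_def interior_e3_def interior_f1_def interior_f2_def interior_f3_def
    interior_h1_def interior_h2_def interior_h3_def
  by (rule refl)+

text \<open>At these three fixed points the annihilator has the same net, so the exchange of two
  cells becomes invariance of one.\<close>

lemma self_dual: "minor_net S_e2 = minor_net R_e2" "minor_net S_f2 = minor_net R_f2" "minor_net S_h2 = minor_net R_h2"
  unfolding minor_net_base by (rule refl)+

theorem proposition4p6:
  fixes g\<^sub>2 :: "W_tensor_W set \<Rightarrow> W_tensor_W set"
  assumes "is_g2 g\<^sub>2"
  shows "g\<^sub>2 ` interior_e1 = interior_e3 \<and> g\<^sub>2 ` interior_e3 = interior_e1 \<and>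
         g\<^sub>2 ` interior_f1 = interior_f3 \<and> g\<^sub>2 ` interior_f3 = interior_f1 \<and>
         g\<^sub>2 ` interior_h1 = interior_h3 \<and> g\<^sub>2 ` interior_h3 = interior_h1 \<and>
         g\<^sub>2 ` interior_e2 = interior_e2 \<and> g\<^sub>2 ` interior_f2 = interior_f2 \<and> g\<^sub>2 ` interior_h2 = interior_h2"
  unfolding interiors
  using is_g2_exchange[OF assms stable_base(1) stable_dual(1) gram_base(1) weight_cell_base_same(1)]
    is_g2_exchange[OF assms stable_base(2) stable_dual(2) gram_base(2) weight_cell_base_same(2), unfolded self_dual]
    is_g2_exchange[OF assms stable_base(3) stable_dual(3) gram_base(3) weight_cell_base_f(1)]
    is_g2_exchange[OF assms stable_base(4) stable_dual(4) gram_base(4) weight_cell_base_f(2), unfolded self_dual]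
    is_g2_exchange[OF assms stable_base(5) stable_dual(5) gram_base(5) weight_cell_base_same(3)]
    is_g2_exchange[OF assms stable_base(6) stable_dual(6) gram_base(6) weight_cell_base_same(4), unfolded self_dual]
  by (intro conjI)

end
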